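(* Let $\mu$ be a probability distribution on $\mathbb{R}^d$ with finite second moments, and let $X \sim \mu$. Let $\delta_1, \delta_2, \dots > 0$ be step sizes, let $N_1, N_2, \dots$ be i.i.d. standard Gaussian vectors in $\mathbb{R}^d$ independent of $X$, and define the comparison process $Y_0 = 0$, $Y_k = Y_{k-1} + \delta_k X + \sqrt{\delta_k} N_k$ for $k \ge 1$. Let $f_1, f_2, \dots \colon \mathbb{R}^d \to \mathbb{R}^d$ be measurable functions, let $\tilde N_1, \tilde N_2, \dots$ be i.i.d. standard Gaussian vectors in $\mathbb{R}^d$, and define the sampling process $Z_0 = 0$, $Z_k = Z_{k-1} + \delta_k f_k(Z_{k-1}) + \sqrt{\delta_k}\tilde N_k$ for $k \ge 1$. Fix $n \ge 1$ and assume $\mathbb{E}\|f_k(Y_{k-1})\|^2 < \infty$ for all $k = 1, \dots, n$. Let $$\Delta_n = D\big(\mathrm{Law}(Y_1,\dots,Y_n) \,\|\, \mathrm{Law}(Z_1,\dots,Z_n)\big)$$ be the Kullback–Leibler divergence. Then $$\Delta_n \le \frac{\delta_{\max}}{2}\operatorname{tr}(\operatorname{cov}(X)) + \sum_{k=1}^n \frac{\delta_k}{2}\,\mathbb{E}\big\|f_k(Y_{k-1}) - \mathbb{E}[X \mid Y_{k-1}]\big\|^2,$$ where $\delta_{\max} = \max\{\delta_1,\dots,\delta_n\}$.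
   Context: $D(P\|Q)$ denotes the Kullback–Leibler divergence (relative entropy) with natural logarithms. $\mathbb{E}[X\mid Y_{k-1}]$ is the conditional expectation of $X$ given $Y_{k-1}$ in the comparison process. *)

theory Defs
  imports "HOL-Probability.Probability"
begin

definition std_gauss_density :: "'a::euclidean_space \<Rightarrow> real" where
  "std_gauss_density x = (2 * pi) powr (- real DIM('a) / 2) * exp (- (norm x)\<^sup>2 / 2)"

fun Yproc :: "(nat \<Rightarrow> real) \<Rightarrow> ('b \<Rightarrow> 'a::euclidean_space) \<Rightarrow> (nat \<Rightarrow> 'b \<Rightarrow> 'a) \<Rightarrow> nat \<Rightarrow> 'b \<Rightarrow> 'a" where
  "Yproc \<delta> X N 0 \<omega> = 0"
| "Yproc \<delta> X N (Suc k) \<omega> =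
     Yproc \<delta> X N k \<omega> + \<delta> (Suc k) *\<^sub>R X \<omega> + sqrt (\<delta> (Suc k)) *\<^sub>R N (Suc k) \<omega>"

fun Zproc :: "(nat \<Rightarrow> real) \<Rightarrow> (nat \<Rightarrow> 'a::euclidean_space \<Rightarrow> 'a) \<Rightarrow> (nat \<Rightarrow> 'b \<Rightarrow> 'a) \<Rightarrow> nat \<Rightarrow> 'b \<Rightarrow> 'a" where
  "Zproc \<delta> f N 0 \<omega> = 0"
| "Zproc \<delta> f N (Suc k) \<omega> =
     Zproc \<delta> f N k \<omega> + \<delta> (Suc k) *\<^sub>R f (Suc k) (Zproc \<delta> f N k \<omega>) + sqrt (\<delta> (Suc k)) *\<^sub>R N (Suc k) \<omega>"

definition path_law :: "'b measure \<Rightarrow> (nat \<Rightarrow> 'b \<Rightarrow> 'a::euclidean_space) \<Rightarrow> nat \<Rightarrow> (nat \<Rightarrow> 'a) measure" where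
  "path_law M V n = distr M (PiM {1..n} (\<lambda>_. borel)) (\<lambda>\<omega>. \<lambda>k\<in>{1..n}. V k \<omega>)"

definition cond_exp_vec :: "'b measure \<Rightarrow> 'b measure \<Rightarrow> ('b \<Rightarrow> 'a::euclidean_space) \<Rightarrow> 'b \<Rightarrow> 'a" where
  "cond_exp_vec M F X \<omega> = (\<Sum>b\<in>Basis. real_cond_exp M F (\<lambda>\<eta>. X \<eta> \<bullet> b) \<omega> *\<^sub>R b)"

definition trace_cov :: "'b measure \<Rightarrow> ('b \<Rightarrow> 'a::euclidean_space) \<Rightarrow> real" where
  "trace_cov M X = (\<Sum>b\<in>Basis. prob_space.variance M (\<lambda>\<omega>. X \<omega> \<bullet> b))"

end

theory Submission
  imports Defs
begin

text \<open>
  Write \<open>t\<^sub>k = \<delta>\<^sub>1 + \<dots> + \<delta>\<^sub>k\<close>. Relative to the driftless Gaussian walk, the law of \<open>Z\<close> has the discrete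
  Girsanov density, and the law of \<open>Y\<close>, a mixture over \<open>X\<close> of walks with constant drift, has density
  \<open>G(y\<^sub>n)\<close> with \<open>G(y) = E exp (X \<bullet> y - t\<^sub>n \<bar>X\<bar>\<^sup>2 / 2)\<close>. With \<open>m\<^sub>k = E[X | Y\<^sub>k]\<close>, expanding the
  logarithm of the quotient turns the divergence into
  \<open>E ln G(Y\<^sub>n) + \<Sum> \<delta>\<^sub>k/2 (E\<bar>f\<^sub>k(Y\<^sub>k\<^sub>-\<^sub>1) - m\<^sub>k\<^sub>-\<^sub>1\<bar>\<^sup>2 - E\<bar>m\<^sub>k\<^sub>-\<^sub>1\<bar>\<^sup>2)\<close>.
  A log-Sobolev type inequality gives \<open>E ln G(Y\<^sub>n) \<le> \<Sum> \<delta>\<^sub>k/2 E\<bar>m\<^sub>k\<bar>\<^sup>2\<close>. Since \<open>E\<bar>m\<^sub>k\<bar>\<^sup>2\<close> increases with \<open>k\<close>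
  from \<open>\<bar>E X\<bar>\<^sup>2\<close> to at most \<open>E\<bar>X\<bar>\<^sup>2\<close>, the sum of \<open>\<delta>\<^sub>k/2 (E\<bar>m\<^sub>k\<bar>\<^sup>2 - E\<bar>m\<^sub>k\<^sub>-\<^sub>1\<bar>\<^sup>2)\<close> is at most
  \<open>\<delta>\<^sub>m\<^sub>a\<^sub>x/2\<close> times the trace of the covariance.

  For bounded \<open>X\<close> the log-Sobolev inequality follows by cutting each time step into pieces of length
  \<open>h\<close>: on a piece, \<open>ln u \<le> u - 1\<close> and a chi-squared computation bound the entropy increment by
  \<open>h/2 E\<bar>m\<bar>\<^sup>2 + O(h\<^sup>2)\<close>. Truncation then removes the boundedness.
\<close>

section \<open>Gaussian measures\<close>

text \<open>Behind the log-Sobolev type bound is the identity d/dt E ln G_t(Y_t) = E|m_t|^2 / 2,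
  where G_t is the density of the law of Y_t relative to N(0, t). Only an upper bound is required,
  so a one-sided estimate on short pieces suffices and nothing is differentiated; as E|m_t|^2
  increases, its value at the right end of a time step bounds all pieces of that step. The
  regression error compares f_k(Y_{k-1}) with m_{k-1}, the left end. This mismatch of one index
  leaves the telescoping increments and hence the covariance term.

  The expected log quotient first contains f_k . X: the increment of Y is delta_k X + sqrt(delta_k)
  N_k, and N_k is centred and independent of the past. Conditioning on Y_{k-1} then replaces X by
  m_{k-1}, which allows completing the square.

  Two obstacles shape the lemmas. With only second moments, E exp(X . y) may be infinite, but exp(X
  . y - t|X|^2/2) is bounded in X for t > 0. And time 0 is unavoidable, since Y_0 = 0 enters the
  bound; there the Gaussian is a point mass and the kernel is bounded only at y = 0.\<close>

definition std_gauss :: "'a::euclidean_space measure" where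
  "std_gauss = density lborel (\<lambda>x. ennreal (std_gauss_density x))"

text \<open>An image measure and not a density, so that \<open>t = 0\<close> is included and gives
  the point mass at 0, the law of the noise at the start.\<close>

definition gauss_var :: "real \<Rightarrow> 'a::euclidean_space measure" where
  "gauss_var t = distr std_gauss borel (\<lambda>z. sqrt t *\<^sub>R z)"

text \<open>Equalities of laws below are mostly checked on sets; this form makes Fubini and
  substitution rules for integrals applicable to them.\<close>

lemma emeasure_distr_nn_integral:
  assumes "f \<in> measurable M N" "A \<in> sets N"
  shows "emeasure (distr M N f) A = (\<integral>\<^sup>+x. indicator A (f x) \<partial>M)"
  using assms by (subst nn_integral_indicator[symmetric], simp, subst nn_integral_distr) simp_all

lemma std_gauss_density_measurable [measurable]:
  "std_gauss_density \<in> borel_measurable (borel :: 'a::euclidean_space measure)"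
  unfolding std_gauss_density_def[abs_def] by measurable

lemma std_gauss_density_nonneg [simp]: "0 \<le> std_gauss_density x"
  by (simp add: std_gauss_density_def)

lemma sets_std_gauss [simp, measurable_cong]: "sets std_gauss = sets borel"
  and space_std_gauss [simp]: "space std_gauss = UNIV"
  by (simp_all add: std_gauss_def)

lemma sets_gauss_var [simp, measurable_cong]: "sets (gauss_var t) = sets borel"
  and space_gauss_var [simp]: "space (gauss_var t) = UNIV"
  by (simp_all add: gauss_var_def)

text \<open>Reduces the normalisation in dimension d to the one-dimensional normal density.\<close>

lemma std_gauss_density_prod:
  fixes x :: "'a::euclidean_space"
  shows "std_gauss_density x = (\<Prod>b\<in>Basis. std_normal_density (x \<bullet> b))"
proof -
  have "(\<Prod>b\<in>Basis. std_normal_density (x \<bullet> b))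
      = (1 / sqrt (2 * pi)) ^ DIM('a) * exp (\<Sum>b\<in>Basis. - (x \<bullet> b)\<^sup>2 / 2)"
    by (simp add: std_normal_density_def prod_dividef exp_sum power_divide)
  also have "(\<Sum>b\<in>Basis. - (x \<bullet> b)\<^sup>2 / 2) = - (norm x)\<^sup>2 / 2"
    by (subst norm_eq_sqrt_inner, subst euclidean_inner)
       (simp add: sum_nonneg sum_negf sum_divide_distrib power2_eq_square)
  also have "(1 / sqrt (2 * pi)) ^ DIM('a) = (2 * pi) powr (- real DIM('a) / 2)"
  proof -
    have "1 / sqrt (2 * pi) = (2 * pi) powr (- (1/2))"
      by (simp add: powr_half_sqrt powr_minus_divide)
    then show ?thesis
      by (simp add: powr_powr flip: powr_realpow)
  qed
  finally show ?thesis
    by (simp add: std_gauss_density_def)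
qed

lemma nn_integral_std_gauss_density:
  "(\<integral>\<^sup>+x. ennreal (std_gauss_density (x::'a::euclidean_space)) \<partial>lborel) = 1"
proof -
  have 1: "(\<integral>\<^sup>+x. ennreal (std_normal_density x) \<partial>lborel) = 1"
    using prob_space.emeasure_space_1[OF prob_space_normal_density[of 1 0]]
    by (simp add: emeasure_density)
  have "(\<integral>\<^sup>+x. ennreal (std_gauss_density (x::'a)) \<partial>lborel)
      = (\<integral>\<^sup>+x. (\<Prod>b\<in>Basis. ennreal (std_normal_density ((x::'a) \<bullet> b))) \<partial>lborel)"
    by (simp add: std_gauss_density_prod prod_ennreal)
  also have "\<dots> = (\<Prod>b\<in>(Basis::'a set). (\<integral>\<^sup>+x. ennreal (std_normal_density x) \<partial>lborel))"
    by (rule nn_integral_lborel_prod) auto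
  finally show ?thesis using 1 by simp
qed

lemma prob_space_std_gauss: "prob_space (std_gauss :: 'a::euclidean_space measure)"
  by (rule prob_spaceI)
     (simp add: std_gauss_def emeasure_density nn_integral_std_gauss_density)

lemma prob_space_gauss_var: "prob_space (gauss_var t :: 'a::euclidean_space measure)"
  unfolding gauss_var_def
  by (rule prob_space.prob_space_distr[OF prob_space_std_gauss]) simp

section \<open>Translations, rotations and convolutions of Gaussian measures\<close>

lemma nn_integral_lborel_affine:
  fixes t :: "'a::euclidean_space"
  assumes [measurable]: "F \<in> borel_measurable borel" and "c \<noteq> 0"
  shows "(\<integral>\<^sup>+x. F x \<partial>lborel) = ennreal (\<bar>c\<bar> ^ DIM('a)) * (\<integral>\<^sup>+x. F (t + c *\<^sub>R x) \<partial>lborel)"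
  by (subst lborel_affine[OF assms(2), of t])
     (simp add: nn_integral_density nn_integral_distr nn_integral_cmult)

lemma nn_integral_std_gauss:
  "F \<in> borel_measurable borel \<Longrightarrow>
    (\<integral>\<^sup>+x. F x \<partial>std_gauss) = (\<integral>\<^sup>+x. ennreal (std_gauss_density x) * F x \<partial>lborel)"
  unfolding std_gauss_def by (subst nn_integral_density) auto

text \<open>The Cameron-Martin formula. It is the completed square
  \<open>- |z|^2 / 2 + a . z - |a|^2 / 2 = - |z - a|^2 / 2\<close> followed by a translation of
  Lebesgue measure.\<close>

lemma std_gauss_shift:
  fixes a :: "'a::euclidean_space"
  shows "density std_gauss (\<lambda>z. ennreal (exp (a \<bullet> z - (norm a)\<^sup>2 / 2))) = distr std_gauss borel (\<lambda>z. z + a)"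
proof (rule measure_eqI)
  fix A assume "A \<in> sets (density std_gauss (\<lambda>z. ennreal (exp (a \<bullet> z - (norm a)\<^sup>2 / 2))))"
  then have [measurable]: "A \<in> sets borel" by simp
  have *: "std_gauss_density z * exp (a \<bullet> z - (norm a)\<^sup>2 / 2) = std_gauss_density (z - a)" for z :: 'a
    unfolding std_gauss_density_def
    by (simp add: power2_norm_eq_inner inner_diff inner_commute field_simps flip: exp_add)
  have "emeasure (density std_gauss (\<lambda>z. ennreal (exp (a \<bullet> z - (norm a)\<^sup>2 / 2)))) A
      = (\<integral>\<^sup>+z. ennreal (std_gauss_density z) * (ennreal (exp (a \<bullet> z - (norm a)\<^sup>2 / 2)) * indicator A z) \<partial>lborel)"
    by (simp add: emeasure_density nn_integral_std_gauss)
  also have "\<dots> = (\<integral>\<^sup>+z. ennreal (std_gauss_density (z - a)) * indicator A z \<partial>lborel)"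
    by (intro nn_integral_cong) (simp add: * flip: mult.assoc ennreal_mult)
  also have "\<dots> = (\<integral>\<^sup>+z. ennreal (std_gauss_density z) * indicator A (z + a) \<partial>lborel)"
    by (subst nn_integral_lborel_affine[where c=1 and t=a]) (simp_all add: add.commute)
  also have "\<dots> = emeasure (distr std_gauss borel (\<lambda>z. z + a)) A"
    by (simp add: emeasure_distr_nn_integral nn_integral_std_gauss)
  finally show "emeasure (density std_gauss (\<lambda>z. ennreal (exp (a \<bullet> z - (norm a)\<^sup>2 / 2)))) A
     = emeasure (distr std_gauss borel (\<lambda>z. z + a)) A" .
qed simp

text \<open>Invariance of the standard Gaussian under a plane rotation, obtained from two affine substitutions
  (shears) instead of a change of variables in the product space.\<close>

lemma nn_integral_std_gauss_rotate:
  fixes \<psi> :: "'a::euclidean_space \<Rightarrow> ennreal"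
  assumes [measurable]: "\<psi> \<in> borel_measurable borel"
    and a: "a > 0" and c: "c > 0" "c\<^sup>2 = a\<^sup>2 + b\<^sup>2"
  shows "(\<integral>\<^sup>+w. \<integral>\<^sup>+z. \<psi> (a *\<^sub>R z + b *\<^sub>R w) \<partial>std_gauss \<partial>std_gauss) = (\<integral>\<^sup>+u. \<psi> (c *\<^sub>R u) \<partial>std_gauss)"
proof -
  let ?p = "\<lambda>x::'a. ennreal (std_gauss_density x)"
  interpret P: prob_space "std_gauss :: 'a measure" by (rule prob_space_std_gauss)
  \<comment> \<open>In the new variables the pair is \<open>w = (b/c) u + (a/c) v\<close> and
    \<open>z = (a/c) u - (b/c) v\<close>, an orthogonal change of coordinates, so the product of the
    two densities keeps its form.\<close>
  have key: "std_gauss_density ((b/c) *\<^sub>R u + (a/c) *\<^sub>R v) *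
      std_gauss_density ((- b/a) *\<^sub>R ((b/c) *\<^sub>R u + (a/c) *\<^sub>R v) + (c/a) *\<^sub>R u) = std_gauss_density u * std_gauss_density v"
    (is "std_gauss_density ?w * std_gauss_density ?z = _") for u v :: 'a
  proof -
    have "?z = (a/c) *\<^sub>R u - (b/c) *\<^sub>R v"
    proof -
      have "c/a - b/a*(b/c) = a/c" using a c by (simp add: field_simps power2_eq_square)
      moreover have "b/a*(a/c) = b/c" using a c by simp
      moreover have "?z = (c/a - b/a*(b/c)) *\<^sub>R u - (b/a*(a/c)) *\<^sub>R v"
        by (simp add: algebra_simps)
      ultimately show ?thesis by simp
    qed
    then have "(norm ?w)\<^sup>2 + (norm ?z)\<^sup>2 = ((a/c)\<^sup>2 + (b/c)\<^sup>2) * ((norm u)\<^sup>2 + (norm v)\<^sup>2)"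
      by (simp only: power2_norm_eq_inner inner_diff inner_add inner_scaleR_left inner_scaleR_right
            inner_commute[of v u]) (simp add: algebra_simps power2_eq_square add_divide_distrib)
    also have "(a/c)\<^sup>2 + (b/c)\<^sup>2 = 1" using c(1) unfolding power_divide add_divide_distrib[symmetric] c(2)[symmetric] by simp
    finally have *: "(norm ?w)\<^sup>2 + (norm ?z)\<^sup>2 = (norm u)\<^sup>2 + (norm v)\<^sup>2" by simp
    have "exp (- (norm ?w)\<^sup>2 / 2) * exp (- (norm ?z)\<^sup>2 / 2) = exp (- ((norm ?w)\<^sup>2 + (norm ?z)\<^sup>2) / 2)"
      by (simp add: field_simps flip: exp_add)
    also have "\<dots> = exp (- (norm u)\<^sup>2 / 2) * exp (- (norm v)\<^sup>2 / 2)"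
      unfolding * by (simp add: field_simps flip: exp_add)
    finally show ?thesis by (simp add: std_gauss_density_def)
  qed
  have inner: "(\<integral>\<^sup>+w. ?p w * ?p ((- b/a) *\<^sub>R w + (c/a) *\<^sub>R u) \<partial>lborel) = ennreal ((a/c) ^ DIM('a)) * ?p u" for u
  proof -
    have "(\<integral>\<^sup>+w. ?p w * ?p ((- b/a) *\<^sub>R w + (c/a) *\<^sub>R u) \<partial>lborel)
       = ennreal ((a/c) ^ DIM('a)) * (\<integral>\<^sup>+v. ?p u * ?p v \<partial>lborel)"
      using a c by (subst nn_integral_lborel_affine[where c="a/c" and t="(b/c) *\<^sub>R u"])
         (simp_all add: key[simplified] flip: ennreal_mult)
    then show ?thesis by (simp add: nn_integral_cmult nn_integral_std_gauss_density)
  qed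
  have "(\<integral>\<^sup>+w. \<integral>\<^sup>+z. \<psi> (a *\<^sub>R z + b *\<^sub>R w) \<partial>std_gauss \<partial>std_gauss)
     = (\<integral>\<^sup>+w. ?p w * (\<integral>\<^sup>+z. ?p z * \<psi> (a *\<^sub>R z + b *\<^sub>R w) \<partial>lborel) \<partial>lborel)"
    by (simp add: nn_integral_std_gauss)
  \<comment> \<open>First shear: for fixed \<open>w\<close>, replace \<open>z\<close> by the
    \<open>u\<close> with \<open>a z + b w = c u\<close>. The second shear, in \<open>inner\<close>,
    replaces \<open>w\<close> by \<open>v\<close> for fixed \<open>u\<close>; the two Jacobians
    \<open>(c/a)^d\<close> and \<open>(a/c)^d\<close> cancel.\<close>
  also have "\<dots> = (\<integral>\<^sup>+w. ?p w * (ennreal ((c/a) ^ DIM('a)) * (\<integral>\<^sup>+u. ?p ((- b/a) *\<^sub>R w + (c/a) *\<^sub>R u) * \<psi> (c *\<^sub>R u) \<partial>lborel)) \<partial>lborel)"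
  proof (rule nn_integral_cong)
    fix w :: 'a
    have "a *\<^sub>R ((- b/a) *\<^sub>R w + (c/a) *\<^sub>R u) + b *\<^sub>R w = c *\<^sub>R u" for u
      using a by (simp add: scaleR_add_right scaleR_diff_right)
    then show "?p w * (\<integral>\<^sup>+z. ?p z * \<psi> (a *\<^sub>R z + b *\<^sub>R w) \<partial>lborel) =
       ?p w * (ennreal ((c/a) ^ DIM('a)) * (\<integral>\<^sup>+u. ?p ((- b/a) *\<^sub>R w + (c/a) *\<^sub>R u) * \<psi> (c *\<^sub>R u) \<partial>lborel))"
      using a c by (subst nn_integral_lborel_affine[where c="c/a" and t="(- b/a) *\<^sub>R w"]) simp_all
  qed
  also have "\<dots> = ennreal ((c/a) ^ DIM('a)) * (\<integral>\<^sup>+w. (\<integral>\<^sup>+u. ?p w * ?p ((- b/a) *\<^sub>R w + (c/a) *\<^sub>R u) * \<psi> (c *\<^sub>R u) \<partial>lborel) \<partial>lborel)"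
    by (simp add: mult_ac flip: nn_integral_cmult)
  also have "\<dots> = ennreal ((c/a) ^ DIM('a)) * (\<integral>\<^sup>+u. (\<integral>\<^sup>+w. ?p w * ?p ((- b/a) *\<^sub>R w + (c/a) *\<^sub>R u) * \<psi> (c *\<^sub>R u) \<partial>lborel) \<partial>lborel)"
    by (subst lborel_pair.Fubini') simp_all
  also have "\<dots> = ennreal ((c/a) ^ DIM('a)) * (\<integral>\<^sup>+u. ennreal ((a/c) ^ DIM('a)) * (?p u * \<psi> (c *\<^sub>R u)) \<partial>lborel)"
    by (subst nn_integral_multc, simp, subst inner) (simp add: mult.assoc)
  also have "\<dots> = ennreal ((c/a) ^ DIM('a) * (a/c) ^ DIM('a)) * (\<integral>\<^sup>+u. ?p u * \<psi> (c *\<^sub>R u) \<partial>lborel)"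
    using a c by (simp add: nn_integral_cmult ennreal_mult mult.assoc)
  also have "(c/a) ^ DIM('a) * (a/c) ^ DIM('a) = 1"
    using a c by (simp flip: power_mult_distrib)
  finally show ?thesis by (simp add: nn_integral_std_gauss)
qed

lemma nn_integral_gauss_var:
  fixes \<psi> :: "'a::euclidean_space \<Rightarrow> ennreal"
  shows "\<psi> \<in> borel_measurable borel \<Longrightarrow> (\<integral>\<^sup>+y. \<psi> y \<partial>gauss_var t) = (\<integral>\<^sup>+z. \<psi> (sqrt t *\<^sub>R z) \<partial>std_gauss)"
  unfolding gauss_var_def by (subst nn_integral_distr) simp_all

lemma gauss_var_0_integral: "(\<integral>y. \<psi> y \<partial>gauss_var 0) = (\<psi> 0 :: real)"
  if [measurable]: "\<psi> \<in> borel_measurable borel" for \<psi> :: "'b::euclidean_space \<Rightarrow> real"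
  unfolding gauss_var_def
  by (subst integral_distr) (simp_all add: prob_space.prob_space[OF prob_space_std_gauss, simplified])

lemma nn_integral_gauss_var_add:
  fixes \<psi> :: "'a::euclidean_space \<Rightarrow> ennreal"
  assumes [measurable]: "\<psi> \<in> borel_measurable borel" and s: "s \<ge> 0" "h \<ge> 0"
  shows "(\<integral>\<^sup>+y. \<integral>\<^sup>+w. \<psi> (y + w) \<partial>gauss_var h \<partial>gauss_var s) = (\<integral>\<^sup>+u. \<psi> u \<partial>gauss_var (s + h))"
proof -
  interpret P: prob_space "std_gauss :: 'a measure" by (rule prob_space_std_gauss)
  interpret P2: pair_prob_space "std_gauss :: 'a measure" "std_gauss :: 'a measure" ..
  have "(\<integral>\<^sup>+y. \<integral>\<^sup>+w. \<psi> (y + w) \<partial>gauss_var h \<partial>gauss_var s) = 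
     (\<integral>\<^sup>+z. \<integral>\<^sup>+w. \<psi> (sqrt s *\<^sub>R z + sqrt h *\<^sub>R w) \<partial>std_gauss \<partial>std_gauss)"
    by (simp add: nn_integral_gauss_var)
  also have "\<dots> = (\<integral>\<^sup>+z. \<psi> (sqrt (s + h) *\<^sub>R z) \<partial>std_gauss)"
  \<comment> \<open>The rotation lemma divides by the coefficient of one variable, here
    \<open>sqrt s\<close>. At \<open>s = 0\<close> that variable disappears and integrates to
    1.\<close>
  proof (cases "s = 0")
    case True
    then show ?thesis by (simp add: P.emeasure_space_1[simplified])
  next
    case False
    then have "0 < s + h" using s by simp
    then show ?thesis using False s
      by (subst P2.Fubini'[symmetric]) (simp_all add: nn_integral_std_gauss_rotate[where c="sqrt (s + h)"])
  qed
  also have "\<dots> = (\<integral>\<^sup>+u. \<psi> u \<partial>gauss_var (s + h))"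
    by (simp add: nn_integral_gauss_var)
  finally show ?thesis .
qed

lemma gauss_var_convolution:
  assumes "s \<ge> 0" "h \<ge> 0"
  shows "distr (gauss_var s \<Otimes>\<^sub>M gauss_var h) borel (\<lambda>(y, w). y + w) = (gauss_var (s + h) :: 'a::euclidean_space measure)"
proof (rule measure_eqI)
  interpret P: prob_space "gauss_var h :: 'a measure" by (rule prob_space_gauss_var)
  fix A :: "'a set" assume "A \<in> sets (distr (gauss_var s \<Otimes>\<^sub>M gauss_var h) borel (\<lambda>(y, w). y + w))"
  then have [measurable]: "A \<in> sets borel" by simp
  show "emeasure (distr (gauss_var s \<Otimes>\<^sub>M gauss_var h) borel (\<lambda>(y, w). y + w)) A = emeasure (gauss_var (s + h)) A"
    using nn_integral_gauss_var_add[of "indicator A" s h] assms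
    by (simp add: emeasure_distr_nn_integral flip: P.nn_integral_fst)
qed simp

text \<open>This is \<open>std_gauss_shift\<close> for the vector \<open>sqrt t *\<^sub>R x\<close>,
  pushed forward by the scaling with \<open>sqrt t\<close>, which turns the translation into
  \<open>t *\<^sub>R x\<close>. The argument never divides by \<open>t\<close> and so covers the
  point mass.\<close>

lemma gauss_var_shift:
  fixes x :: "'a::euclidean_space"
  assumes "t \<ge> 0"
  shows "density (gauss_var t) (\<lambda>y. ennreal (exp (x \<bullet> y - t / 2 * (norm x)\<^sup>2))) = distr (gauss_var t) borel (\<lambda>y. y + t *\<^sub>R x)"
proof -
  have "density (gauss_var t) (\<lambda>y. ennreal (exp (x \<bullet> y - t / 2 * (norm x)\<^sup>2)))
     = distr (density std_gauss (\<lambda>z. ennreal (exp ((sqrt t *\<^sub>R x) \<bullet> z - (norm (sqrt t *\<^sub>R x))\<^sup>2 / 2)))) borel (\<lambda>z. sqrt t *\<^sub>R z)"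
    unfolding gauss_var_def using assms
    by (subst density_distr) (simp_all add: power_mult_distrib)
  also have "\<dots> = distr (distr std_gauss borel (\<lambda>z. z + sqrt t *\<^sub>R x)) borel (\<lambda>z. sqrt t *\<^sub>R z)"
    by (simp only: std_gauss_shift)
  also have "\<dots> = distr (gauss_var t) borel (\<lambda>y. y + t *\<^sub>R x)"
    unfolding gauss_var_def using assms
    by (simp add: distr_distr comp_def scaleR_add_right)
  finally show ?thesis .
qed

text \<open>The tilted measure is the law of a translate, hence has finite mass; that finiteness is
  the integrability of the exponential.\<close>

lemma integrable_std_gauss_exp: "integrable std_gauss (\<lambda>z::'a::euclidean_space. exp (a \<bullet> z))"
proof -
  interpret P: prob_space "std_gauss :: 'a measure" by (rule prob_space_std_gauss)
  have "integrable (density std_gauss (\<lambda>z. ennreal (exp (a \<bullet> z - (norm a)\<^sup>2 / 2)))) (\<lambda>_. 1::real)"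
    unfolding std_gauss_shift by (subst integrable_distr_eq) simp_all
  then have "integrable std_gauss (\<lambda>z. exp (a \<bullet> z - (norm a)\<^sup>2 / 2))"
    by (subst (asm) integrable_density) simp_all
  from integrable_mult_right[OF this, of "exp ((norm a)\<^sup>2 / 2)"] show ?thesis
    by (simp flip: exp_add)
qed

lemma integrable_std_gauss_norm2: "integrable std_gauss (\<lambda>z::'a::euclidean_space. (norm z)\<^sup>2)"
proof -
  have "integrable std_gauss (\<lambda>z::'a. (z \<bullet> b)\<^sup>2)" for b :: 'a
  proof (rule Bochner_Integration.integrable_bound)
    show "integrable std_gauss (\<lambda>z::'a. 2 * (exp (b \<bullet> z) + exp ((- b) \<bullet> z)))"
      by (intro integrable_mult_right Bochner_Integration.integrable_add integrable_std_gauss_exp)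
    \<comment> \<open>A crude domination of squares by exponentials, from
      \<open>exp v \<ge> v^2 / 2\<close> for \<open>v \<ge> 0\<close>, reduces second moments to the
      previous lemma.\<close>
    have "u\<^sup>2 \<le> 2 * (exp u + exp (- u))" for u :: real
    proof -
      have *: "v\<^sup>2 \<le> 2 * exp v" if "v \<ge> 0" for v :: real
        using exp_lower_Taylor_quadratic[OF that] that by simp
      show ?thesis
      proof (cases "u \<ge> 0")
        case True then show ?thesis using *[of u] exp_ge_zero[of "- u"] by argo
      next
        case False then show ?thesis using *[of "- u"] exp_ge_zero[of u] by (simp del: exp_ge_zero)
      qed
    qed
    then show "AE z in std_gauss. norm ((z \<bullet> b)\<^sup>2) \<le> norm (2 * (exp (b \<bullet> z) + exp ((- b) \<bullet> z)))"
      by (intro AE_I2) (simp add: inner_commute)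
  qed simp
  then have "integrable std_gauss (\<lambda>z::'a. \<Sum>b\<in>Basis. (z \<bullet> b)\<^sup>2)"
    by (intro Bochner_Integration.integrable_sum)
  also have "(\<lambda>z::'a. \<Sum>b\<in>Basis. (z \<bullet> b)\<^sup>2) = (\<lambda>z. (norm z)\<^sup>2)"
    by (rule ext, subst power2_norm_eq_inner, subst euclidean_inner) (simp add: power2_eq_square)
  finally show ?thesis .
qed

text \<open>By symmetry: the substitution with factor -1 shows that negation preserves the
  measure.\<close>

lemma integral_std_gauss_inner: "(\<integral>z. z \<bullet> b \<partial>std_gauss) = (0::real)" for b :: "'a::euclidean_space"
proof -
  have "distr std_gauss borel uminus = (std_gauss :: 'a measure)"
  proof (rule measure_eqI)
    fix A :: "'a set" assume "A \<in> sets (distr std_gauss borel uminus)"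
    then have [measurable]: "A \<in> sets borel" by simp
    have "(\<integral>\<^sup>+z. indicator A z \<partial>std_gauss) = (\<integral>\<^sup>+z. indicator A (- z) \<partial>std_gauss)"
      by (subst (1 2) nn_integral_std_gauss, simp_all del: nn_integral_indicator)
         (subst nn_integral_lborel_affine[where c="-1" and t=0],
           simp_all add: std_gauss_density_def del: nn_integral_indicator)
    then show "emeasure (distr std_gauss borel uminus) A = emeasure std_gauss A"
      by (simp add: emeasure_distr_nn_integral)
  qed simp
  then have "(\<integral>z. z \<bullet> b \<partial>std_gauss) = (\<integral>z. z \<bullet> b \<partial>distr std_gauss borel uminus)" by simp
  also have "\<dots> = - (\<integral>z. z \<bullet> b \<partial>std_gauss)"
    by (subst integral_distr) simp_all
  finally show ?thesis by simp
qed

lemma integrable_gauss_var_norm2: "integrable (gauss_var t) (\<lambda>y::'a::euclidean_space. (norm y)\<^sup>2)"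
  unfolding gauss_var_def
  by (subst integrable_distr_eq) (simp_all add: power_mult_distrib integrable_std_gauss_norm2)

lemma integral_gauss_var_inner: "(\<integral>y. y \<bullet> b \<partial>gauss_var t) = (0::real)" for b :: "'a::euclidean_space"
  unfolding gauss_var_def
  by (subst integral_distr) (simp_all add: integral_std_gauss_inner)

section \<open>Gaussian tilts of a measure with finite second moment\<close>

text \<open>The density of N(t x, t) relative to N(0, t) at \<open>y\<close>, that is, the
  likelihood of the drift \<open>x\<close> when position \<open>y\<close> is observed at time
  \<open>t\<close>.\<close>

definition gker :: "real \<Rightarrow> 'a::euclidean_space \<Rightarrow> 'a \<Rightarrow> real" where
  "gker t x y = exp (x \<bullet> y - t / 2 * (norm x)\<^sup>2)"

definition tilt_mass :: "'a::euclidean_space measure \<Rightarrow> real \<Rightarrow> 'a \<Rightarrow> real" where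
  "tilt_mass \<mu> t y = (\<integral>x. gker t x y \<partial>\<mu>)"

definition tilt_moment :: "'a::euclidean_space measure \<Rightarrow> real \<Rightarrow> 'a \<Rightarrow> 'a" where
  "tilt_moment \<mu> t y = (\<integral>x. gker t x y *\<^sub>R x \<partial>\<mu>)"

text \<open>The Bayes formula for the mean of \<open>X\<close> given position \<open>y\<close> at
  time \<open>t\<close>. Formally it is also the gradient in \<open>y\<close> of
  \<open>ln (tilt_mass \<mu> t y)\<close>.\<close>

definition post_mean :: "'a::euclidean_space measure \<Rightarrow> real \<Rightarrow> 'a \<Rightarrow> 'a" where
  "post_mean \<mu> t y = tilt_moment \<mu> t y /\<^sub>R tilt_mass \<mu> t y"

text \<open>For a probability measure this is E|m_t|^2 with m_t the posterior mean. The name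
  reflects that m_t is the gradient of the log density, so that this is a relative Fisher
  information.\<close>

definition fisher :: "'a::euclidean_space measure \<Rightarrow> real \<Rightarrow> real" where
  "fisher \<mu> t = (\<integral>y. tilt_mass \<mu> t y * (norm (post_mean \<mu> t y))\<^sup>2 \<partial>gauss_var t)"

text \<open>Written against the Gaussian reference; for a probability measure it is the expectation
  of \<open>ln (tilt_mass \<mu> t)\<close> at the position of the process, a relative
  entropy.\<close>

definition ent :: "'a::euclidean_space measure \<Rightarrow> real \<Rightarrow> real" where
  "ent \<mu> t = (\<integral>y. tilt_mass \<mu> t y * ln (tilt_mass \<mu> t y) \<partial>gauss_var t)"

text \<open>The points charged by \<^term>\<open>gauss_var t\<close>; on them the kernel is bounded in \<^term>\<open>x\<close>,
  also for \<^term>\<open>t = 0\<close>, where the measure is a point mass.\<close>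

definition admissible :: "real \<Rightarrow> 'a::euclidean_space \<Rightarrow> bool" where
  "admissible t y \<longleftrightarrow> t > 0 \<or> t = 0 \<and> y = 0"

lemma gker_measurable [measurable]:
  assumes "f \<in> borel_measurable M" "g \<in> borel_measurable M"
  shows "(\<lambda>p. gker t (f p) (g p)) \<in> borel_measurable M"
  using assms unfolding gker_def by measurable

lemma gker_pos [simp]: "0 < gker t x y" and gker_nonneg [simp]: "0 \<le> gker t x y"
  by (simp_all add: gker_def)

lemma gker_0_0 [simp]: "gker 0 x 0 = 1"
  by (simp add: gker_def)

text \<open>Likelihoods of consecutive increments multiply. All semigroup identities below rest on
  this factorisation.\<close>

lemma gker_add: "gker (t + h) x (y + w) = gker t x y * gker h x w"
  by (simp add: gker_def inner_add field_simps flip: exp_add)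

lemma admissible_0 [simp]: "admissible 0 0"
  by (simp add: admissible_def)

lemma admissible_nonneg: "admissible t y \<Longrightarrow> t \<ge> 0"
  by (auto simp: admissible_def)

text \<open>Uniformity in \<open>x\<close> lets every integrable function of \<open>x\<close> stay
  integrable after multiplication by the kernel. For \<open>t > 0\<close> it is
  \<open>|y - t x|^2 \<ge> 0\<close>; at \<open>t = 0\<close> admissibility forces
  \<open>y = 0\<close>, and the bound reads 1 because \<open>0 / 0 = 0\<close>.\<close>

lemma gker_le:
  assumes "admissible t y"
  shows "gker t x y \<le> exp ((norm y)\<^sup>2 / (2 * t))"
proof (cases "t = 0")
  case True
  with assms show ?thesis by (simp add: admissible_def)
next
  case False
  with assms have t: "t > 0" by (simp add: admissible_def)
  have "0 \<le> (norm (y - t *\<^sub>R x))\<^sup>2" by simp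
  also have "\<dots> = (norm y)\<^sup>2 - 2 * t * (x \<bullet> y) + t\<^sup>2 * (norm x)\<^sup>2"
    unfolding power2_norm_eq_inner by (simp add: inner_diff inner_commute power2_eq_square algebra_simps)
  finally have "2 * t * (x \<bullet> y - t / 2 * (norm x)\<^sup>2) \<le> (norm y)\<^sup>2"
    by (simp add: algebra_simps power2_eq_square)
  with t show ?thesis
    by (simp add: gker_def field_simps)
qed

lemma AE_admissible: "t \<ge> 0 \<Longrightarrow> AE y in gauss_var t. admissible t (y :: 'a::euclidean_space)"
proof -
  assume "t \<ge> 0"
  have [measurable]: "Measurable.pred borel (admissible t :: 'a \<Rightarrow> bool)"
    unfolding admissible_def[abs_def] by measurable
  show ?thesis unfolding gauss_var_def using \<open>t \<ge> 0\<close>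
    by (subst AE_distr_iff) (auto simp: admissible_def)
qed

lemma AE_admissible_add:
  assumes "admissible t y" "h \<ge> 0"
  shows "AE w in gauss_var h. admissible (t + h) (y + w :: 'a::euclidean_space)"
  using assms AE_admissible[of h] by (auto simp: admissible_def)

lemma integral_gker_mult:
  fixes \<psi> :: "'a::euclidean_space \<Rightarrow> real"
  assumes [measurable]: "\<psi> \<in> borel_measurable borel" and t: "t \<ge> 0"
  shows "(\<integral>y. gker t x y * \<psi> y \<partial>gauss_var t) = (\<integral>y. \<psi> (y + t *\<^sub>R x) \<partial>gauss_var t)"
proof -
  have eq: "density (gauss_var t) (\<lambda>y. ennreal (gker t x y)) = distr (gauss_var t) borel (\<lambda>y. y + t *\<^sub>R x)"
    using gauss_var_shift[OF t] unfolding gker_def .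
  have "(\<integral>y. gker t x y * \<psi> y \<partial>gauss_var t) = integral\<^sup>L (density (gauss_var t) (\<lambda>y. ennreal (gker t x y))) \<psi>"
    by (subst integral_density) simp_all
  also have "\<dots> = (\<integral>y. \<psi> (y + t *\<^sub>R x) \<partial>gauss_var t)"
    unfolding eq by (subst integral_distr) simp_all
  finally show "(\<integral>y. gker t x y * \<psi> y \<partial>gauss_var t) = (\<integral>y. \<psi> (y + t *\<^sub>R x) \<partial>gauss_var t)" .
qed

lemma nn_integral_gker_mult:
  fixes \<psi> :: "'a::euclidean_space \<Rightarrow> ennreal"
  assumes [measurable]: "\<psi> \<in> borel_measurable borel" and t: "t \<ge> 0"
  shows "(\<integral>\<^sup>+y. ennreal (gker t x y) * \<psi> y \<partial>gauss_var t) = (\<integral>\<^sup>+y. \<psi> (y + t *\<^sub>R x) \<partial>gauss_var t)"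
proof -
  have "(\<integral>\<^sup>+y. ennreal (gker t x y) * \<psi> y \<partial>gauss_var t) = integral\<^sup>N (density (gauss_var t) (\<lambda>y. ennreal (gker t x y))) \<psi>"
    by (subst nn_integral_density) simp_all
  also have "\<dots> = (\<integral>\<^sup>+y. \<psi> (y + t *\<^sub>R x) \<partial>gauss_var t)"
    using gauss_var_shift[OF t, of x] unfolding gker_def by (simp add: nn_integral_distr)
  finally show ?thesis .
qed

section \<open>Scalar inequalities\<close>

lemma le_one_plus_square: "r \<le> 1 + r\<^sup>2" for r :: real
  using zero_le_power2[of "r - 1 / 2"] by (simp add: power2_eq_square algebra_simps)

lemma mult_ln_ge: "u * ln u \<ge> - 1" if "u \<ge> 0" for u :: real
proof (cases "u = 0")
  case False
  with that have "ln (1 / u) \<le> 1 / u - 1" by (intro ln_le_minus_one) simp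
  then have "u * ln (1 / u) \<le> u * (1 / u - 1)" using that by (intro mult_left_mono) simp_all
  then show ?thesis using False that by (simp add: ln_div algebra_simps)
qed simp

text \<open>For \<open>a = - u\<close> negative the claim is
  \<open>1 \<le> (1 - u + u^2) exp u\<close>, and it already holds with \<open>exp u\<close>
  replaced by its second-order Taylor polynomial.\<close>

lemma exp_le_quadratic: "exp a \<le> 1 + a + a\<^sup>2" if "a \<le> 1" for a :: real
proof (cases "a \<ge> 0")
  case True
  then show ?thesis using exp_bound[of a] that by simp
next
  case False
  define u where "u = - a"
  have u: "u > 0" using False by (simp add: u_def)
  have "1 \<le> (1 - u + u\<^sup>2) * (1 + u + u\<^sup>2 / 2)"
  proof -
    have "(1 - u + u\<^sup>2) * (1 + u + u\<^sup>2 / 2) = 1 + u\<^sup>2 / 2 + u^3 / 2 + u^4 / 2"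
      by (simp add: field_simps power2_eq_square power3_eq_cube power4_eq_xxxx)
    then show ?thesis using u by simp
  qed
  also have "\<dots> \<le> (1 - u + u\<^sup>2) * exp u"
  proof (rule mult_left_mono)
    show "1 + u + u\<^sup>2 / 2 \<le> exp u" using u by (intro exp_lower_Taylor_quadratic) simp
    have "0 \<le> (1 - u / 2)\<^sup>2 + 3 / 4 * u\<^sup>2" by simp
    then show "0 \<le> 1 - u + u\<^sup>2" by (simp add: power2_eq_square algebra_simps)
  qed
  finally show ?thesis
    by (simp add: u_def exp_minus field_simps)
qed

text \<open>Subprobability measures are included so that restrictions of the law of \<open>X\<close>
  to balls are instances. Positive mass keeps \<open>tilt_mass\<close> positive, which its logarithm
  and the quotient \<open>post_mean\<close> rely on.\<close>

locale moment_measure = finite_measure \<mu> for \<mu> :: "'a::euclidean_space measure" +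
  assumes sets_mu [simp, measurable_cong]: "sets \<mu> = sets borel"
    and mass_pos: "measure \<mu> UNIV > 0"
    and mass_le: "measure \<mu> UNIV \<le> 1"
    and second_moment: "integrable \<mu> (\<lambda>x. (norm x)\<^sup>2)"
begin

lemma space_mu [simp]: "space \<mu> = UNIV"
  using sets_eq_imp_space_eq[OF sets_mu] by simp

lemma tilt_mass_measurable [measurable]: "tilt_mass \<mu> t \<in> borel_measurable borel"
  unfolding tilt_mass_def[abs_def] by measurable

lemma tilt_moment_measurable [measurable]: "tilt_moment \<mu> t \<in> borel_measurable borel"
  unfolding tilt_moment_def[abs_def] by measurable

lemma post_mean_measurable [measurable]: "post_mean \<mu> t \<in> borel_measurable borel"
  unfolding post_mean_def[abs_def] by measurable

lemma first_moment: "integrable \<mu> (\<lambda>x. norm x)"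
proof (rule Bochner_Integration.integrable_bound)
  show "integrable \<mu> (\<lambda>x. 1 + (norm x)\<^sup>2)" using second_moment by simp
  show "AE x in \<mu>. norm (norm x) \<le> norm (1 + (norm x)\<^sup>2)" by (simp add: le_one_plus_square)
qed simp

lemma integrable_gker_bounded:
  fixes F :: "'a \<Rightarrow> 'b::{banach, second_countable_topology}"
  assumes "admissible t y" "integrable \<mu> F"
  shows "integrable \<mu> (\<lambda>x. gker t x y *\<^sub>R F x)"
proof (rule Bochner_Integration.integrable_bound)
  show "integrable \<mu> (\<lambda>x. exp ((norm y)\<^sup>2 / (2 * t)) *\<^sub>R F x)" using assms(2) by simp
  show "AE x in \<mu>. norm (gker t x y *\<^sub>R F x) \<le> norm (exp ((norm y)\<^sup>2 / (2 * t)) *\<^sub>R F x)"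
    by (intro AE_I2) (simp add: gker_le[OF assms(1)] mult_right_mono)
qed (use assms(2) in measurable)

lemma integrable_gker: "admissible t y \<Longrightarrow> integrable \<mu> (\<lambda>x. gker t x y)"
  using integrable_gker_bounded[of t y "\<lambda>_. 1::real"] by simp

lemma integrable_id: "integrable \<mu> (\<lambda>x. x)"
  using first_moment by (rule integrable_norm_cancel) simp

lemma integrable_gker_id: "admissible t y \<Longrightarrow> integrable \<mu> (\<lambda>x. gker t x y *\<^sub>R x)"
  by (intro integrable_gker_bounded integrable_id)

lemma integrable_gker_norm2: "admissible t y \<Longrightarrow> integrable \<mu> (\<lambda>x. gker t x y * (norm x)\<^sup>2)"
  using integrable_gker_bounded[of t y "\<lambda>x. (norm x)\<^sup>2"] second_moment by simp

lemma tilt_mass_pos: "admissible t y \<Longrightarrow> 0 < tilt_mass \<mu> t y"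
proof -
  assume a: "admissible t y"
  have "0 \<le> tilt_mass \<mu> t y" unfolding tilt_mass_def by simp
  moreover have "tilt_mass \<mu> t y \<noteq> 0"
  proof
    assume "tilt_mass \<mu> t y = 0"
    then have "AE x in \<mu>. gker t x y = 0"
      unfolding tilt_mass_def using integral_nonneg_eq_0_iff_AE[OF integrable_gker[OF a]] by simp
    then have "AE x in \<mu>. False"
      by eventually_elim (metis gker_pos less_irrefl)
    then have "emeasure \<mu> (space \<mu>) = 0" 
      using AE_iff_measurable[of "space \<mu>" \<mu> "\<lambda>_. False"] by simp
    then show False using mass_pos by (simp add: measure_def)
  qed
  ultimately show ?thesis by simp
qed

lemma tilt_mass_nonneg: "0 \<le> tilt_mass \<mu> t y"
  unfolding tilt_mass_def by simp

lemma tilt_mass_le: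
  assumes "admissible t y"
  shows "tilt_mass \<mu> t y \<le> exp ((norm y)\<^sup>2 / (2 * t))"
proof -
  have "tilt_mass \<mu> t y \<le> (\<integral>x. exp ((norm y)\<^sup>2 / (2 * t)) \<partial>\<mu>)"
    unfolding tilt_mass_def by (intro integral_mono integrable_gker gker_le assms) simp
  also have "\<dots> = measure \<mu> UNIV * exp ((norm y)\<^sup>2 / (2 * t))" by simp
  also have "\<dots> \<le> exp ((norm y)\<^sup>2 / (2 * t))" using mass_le by (simp add: mult_left_le_one_le)
  finally show ?thesis .
qed

lemma tilt_moment_eq: "admissible t y \<Longrightarrow> tilt_moment \<mu> t y = tilt_mass \<mu> t y *\<^sub>R post_mean \<mu> t y"
  using tilt_mass_pos[of t y] by (simp add: post_mean_def)

text \<open>Jensen's inequality for the unnormalised posterior: its variance about its own mean is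
  nonnegative. The right-hand side is linear in \<open>\<mu>\<close>, so the semigroup identity
  supplies its integrability.\<close>

lemma tilt_mass_post_mean_le:
  assumes "admissible t y"
  shows "tilt_mass \<mu> t y * (norm (post_mean \<mu> t y))\<^sup>2 \<le> (\<integral>x. gker t x y * (norm x)\<^sup>2 \<partial>\<mu>)"
proof -
  let ?m = "post_mean \<mu> t y"
  have "0 \<le> (\<integral>x. gker t x y * (norm (x - ?m))\<^sup>2 \<partial>\<mu>)" by simp
  also have "\<dots> = (\<integral>x. gker t x y * (norm x)\<^sup>2 - 2 * ((gker t x y *\<^sub>R x) \<bullet> ?m) + gker t x y * (norm ?m)\<^sup>2 \<partial>\<mu>)"
    by (intro Bochner_Integration.integral_cong refl)
       (simp add: power2_norm_eq_inner inner_diff inner_commute algebra_simps)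
  also have "\<dots> = (\<integral>x. gker t x y * (norm x)\<^sup>2 \<partial>\<mu>) - 2 * (tilt_moment \<mu> t y \<bullet> ?m) + tilt_mass \<mu> t y * (norm ?m)\<^sup>2"
    unfolding tilt_moment_def tilt_mass_def
    using integrable_gker[OF assms] integrable_gker_id[OF assms] integrable_gker_norm2[OF assms]
    by (simp add: integrable_inner_left del: inner_scaleR_left)
  also have "tilt_moment \<mu> t y \<bullet> ?m = tilt_mass \<mu> t y * (norm ?m)\<^sup>2"
    using tilt_moment_eq[OF assms] by (simp add: power2_norm_eq_inner)
  finally show ?thesis by simp
qed

text \<open>Fubini combined with the Cameron--Martin shift of \<^term>\<open>gauss_var h\<close>.
  For \<^term>\<open>t = 0\<close> and \<^term>\<open>y = 0\<close> this describes the joint law of \<open>X\<close> and \<open>h X + W\<close>.\<close>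

lemma
  fixes F \<psi> :: "'a \<Rightarrow> real"
  assumes [measurable]: "F \<in> borel_measurable borel" "\<psi> \<in> borel_measurable borel" and h: "h \<ge> 0"
    and int: "integrable (\<mu> \<Otimes>\<^sub>M gauss_var h) (\<lambda>(x, w). gker t x y * F x * \<psi> (w + h *\<^sub>R x))"
  shows integrable_tilt: "integrable (gauss_var h) (\<lambda>w. (\<integral>x. gker (t + h) x (y + w) * F x \<partial>\<mu>) * \<psi> w)"
    and integral_tilt: "(\<integral>w. (\<integral>x. gker (t + h) x (y + w) * F x \<partial>\<mu>) * \<psi> w \<partial>gauss_var h)
      = (\<integral>x. gker t x y * F x * (\<integral>w. \<psi> (w + h *\<^sub>R x) \<partial>gauss_var h) \<partial>\<mu>)"
proof -
  interpret W: prob_space "gauss_var h :: 'a measure" by (rule prob_space_gauss_var)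
  interpret P: pair_sigma_finite \<mu> "gauss_var h :: 'a measure" ..
  let ?f = "\<lambda>(x, w). gker t x y * F x * (gker h x w * \<psi> w)"
  \<comment> \<open>Integrability is transferred through absolute values: for nonnegative integrands
    the factor \<open>gker h x w\<close> can be traded for the translation by
    \<open>h *\<^sub>R x\<close> under the integral, which yields exactly the hypothesis
    \<open>int\<close>.\<close>
  have "(\<integral>\<^sup>+p. ennreal (norm (?f p)) \<partial>(\<mu> \<Otimes>\<^sub>M gauss_var h)) = 
      (\<integral>\<^sup>+x. ennreal \<bar>gker t x y * F x\<bar> * (\<integral>\<^sup>+w. ennreal (gker h x w) * ennreal \<bar>\<psi> w\<bar> \<partial>gauss_var h) \<partial>\<mu>)"
    by (subst W.nn_integral_fst[symmetric], simp)
       (simp add: abs_mult ennreal_mult' nn_integral_cmult)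
  also have "\<dots> = (\<integral>\<^sup>+x. ennreal \<bar>gker t x y * F x\<bar> * (\<integral>\<^sup>+w. ennreal \<bar>\<psi> (w + h *\<^sub>R x)\<bar> \<partial>gauss_var h) \<partial>\<mu>)"
    using h by (simp add: nn_integral_gker_mult)
  also have "\<dots> = (\<integral>\<^sup>+p. ennreal (norm ((\<lambda>(x, w). gker t x y * F x * \<psi> (w + h *\<^sub>R x)) p)) \<partial>(\<mu> \<Otimes>\<^sub>M gauss_var h))"
    by (subst W.nn_integral_fst[symmetric], simp)
       (simp add: abs_mult ennreal_mult' nn_integral_cmult)
  also have "\<dots> < \<infinity>" using int unfolding integrable_iff_bounded by simp
  finally have f: "integrable (\<mu> \<Otimes>\<^sub>M gauss_var h) ?f"
    unfolding integrable_iff_bounded by simp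
  have eq: "(\<integral>x. gker t x y * F x * (gker h x w * \<psi> w) \<partial>\<mu>) = (\<integral>x. gker (t + h) x (y + w) * F x \<partial>\<mu>) * \<psi> w" for w
    unfolding gker_add integral_mult_left_zero[symmetric] by (simp add: mult_ac)
  show "integrable (gauss_var h) (\<lambda>w. (\<integral>x. gker (t + h) x (y + w) * F x \<partial>\<mu>) * \<psi> w)"
    using P.integrable_snd[OF f] by (simp add: eq)
  show "(\<integral>w. (\<integral>x. gker (t + h) x (y + w) * F x \<partial>\<mu>) * \<psi> w \<partial>gauss_var h)
      = (\<integral>x. gker t x y * F x * (\<integral>w. \<psi> (w + h *\<^sub>R x) \<partial>gauss_var h) \<partial>\<mu>)"
    using P.Fubini_integral[OF f] h by (simp add: eq integral_gker_mult)
qed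

lemma integrable_pair_gauss:
  fixes F :: "'a \<Rightarrow> real"
  assumes "integrable \<mu> F"
  shows "integrable (\<mu> \<Otimes>\<^sub>M gauss_var h) (\<lambda>(x, w::'a). F x)"
proof -
  interpret W: prob_space "gauss_var h :: 'a measure" by (rule prob_space_gauss_var)
  interpret P: pair_sigma_finite \<mu> "gauss_var h :: 'a measure" ..
  show ?thesis
    by (intro P.Fubini_integrable) (use assms in \<open>simp_all add: W.prob_space[simplified]\<close>)
qed

text \<open>The case \<open>\<psi> = 1\<close> of the previous lemma. Along the driftless walk,
  kernel integrals of a fixed \<open>F\<close> form a martingale; \<open>tilt_mass\<close> and the
  coordinates of \<open>tilt_moment\<close> are the instances used.\<close>

lemma
  fixes F :: "'a \<Rightarrow> real"
  assumes h: "h \<ge> 0" and F: "F \<in> borel_measurable borel" "integrable \<mu> (\<lambda>x. gker t x y * F x)"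
  shows integrable_semigroup: "integrable (gauss_var h) (\<lambda>w. \<integral>x. gker (t + h) x (y + w) * F x \<partial>\<mu>)"
    and integral_semigroup: "(\<integral>w. (\<integral>x. gker (t + h) x (y + w) * F x \<partial>\<mu>) \<partial>gauss_var h) = (\<integral>x. gker t x y * F x \<partial>\<mu>)"
proof -
  interpret W: prob_space "gauss_var h :: 'a measure" by (rule prob_space_gauss_var)
  have *: "integrable (\<mu> \<Otimes>\<^sub>M gauss_var h) (\<lambda>(x, w::'a). gker t x y * F x * 1)"
    using integrable_pair_gauss[OF F(2)] by simp
  note ** = integrable_tilt[OF F(1) borel_measurable_const h *] integral_tilt[OF F(1) borel_measurable_const h *]
  show "integrable (gauss_var h) (\<lambda>w. \<integral>x. gker (t + h) x (y + w) * F x \<partial>\<mu>)"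
    "(\<integral>w. (\<integral>x. gker (t + h) x (y + w) * F x \<partial>\<mu>) \<partial>gauss_var h) = (\<integral>x. gker t x y * F x \<partial>\<mu>)"
    using ** by (simp_all add: W.prob_space[simplified])
qed

lemma
  assumes "h \<ge> 0" "admissible t y"
  shows integrable_tilt_mass_semigroup: "integrable (gauss_var h) (\<lambda>w. tilt_mass \<mu> (t + h) (y + w))"
    and integral_tilt_mass_semigroup: "(\<integral>w. tilt_mass \<mu> (t + h) (y + w) \<partial>gauss_var h) = tilt_mass \<mu> t y"
  using integrable_semigroup[of h "\<lambda>_. 1" t y] integral_semigroup[of h "\<lambda>_. 1" t y] assms
  by (simp_all add: integrable_gker tilt_mass_def)

lemma tilt_moment_inner:
  "admissible t y \<Longrightarrow> (\<integral>x. gker t x y * (x \<bullet> v) \<partial>\<mu>) = tilt_moment \<mu> t y \<bullet> v"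
  unfolding tilt_moment_def
  using integral_inner_left[of v \<mu> "\<lambda>x. gker t x y *\<^sub>R x"] integrable_gker_id by simp

lemma
  assumes "h \<ge> 0" "admissible t y"
  shows integrable_tilt_moment_semigroup: "integrable (gauss_var h) (\<lambda>w. tilt_moment \<mu> (t + h) (y + w) \<bullet> v)"
    and integral_tilt_moment_semigroup: "(\<integral>w. tilt_moment \<mu> (t + h) (y + w) \<bullet> v \<partial>gauss_var h) = tilt_moment \<mu> t y \<bullet> v"
proof -
  have i: "integrable \<mu> (\<lambda>x. gker t x y * (x \<bullet> v))"
    using integrable_inner_left[OF integrable_gker_id[OF assms(2)], of v] by simp
  have ae: "AE w in gauss_var h. (\<integral>x. gker (t + h) x (y + w) * (x \<bullet> v) \<partial>\<mu>) = tilt_moment \<mu> (t + h) (y + w) \<bullet> v"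
    using AE_admissible_add[OF assms(2,1)] by eventually_elim (rule tilt_moment_inner)
  note * = integrable_semigroup[of h "\<lambda>x. x \<bullet> v" t y] integral_semigroup[of h "\<lambda>x. x \<bullet> v" t y]
  show "integrable (gauss_var h) (\<lambda>w. tilt_moment \<mu> (t + h) (y + w) \<bullet> v)"
    using *(1) assms i by (subst integrable_cong_AE[THEN iffD1, OF _ _ ae]) simp_all
  have "(\<integral>w. tilt_moment \<mu> (t + h) (y + w) \<bullet> v \<partial>gauss_var h) = (\<integral>w. (\<integral>x. gker (t + h) x (y + w) * (x \<bullet> v) \<partial>\<mu>) \<partial>gauss_var h)"
    using ae by (intro integral_cong_AE) auto
  then show "(\<integral>w. tilt_moment \<mu> (t + h) (y + w) \<bullet> v \<partial>gauss_var h) = tilt_moment \<mu> t y \<bullet> v"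
    using *(2) assms i by (simp add: tilt_moment_inner)
qed

text \<open>The quantity equals \<open>|tilt_moment|^2 / tilt_mass\<close>, a jointly convex
  function of a pair that is a martingale, hence a submartingale. With \<open>m\<close> the
  posterior mean at \<open>(t, y)\<close>, the supporting linear function is
  \<open>2 tilt_moment . m - |m|^2 tilt_mass\<close>; that it lies below is
  \<open>|p - m|^2 \<ge> 0\<close> for the later posterior mean \<open>p\<close>.\<close>

lemma
  assumes h: "h \<ge> 0" and a: "admissible t y"
  shows integrable_fisher_step:
      "integrable (gauss_var h) (\<lambda>w. tilt_mass \<mu> (t + h) (y + w) * (norm (post_mean \<mu> (t + h) (y + w)))\<^sup>2)"
    and fisher_step: "tilt_mass \<mu> t y * (norm (post_mean \<mu> t y))\<^sup>2
      \<le> (\<integral>w. tilt_mass \<mu> (t + h) (y + w) * (norm (post_mean \<mu> (t + h) (y + w)))\<^sup>2 \<partial>gauss_var h)"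
proof -
  note ae = AE_admissible_add[OF a h]
  show int: "integrable (gauss_var h) (\<lambda>w. tilt_mass \<mu> (t + h) (y + w) * (norm (post_mean \<mu> (t + h) (y + w)))\<^sup>2)"
  proof (rule Bochner_Integration.integrable_bound)
    show "integrable (gauss_var h) (\<lambda>w. \<integral>x. gker (t + h) x (y + w) * (norm x)\<^sup>2 \<partial>\<mu>)"
      using h a by (intro integrable_semigroup integrable_gker_norm2) simp_all
    show "AE w in gauss_var h. norm (tilt_mass \<mu> (t + h) (y + w) * (norm (post_mean \<mu> (t + h) (y + w)))\<^sup>2)
        \<le> norm (\<integral>x. gker (t + h) x (y + w) * (norm x)\<^sup>2 \<partial>\<mu>)"
      using ae by eventually_elim (use tilt_mass_post_mean_le tilt_mass_nonneg in \<open>simp add: abs_mult\<close>)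
  qed simp
  let ?m = "post_mean \<mu> t y"
  have "tilt_mass \<mu> t y * (norm ?m)\<^sup>2 = 2 * (tilt_moment \<mu> t y \<bullet> ?m) - (norm ?m)\<^sup>2 * tilt_mass \<mu> t y"
    using tilt_moment_eq[OF a] by (simp add: power2_norm_eq_inner)
  also have "\<dots> = (\<integral>w. 2 * (tilt_moment \<mu> (t + h) (y + w) \<bullet> ?m) - (norm ?m)\<^sup>2 * tilt_mass \<mu> (t + h) (y + w) \<partial>gauss_var h)"
    using integrable_tilt_moment_semigroup[OF h a] integrable_tilt_mass_semigroup[OF h a]
    by (simp add: integral_tilt_moment_semigroup[OF h a] integral_tilt_mass_semigroup[OF h a])
  also have "\<dots> \<le> (\<integral>w. tilt_mass \<mu> (t + h) (y + w) * (norm (post_mean \<mu> (t + h) (y + w)))\<^sup>2 \<partial>gauss_var h)"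
  proof (rule integral_mono_AE)
    show "integrable (gauss_var h) (\<lambda>w. 2 * (tilt_moment \<mu> (t + h) (y + w) \<bullet> ?m) - (norm ?m)\<^sup>2 * tilt_mass \<mu> (t + h) (y + w))"
      using integrable_tilt_moment_semigroup[OF h a] integrable_tilt_mass_semigroup[OF h a] by simp
    show "AE w in gauss_var h. 2 * (tilt_moment \<mu> (t + h) (y + w) \<bullet> ?m) - (norm ?m)\<^sup>2 * tilt_mass \<mu> (t + h) (y + w)
       \<le> tilt_mass \<mu> (t + h) (y + w) * (norm (post_mean \<mu> (t + h) (y + w)))\<^sup>2"
      using ae
    proof eventually_elim
      case (elim w)
      let ?g = "tilt_mass \<mu> (t + h) (y + w)" and ?p = "post_mean \<mu> (t + h) (y + w)"
      have "0 \<le> ?g * (norm (?p - ?m))\<^sup>2" using tilt_mass_nonneg by simp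
      also have "\<dots> = ?g * (norm ?p)\<^sup>2 - 2 * ((?g *\<^sub>R ?p) \<bullet> ?m) + (norm ?m)\<^sup>2 * ?g"
        by (simp add: power2_norm_eq_inner inner_diff inner_commute algebra_simps)
      finally show ?case using tilt_moment_eq[OF elim] by simp
    qed
  qed fact
  finally show "tilt_mass \<mu> t y * (norm ?m)\<^sup>2
      \<le> (\<integral>w. tilt_mass \<mu> (t + h) (y + w) * (norm (post_mean \<mu> (t + h) (y + w)))\<^sup>2 \<partial>gauss_var h)" .
qed

lemma integrable_fisher: "t \<ge> 0 \<Longrightarrow>
  integrable (gauss_var t) (\<lambda>y. tilt_mass \<mu> t y * (norm (post_mean \<mu> t y))\<^sup>2)"
  using integrable_fisher_step[of t 0 0] by simp

end

lemma
  fixes \<psi> :: "'a::euclidean_space \<Rightarrow> real"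
  assumes "s \<ge> 0" "h \<ge> 0" and \<psi>: "integrable (gauss_var (s + h)) \<psi>"
  shows integrable_gauss_var_add: "integrable (gauss_var s) (\<lambda>y. \<integral>w. \<psi> (y + w) \<partial>gauss_var h)"
    and integral_gauss_var_add: "(\<integral>y. (\<integral>w. \<psi> (y + w) \<partial>gauss_var h) \<partial>gauss_var s) = integral\<^sup>L (gauss_var (s + h)) \<psi>"
proof -
  interpret S: prob_space "gauss_var s :: 'a measure" by (rule prob_space_gauss_var)
  interpret W: prob_space "gauss_var h :: 'a measure" by (rule prob_space_gauss_var)
  interpret P: pair_sigma_finite "gauss_var s :: 'a measure" "gauss_var h :: 'a measure" ..
  have [measurable]: "\<psi> \<in> borel_measurable borel" using \<psi> by (simp add: borel_measurable_integrable)
  have *: "integrable (gauss_var s \<Otimes>\<^sub>M gauss_var h) (\<lambda>(y, w). \<psi> (y + w))"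
    using \<psi> unfolding gauss_var_convolution[OF assms(1,2), symmetric]
    by (subst (asm) integrable_distr_eq) (simp_all add: case_prod_beta')
  show "integrable (gauss_var s) (\<lambda>y. \<integral>w. \<psi> (y + w) \<partial>gauss_var h)"
    using P.integrable_fst[OF *] .
  have "(\<integral>y. (\<integral>w. \<psi> (y + w) \<partial>gauss_var h) \<partial>gauss_var s) = (\<integral>(y, w). \<psi> (y + w) \<partial>(gauss_var s \<Otimes>\<^sub>M gauss_var h))"
    using P.integral_fst[OF *] .
  also have "\<dots> = integral\<^sup>L (gauss_var (s + h)) \<psi>"
    unfolding gauss_var_convolution[OF assms(1,2), symmetric]
    by (subst integral_distr) (simp_all add: case_prod_beta')
  finally show "(\<integral>y. (\<integral>w. \<psi> (y + w) \<partial>gauss_var h) \<partial>gauss_var s) = integral\<^sup>L (gauss_var (s + h)) \<psi>" .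
qed

section \<open>Monotonicity of \<open>fisher\<close> and integrability of the entropy\<close>

context moment_measure
begin

lemma fisher_mono:
  assumes "0 \<le> s" "s \<le> t"
  shows "fisher \<mu> s \<le> fisher \<mu> t"
proof -
  define h where "h = t - s"
  have h: "h \<ge> 0" "t = s + h" using assms by (simp_all add: h_def)
  have i: "integrable (gauss_var (s + h)) (\<lambda>y. tilt_mass \<mu> t y * (norm (post_mean \<mu> t y))\<^sup>2)"
    using integrable_fisher[of t] assms h by simp
  have "fisher \<mu> s \<le> (\<integral>y. (\<integral>w. tilt_mass \<mu> t (y + w) * (norm (post_mean \<mu> t (y + w)))\<^sup>2 \<partial>gauss_var h) \<partial>gauss_var s)"
    unfolding fisher_def
  proof (rule integral_mono_AE)
    show "AE y in gauss_var s. tilt_mass \<mu> s y * (norm (post_mean \<mu> s y))\<^sup>2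
      \<le> (\<integral>w. tilt_mass \<mu> t (y + w) * (norm (post_mean \<mu> t (y + w)))\<^sup>2 \<partial>gauss_var h)"
      using AE_admissible[OF assms(1)] by eventually_elim (use fisher_step[OF h(1)] h(2) in simp)
  qed (use integrable_fisher assms integrable_gauss_var_add[OF _ h(1) i] in simp_all)
  also have "\<dots> = fisher \<mu> t"
    unfolding fisher_def using integral_gauss_var_add[OF _ h(1) i] assms h by simp
  finally show ?thesis .
qed

lemma fisher_le_second_moment:
  assumes "t \<ge> 0"
  shows "fisher \<mu> t \<le> (\<integral>x. (norm x)\<^sup>2 \<partial>\<mu>)"
proof -
  \<comment> \<open>The kernel is 1 at time 0 and position 0, so the semigroup identity started
    there returns plain moments of \<open>\<mu>\<close>.\<close>
  have i: "integrable \<mu> (\<lambda>x. gker 0 x 0 * (norm x)\<^sup>2)" using second_moment by simp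
  have "fisher \<mu> t \<le> (\<integral>y. (\<integral>x. gker (0 + t) x (0 + y) * (norm x)\<^sup>2 \<partial>\<mu>) \<partial>gauss_var t)"
    unfolding fisher_def
  proof (rule integral_mono_AE)
    show "AE y in gauss_var t. tilt_mass \<mu> t y * (norm (post_mean \<mu> t y))\<^sup>2
       \<le> (\<integral>x. gker (0 + t) x (0 + y) * (norm x)\<^sup>2 \<partial>\<mu>)"
      using AE_admissible[OF assms] by eventually_elim (simp add: tilt_mass_post_mean_le)
  qed (use integrable_fisher[OF assms] integrable_semigroup[OF assms _ i] in simp_all)
  also have "\<dots> = (\<integral>x. (norm x)\<^sup>2 \<partial>\<mu>)"
    using integral_semigroup[OF assms _ i] by simp
  finally show ?thesis .
qed

text \<open>Under the tilted law the position is Gaussian noise plus \<open>t x\<close>, so its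
  second moment is controlled by that of \<open>\<mu>\<close>. This is what dominates the entropy
  integrand.\<close>

lemma integrable_tilt_mass_norm2:
  assumes "t \<ge> 0"
  shows "integrable (gauss_var t) (\<lambda>y. tilt_mass \<mu> t y * (norm y)\<^sup>2)"
proof -
  interpret W: prob_space "gauss_var t :: 'a measure" by (rule prob_space_gauss_var)
  interpret P: pair_sigma_finite \<mu> "gauss_var t :: 'a measure" ..
  have "integrable (\<mu> \<Otimes>\<^sub>M gauss_var t) (\<lambda>(x, w). gker 0 x 0 * 1 * (norm (w + t *\<^sub>R x))\<^sup>2)"
  proof (rule Bochner_Integration.integrable_bound)
    have "integrable (\<mu> \<Otimes>\<^sub>M gauss_var t) (\<lambda>(x, w::'a). (norm w)\<^sup>2)"
      by (intro P.Fubini_integrable) (use integrable_gauss_var_norm2[of t, where 'a='a] in simp_all)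
    moreover have "integrable (\<mu> \<Otimes>\<^sub>M gauss_var t) (\<lambda>(x, w::'a). (norm x)\<^sup>2)"
      by (rule integrable_pair_gauss) (rule second_moment)
    ultimately show "integrable (\<mu> \<Otimes>\<^sub>M gauss_var t) (\<lambda>p::'a \<times> 'a. 2 * (norm (snd p))\<^sup>2 + 2 * t\<^sup>2 * (norm (fst p))\<^sup>2)"
      by (simp add: case_prod_beta')
    have "(norm (w + t *\<^sub>R x))\<^sup>2 \<le> 2 * (norm w)\<^sup>2 + 2 * t\<^sup>2 * (norm x)\<^sup>2" for w x :: 'a
    proof -
      have "0 \<le> (norm (w - t *\<^sub>R x))\<^sup>2" by simp
      then show ?thesis
        unfolding power2_norm_eq_inner
        by (simp add: inner_diff inner_add inner_commute power2_eq_square algebra_simps)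
    qed
    then show "AE p in \<mu> \<Otimes>\<^sub>M gauss_var t. norm (case p of (x, w) \<Rightarrow> gker 0 x 0 * 1 * (norm (w + t *\<^sub>R x))\<^sup>2)
        \<le> norm (2 * (norm (snd p))\<^sup>2 + 2 * t\<^sup>2 * (norm (fst p))\<^sup>2)"
      by (intro AE_I2) (simp add: case_prod_beta')
  qed simp
  from integrable_tilt[OF _ _ assms this] show ?thesis
    by (simp add: tilt_mass_def)
qed

text \<open>From below use \<open>u ln u \<ge> - 1\<close>, from above the logarithm of
  \<open>tilt_mass_le\<close>. The bound increases with \<open>tilt_mass\<close>, so the one for
  \<open>\<mu>\<close> dominates those for all its truncations.\<close>

lemma entropy_integrand_bound:
  assumes "admissible t y"
  shows "\<bar>tilt_mass \<mu> t y * ln (tilt_mass \<mu> t y)\<bar> \<le> 1 + tilt_mass \<mu> t y * ((norm y)\<^sup>2 / (2 * t))"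
proof -
  have "ln (tilt_mass \<mu> t y) \<le> (norm y)\<^sup>2 / (2 * t)"
    using tilt_mass_le[OF assms] tilt_mass_pos[OF assms] 
    by (metis exp_gt_zero ln_exp ln_le_cancel_iff)
  then have "tilt_mass \<mu> t y * ln (tilt_mass \<mu> t y) \<le> tilt_mass \<mu> t y * ((norm y)\<^sup>2 / (2 * t))"
    using tilt_mass_nonneg by (intro mult_left_mono)
  moreover have "tilt_mass \<mu> t y * ((norm y)\<^sup>2 / (2 * t)) \<ge> 0"
    using tilt_mass_nonneg admissible_nonneg[OF assms] by simp
  ultimately show ?thesis
    using mult_ln_ge[OF tilt_mass_nonneg, of t y] by linarith
qed

lemma integrable_ent:
  assumes "t \<ge> 0"
  shows "integrable (gauss_var t) (\<lambda>y. tilt_mass \<mu> t y * ln (tilt_mass \<mu> t y))"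
proof (rule Bochner_Integration.integrable_bound)
  interpret W: prob_space "gauss_var t :: 'a measure" by (rule prob_space_gauss_var)
  show "integrable (gauss_var t) (\<lambda>y. 1 + tilt_mass \<mu> t y * (norm y)\<^sup>2 / (2 * t))"
    using integrable_tilt_mass_norm2[OF assms] by simp
  show "AE y in gauss_var t. norm (tilt_mass \<mu> t y * ln (tilt_mass \<mu> t y)) \<le> norm (1 + tilt_mass \<mu> t y * (norm y)\<^sup>2 / (2 * t))"
    using AE_admissible[OF assms]
  proof eventually_elim
    case (elim y)
    show ?case using entropy_integrand_bound[OF elim] by simp
  qed
qed simp

end

section \<open>Entropy growth over a short time step\<close>

lemma integrable_gauss_var_id: "integrable (gauss_var t) (\<lambda>y::'a::euclidean_space. y)"
proof (rule Bochner_Integration.integrable_bound)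
  interpret W: prob_space "gauss_var t :: 'a measure" by (rule prob_space_gauss_var)
  show "integrable (gauss_var t) (\<lambda>y::'a. 1 + (norm y)\<^sup>2)"
    using integrable_gauss_var_norm2[of t, where 'a='a] by simp
  show "AE y::'a in gauss_var t. norm y \<le> norm (1 + (norm y)\<^sup>2)" by (simp add: le_one_plus_square)
qed simp

text \<open>The linear exponents combine to the drift \<open>x + x' - m\<close>, and the mismatch of
  the squared norms is the inner product of the deviations. The remaining kernel has Gaussian
  integral 1, so the chi-squared integral becomes an exponential moment of two independent posterior
  samples.\<close>

lemma gker_mult_divide:
  "gker h x w * gker h x' w / gker h m w = exp (h * ((x - m) \<bullet> (x' - m))) * gker h (x + x' - m) w"
  unfolding gker_def power2_norm_eq_inner
  by (simp add: inner_diff inner_add inner_commute algebra_simps add_divide_distrib diff_divide_distrib flip: exp_add exp_diff)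

lemma nn_integral_gker: "h \<ge> 0 \<Longrightarrow> (\<integral>\<^sup>+w. ennreal (gker h x w) \<partial>gauss_var h) = 1"
  for x :: "'a::euclidean_space"
  using nn_integral_gker_mult[of "\<lambda>_. 1" h x]
    prob_space.emeasure_space_1[OF prob_space_gauss_var[of h, where 'a='a]] by simp

context moment_measure
begin

text \<open>The next increment is centred noise plus \<open>h x\<close>, so its posterior predictive
  mean is \<open>h\<close> times the posterior mean.\<close>

lemma
  assumes h: "h \<ge> 0" and a: "admissible t y"
  shows integrable_tilt_mass_inner: "integrable (gauss_var h) (\<lambda>w. tilt_mass \<mu> (t + h) (y + w) * (w \<bullet> v))"
    and integral_tilt_mass_inner: "(\<integral>w. tilt_mass \<mu> (t + h) (y + w) * (w \<bullet> v) \<partial>gauss_var h) = h * (tilt_moment \<mu> t y \<bullet> v)"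
proof -
  interpret W: prob_space "gauss_var h :: 'a measure" by (rule prob_space_gauss_var)
  interpret P: pair_sigma_finite \<mu> "gauss_var h :: 'a measure" ..
  have Wi: "integrable (gauss_var h) (\<lambda>w::'a. w \<bullet> v)"
    using integrable_inner_left[OF integrable_gauss_var_id] .
  have 1: "integrable (\<mu> \<Otimes>\<^sub>M gauss_var h) (\<lambda>(x, w::'a). gker t x y * (w \<bullet> v))"
    by (intro P.Fubini_integrable) (use Wi integrable_gker[OF a] in \<open>simp_all add: abs_mult\<close>)
  have xv: "integrable \<mu> (\<lambda>x. gker t x y * (x \<bullet> v))"
    using integrable_inner_left[OF integrable_gker_id[OF a], of v] by simp
  have 2: "integrable (\<mu> \<Otimes>\<^sub>M gauss_var h) (\<lambda>(x, w::'a). h * (gker t x y * (x \<bullet> v)))"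
    using xv by (intro integrable_pair_gauss) simp
  have *: "integrable (\<mu> \<Otimes>\<^sub>M gauss_var h) (\<lambda>(x, w). gker t x y * 1 * ((w + h *\<^sub>R x) \<bullet> v))"
    using Bochner_Integration.integrable_add[OF 1 2]
    by (simp add: case_prod_beta' inner_add algebra_simps)
  show "integrable (gauss_var h) (\<lambda>w. tilt_mass \<mu> (t + h) (y + w) * (w \<bullet> v))"
    using integrable_tilt[OF _ _ h *] by (simp add: tilt_mass_def)
  have "(\<integral>w. tilt_mass \<mu> (t + h) (y + w) * (w \<bullet> v) \<partial>gauss_var h)
      = (\<integral>x. gker t x y * (\<integral>w. (w + h *\<^sub>R x) \<bullet> v \<partial>gauss_var h) \<partial>\<mu>)"
    using integral_tilt[OF _ _ h *] by (simp add: tilt_mass_def)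
  also have "\<dots> = (\<integral>x. h * (gker t x y * (x \<bullet> v)) \<partial>\<mu>)"
    using Wi by (simp add: inner_add integral_gauss_var_inner W.prob_space[simplified] mult_ac)
  also have "\<dots> = h * (tilt_moment \<mu> t y \<bullet> v)"
    using tilt_moment_inner[OF a] by simp
  finally show "(\<integral>w. tilt_mass \<mu> (t + h) (y + w) * (w \<bullet> v) \<partial>gauss_var h) = h * (tilt_moment \<mu> t y \<bullet> v)" .
qed

lemma norm_post_mean_le:
  assumes a: "admissible t y" and R: "AE x in \<mu>. norm x \<le> R"
  shows "norm (post_mean \<mu> t y) \<le> R"
proof -
  have "norm (tilt_moment \<mu> t y) \<le> (\<integral>x. norm (gker t x y *\<^sub>R x) \<partial>\<mu>)"
    unfolding tilt_moment_def by (rule integral_norm_bound)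
  also have "\<dots> \<le> (\<integral>x. gker t x y * R \<partial>\<mu>)"
  proof (rule integral_mono_AE)
    show "AE x in \<mu>. norm (gker t x y *\<^sub>R x) \<le> gker t x y * R"
      using R by eventually_elim (simp add: mult_left_mono)
  qed (use integrable_norm[OF integrable_gker_id[OF a]] integrable_gker[OF a] in simp_all)
  also have "\<dots> = tilt_mass \<mu> t y * R"
    by (simp add: tilt_mass_def)
  finally show ?thesis
    using tilt_mass_pos[OF a] by (simp add: post_mean_def field_simps)
qed

text \<open>A chi-squared estimate: over a time step \<open>h\<close> the posterior predictive law differs from the Gaussian
  with the posterior mean as drift only by \<open>O(h\<^sup>2)\<close>, since the first-order term
  \<open>h * ((x - m) \<bullet> (x' - m))\<close> integrates to zero.\<close>

lemma nn_integral_tilt_mass_square_le: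
  assumes h: "h \<ge> 0" and a: "admissible t y" and R: "AE x in \<mu>. norm x \<le> R" and hR: "4 * h * R\<^sup>2 \<le> 1"
  shows "(\<integral>\<^sup>+w. ennreal (tilt_mass \<mu> (t + h) (y + w) * tilt_mass \<mu> (t + h) (y + w) / gker h (post_mean \<mu> t y) w) \<partial>gauss_var h)
    \<le> ennreal ((tilt_mass \<mu> t y)\<^sup>2 * (1 + 16 * h\<^sup>2 * R^4))"
proof -
  interpret W: prob_space "gauss_var h :: 'a measure" by (rule prob_space_gauss_var)
  interpret P: pair_sigma_finite \<mu> "gauss_var h :: 'a measure" ..
  define m where "m = post_mean \<mu> t y"
  define k where "k x = gker t x y" for x
  \<comment> \<open>This is \<open>(4 h R^2)^2\<close>: both deviations from \<open>m\<close> have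
    norm at most \<open>2 R\<close>. The hypothesis \<open>hR\<close> keeps the exponent at most 1,
    as \<open>exp_le_quadratic\<close> requires.\<close>
  define C where "C = 16 * h\<^sup>2 * R^4"
  define G where "G = tilt_mass \<mu> t y"
  have [measurable]: "k \<in> borel_measurable borel" unfolding k_def[abs_def] by measurable
  have k_pos [simp]: "0 < k x" "0 \<le> k x" for x by (simp_all add: k_def)
  have m_le: "norm m \<le> R" unfolding m_def by (rule norm_post_mean_le[OF a R])
  have C: "C \<ge> 0" by (simp add: C_def)
  have G: "G > 0" unfolding G_def by (rule tilt_mass_pos[OF a])
  have exp_le: "exp (h * ((x - m) \<bullet> (x' - m))) \<le> 1 + h * ((x - m) \<bullet> (x' - m)) + C"
    if "norm x \<le> R" "norm x' \<le> R" for x x'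
  proof -
    let ?a = "h * ((x - m) \<bullet> (x' - m))"
    have "\<bar>(x - m) \<bullet> (x' - m)\<bar> \<le> norm (x - m) * norm (x' - m)" by (rule Cauchy_Schwarz_ineq2)
    also have "\<dots> \<le> (2 * R) * (2 * R)"
      using norm_triangle_ineq4[of x m] norm_triangle_ineq4[of x' m] that m_le
      by (intro mult_mono) (simp_all add: order_trans[OF norm_ge_zero m_le])
    finally have le: "\<bar>(x - m) \<bullet> (x' - m)\<bar> \<le> 4 * R\<^sup>2" by (simp add: power2_eq_square)
    have abs_le: "\<bar>?a\<bar> \<le> 4 * h * R\<^sup>2"
      using mult_left_mono[OF le h] h by (simp add: abs_mult mult_ac)
    then have "exp ?a \<le> 1 + ?a + ?a\<^sup>2" using hR by (intro exp_le_quadratic) linarith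
    also have "?a\<^sup>2 \<le> (4 * h * R\<^sup>2)\<^sup>2"
      using abs_le by (metis abs_ge_zero power2_abs power_mono)
    also have "\<dots> = C" by (simp add: C_def power_mult_distrib)
    finally show ?thesis by simp
  qed
  have ae: "AE w in gauss_var h. admissible (t + h) (y + w)" by (rule AE_admissible_add[OF a h])
  have "(\<integral>\<^sup>+w. ennreal (tilt_mass \<mu> (t + h) (y + w) * tilt_mass \<mu> (t + h) (y + w) / gker h m w) \<partial>gauss_var h)
      = (\<integral>\<^sup>+w. \<integral>\<^sup>+x. \<integral>\<^sup>+x'. ennreal (k x * k x' * (gker h x w * gker h x' w / gker h m w)) \<partial>\<mu> \<partial>\<mu> \<partial>gauss_var h)"
  proof (rule nn_integral_cong_AE)
    show "AE w in gauss_var h. ennreal (tilt_mass \<mu> (t + h) (y + w) * tilt_mass \<mu> (t + h) (y + w) / gker h m w)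
       = (\<integral>\<^sup>+x. \<integral>\<^sup>+x'. ennreal (k x * k x' * (gker h x w * gker h x' w / gker h m w)) \<partial>\<mu> \<partial>\<mu>)"
      using ae
    proof eventually_elim
      case (elim w)
      have g: "ennreal (tilt_mass \<mu> (t + h) (y + w)) = (\<integral>\<^sup>+x. ennreal (k x * gker h x w) \<partial>\<mu>)"
        unfolding tilt_mass_def k_def gker_add[symmetric]
        by (rule nn_integral_eq_integral[symmetric]) (use integrable_gker[OF elim] in simp_all)
      have "(\<integral>\<^sup>+x. \<integral>\<^sup>+x'. ennreal (k x * k x' * (gker h x w * gker h x' w / gker h m w)) \<partial>\<mu> \<partial>\<mu>)
         = (\<integral>\<^sup>+x. \<integral>\<^sup>+x'. ennreal (k x * gker h x w) * (ennreal (k x' * gker h x' w) * ennreal (1 / gker h m w)) \<partial>\<mu> \<partial>\<mu>)"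
        by (intro nn_integral_cong) (simp add: mult_ac flip: ennreal_mult)
      also have "\<dots> = ennreal (tilt_mass \<mu> (t + h) (y + w)) * (ennreal (tilt_mass \<mu> (t + h) (y + w)) * ennreal (1 / gker h m w))"
        by (simp add: nn_integral_cmult nn_integral_multc g)
      also have "\<dots> = ennreal (tilt_mass \<mu> (t + h) (y + w) * tilt_mass \<mu> (t + h) (y + w) / gker h m w)"
        by (simp add: tilt_mass_nonneg flip: ennreal_mult)
      finally show ?case by simp
    qed
  qed
  also have "\<dots> = (\<integral>\<^sup>+x. \<integral>\<^sup>+w. \<integral>\<^sup>+x'. ennreal (k x * k x' * (gker h x w * gker h x' w / gker h m w)) \<partial>\<mu> \<partial>gauss_var h \<partial>\<mu>)"
    by (rule P.Fubini') simp
  also have "\<dots> = (\<integral>\<^sup>+x. \<integral>\<^sup>+x'. \<integral>\<^sup>+w. ennreal (k x * k x' * (gker h x w * gker h x' w / gker h m w)) \<partial>gauss_var h \<partial>\<mu> \<partial>\<mu>)"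
    by (intro nn_integral_cong P.Fubini') simp
  also have "\<dots> = (\<integral>\<^sup>+x. \<integral>\<^sup>+x'. ennreal (k x * k x' * exp (h * ((x - m) \<bullet> (x' - m)))) \<partial>\<mu> \<partial>\<mu>)"
  proof (intro nn_integral_cong)
    fix x x'
    have "(\<integral>\<^sup>+w. ennreal (k x * k x' * (gker h x w * gker h x' w / gker h m w)) \<partial>gauss_var h)
       = (\<integral>\<^sup>+w. ennreal (k x * k x' * exp (h * ((x - m) \<bullet> (x' - m)))) * ennreal (gker h (x + x' - m) w) \<partial>gauss_var h)"
      unfolding gker_mult_divide by (intro nn_integral_cong) (simp add: mult_ac flip: ennreal_mult)
    also have "\<dots> = ennreal (k x * k x' * exp (h * ((x - m) \<bullet> (x' - m))))"
      using h by (simp add: nn_integral_cmult nn_integral_gker)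
    finally show "(\<integral>\<^sup>+w. ennreal (k x * k x' * (gker h x w * gker h x' w / gker h m w)) \<partial>gauss_var h)
       = ennreal (k x * k x' * exp (h * ((x - m) \<bullet> (x' - m))))" .
  qed
  also have "\<dots> \<le> (\<integral>\<^sup>+x. ennreal (k x * (G * (1 + C))) \<partial>\<mu>)"
  proof (rule nn_integral_mono_AE)
    show "AE x in \<mu>. (\<integral>\<^sup>+x'. ennreal (k x * k x' * exp (h * ((x - m) \<bullet> (x' - m)))) \<partial>\<mu>) \<le> ennreal (k x * (G * (1 + C)))"
      using R
    proof eventually_elim
      case (elim x)
      \<comment> \<open>The quadratic bound sorted by its dependence on \<open>x'\<close>, so that
        its integral involves only the mass and the moment in direction \<open>x - m\<close>.
        Inserting \<open>tilt_moment = G m\<close> cancels the two terms with factor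
        \<open>h\<close>.\<close>
      let ?u = "\<lambda>x'. (1 + C - h * ((x - m) \<bullet> m)) * k x' + h * (k x' * (x' \<bullet> (x - m)))"
      have u_eq: "?u x' = k x' * (1 + h * ((x - m) \<bullet> (x' - m)) + C)" for x'
        by (simp add: inner_diff inner_commute algebra_simps)
      have le: "AE x' in \<mu>. k x' * exp (h * ((x - m) \<bullet> (x' - m))) \<le> ?u x'"
        using R unfolding u_eq
      proof eventually_elim
        case (elim x')
        from exp_le[OF \<open>norm x \<le> R\<close> elim] show ?case by (intro mult_left_mono) simp_all
      qed
      have iu: "integrable \<mu> ?u"
        using integrable_gker[OF a] integrable_inner_left[OF integrable_gker_id[OF a], of "x - m"]
        by (simp add: k_def)
      have "(\<integral>\<^sup>+x'. ennreal (k x' * exp (h * ((x - m) \<bullet> (x' - m)))) \<partial>\<mu>) \<le> (\<integral>\<^sup>+x'. ennreal (?u x') \<partial>\<mu>)"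
        by (rule nn_integral_mono_AE) (use le in eventually_elim, simp add: ennreal_leI)
      also have "\<dots> = ennreal (integral\<^sup>L \<mu> ?u)"
      proof (rule nn_integral_eq_integral[OF iu])
        show "AE x' in \<mu>. 0 \<le> ?u x'"
          using le by eventually_elim (rule order_trans, rule mult_nonneg_nonneg, simp_all)
      qed
      also have "integral\<^sup>L \<mu> ?u = (1 + C - h * ((x - m) \<bullet> m)) * G + h * (tilt_moment \<mu> t y \<bullet> (x - m))"
        using integrable_gker[OF a] integrable_inner_left[OF integrable_gker_id[OF a], of "x - m"]
          tilt_moment_inner[OF a, of "x - m"]
        by (simp add: k_def G_def tilt_mass_def)
      also have "\<dots> = G * (1 + C)"
        unfolding tilt_moment_eq[OF a] G_def[symmetric] m_def[symmetric]
        by (simp add: inner_commute algebra_simps)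
      finally have "ennreal (k x) * (\<integral>\<^sup>+x'. ennreal (k x' * exp (h * ((x - m) \<bullet> (x' - m)))) \<partial>\<mu>) \<le> ennreal (k x) * ennreal (G * (1 + C))"
        by (rule mult_left_mono) simp
      then show ?case
        by (simp add: mult.assoc ennreal_mult' flip: nn_integral_cmult)
    qed
  qed
  also have "\<dots> = ennreal (\<integral>x. k x * (G * (1 + C)) \<partial>\<mu>)"
    using integrable_gker[OF a] G C by (intro nn_integral_eq_integral) (simp_all add: k_def)
  also have "(\<integral>x. k x * (G * (1 + C)) \<partial>\<mu>) = G * (G * (1 + C))"
    by (simp add: G_def tilt_mass_def k_def)
  finally show ?thesis by (simp add: G_def C_def m_def power2_eq_square mult_ac)
qed

text \<open>The true predictive mass \<open>g w\<close> is compared with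
  \<open>G * gker h m w\<close>, the prediction of a walk whose drift is frozen at the posterior
  mean \<open>m\<close>. The logarithm of the latter contributes \<open>h |m|^2 - h/2 |m|^2\<close>
  per unit mass, the source of the factor \<open>h / 2\<close>; replacing the former costs only the
  chi-squared error.\<close>

lemma ent_step:
  assumes h: "h \<ge> 0" and a: "admissible t y" and R: "AE x in \<mu>. norm x \<le> R" and hR: "4 * h * R\<^sup>2 \<le> 1"
    and int: "integrable (gauss_var h) (\<lambda>w. tilt_mass \<mu> (t + h) (y + w) * ln (tilt_mass \<mu> (t + h) (y + w)))"
  shows "(\<integral>w. tilt_mass \<mu> (t + h) (y + w) * ln (tilt_mass \<mu> (t + h) (y + w)) \<partial>gauss_var h)
    \<le> tilt_mass \<mu> t y * ln (tilt_mass \<mu> t y) + h / 2 * (tilt_mass \<mu> t y * (norm (post_mean \<mu> t y))\<^sup>2)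
      + 16 * h\<^sup>2 * R^4 * tilt_mass \<mu> t y"
proof -
  define m where "m = post_mean \<mu> t y"
  define G where "G = tilt_mass \<mu> t y"
  define g where "g w = tilt_mass \<mu> (t + h) (y + w)" for w
  define q where "q w = g w * g w / gker h m w" for w
  have [measurable]: "g \<in> borel_measurable borel" unfolding g_def[abs_def] by measurable
  have [measurable]: "q \<in> borel_measurable borel" unfolding q_def[abs_def] by measurable
  have G: "G > 0" unfolding G_def by (rule tilt_mass_pos[OF a])
  have q_nonneg: "0 \<le> q w" for w by (simp add: q_def)
  have q_le: "(\<integral>\<^sup>+w. ennreal (q w) \<partial>gauss_var h) \<le> ennreal (G\<^sup>2 * (1 + 16 * h\<^sup>2 * R^4))"
    unfolding q_def g_def m_def G_def by (rule nn_integral_tilt_mass_square_le[OF h a R hR])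
  have q_int: "integrable (gauss_var h) q"
    using q_le q_nonneg by (intro integrableI_bounded) (auto simp: le_less_trans)
  have q_le': "integral\<^sup>L (gauss_var h) q \<le> G\<^sup>2 * (1 + 16 * h\<^sup>2 * R^4)"
    using q_le q_nonneg by (simp add: nn_integral_eq_integral[OF q_int])
  have g_int: "integrable (gauss_var h) g" and g_eq: "integral\<^sup>L (gauss_var h) g = G"
    unfolding g_def[abs_def] G_def using integrable_tilt_mass_semigroup[OF h a] integral_tilt_mass_semigroup[OF h a] by auto
  have gw_int: "integrable (gauss_var h) (\<lambda>w. g w * (w \<bullet> m))"
    and gw_eq: "(\<integral>w. g w * (w \<bullet> m) \<partial>gauss_var h) = h * (G * (norm m)\<^sup>2)"
    unfolding g_def[abs_def] G_def using integrable_tilt_mass_inner[OF h a] integral_tilt_mass_inner[OF h a] tilt_moment_eq[OF a]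
    by (auto simp: m_def power2_norm_eq_inner)
  \<comment> \<open>The inequality \<open>ln u \<le> u - 1\<close> for
    \<open>u = g w / (G * gker h m w)\<close>, solved for \<open>ln (g w)\<close> and multiplied by
    \<open>g w\<close>. Each summand has an integral that is known or bounded.\<close>
  let ?U = "\<lambda>w. (ln G - h / 2 * (norm m)\<^sup>2 - 1) * g w + g w * (w \<bullet> m) + q w / G"
  have "(\<integral>w. g w * ln (g w) \<partial>gauss_var h) \<le> integral\<^sup>L (gauss_var h) ?U"
  proof (rule integral_mono_AE)
    show "integrable (gauss_var h) (\<lambda>w. g w * ln (g w))" using int unfolding g_def .
    show "integrable (gauss_var h) ?U" using g_int gw_int q_int by simp
    show "AE w in gauss_var h. g w * ln (g w) \<le> ?U w"
      using AE_admissible_add[OF a h]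
    proof eventually_elim
      case (elim w)
      have gpos: "g w > 0" unfolding g_def by (rule tilt_mass_pos[OF elim])
      define e where "e = gker h m w"
      have e: "e > 0" by (simp add: e_def)
      have "ln (g w / (G * e)) \<le> g w / (G * e) - 1" using gpos G e by (intro ln_le_minus_one) simp
      moreover have "ln (g w / (G * e)) = ln (g w) - ln G - ln e" using gpos G e by (simp add: ln_div ln_mult)
      moreover have "ln e = w \<bullet> m - h / 2 * (norm m)\<^sup>2" by (simp add: e_def gker_def inner_commute)
      ultimately have "ln (g w) \<le> ln G + (w \<bullet> m - h / 2 * (norm m)\<^sup>2) + g w / (G * e) - 1" by linarith
      then have "g w * ln (g w) \<le> g w * (ln G + (w \<bullet> m - h / 2 * (norm m)\<^sup>2) + g w / (G * e) - 1)"
        using gpos by (intro mult_left_mono) simp_all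
      also have "\<dots> = ?U w"
        unfolding q_def e_def[symmetric] using G e by (simp add: field_simps)
      finally show ?case .
    qed
  qed
  also have "\<dots> = (ln G - h / 2 * (norm m)\<^sup>2 - 1) * G + h * (G * (norm m)\<^sup>2) + integral\<^sup>L (gauss_var h) q / G"
    using g_int gw_int q_int by (simp add: g_eq gw_eq)
  also have "integral\<^sup>L (gauss_var h) q / G \<le> G * (1 + 16 * h\<^sup>2 * R^4)"
    using q_le' G by (simp add: divide_le_eq power2_eq_square mult_ac)
  also have "(ln G - h / 2 * (norm m)\<^sup>2 - 1) * G + h * (G * (norm m)\<^sup>2) + G * (1 + 16 * h\<^sup>2 * R^4)
      = G * ln G + h / 2 * (G * (norm m)\<^sup>2) + 16 * h\<^sup>2 * R^4 * G"
    by (simp add: field_simps)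
  finally show ?thesis unfolding g_def G_def m_def by simp
qed

section \<open>From short steps to the log-Sobolev type bound\<close>

lemma integral_tilt_mass: "t \<ge> 0 \<Longrightarrow> (\<integral>y. tilt_mass \<mu> t y \<partial>gauss_var t) = measure \<mu> UNIV"
  using integral_tilt_mass_semigroup[of t 0 0] by (simp add: tilt_mass_def)

lemma integrable_tilt_mass: "t \<ge> 0 \<Longrightarrow> integrable (gauss_var t) (tilt_mass \<mu> t)"
  using integrable_tilt_mass_semigroup[of t 0 0] by simp

lemma ent_increment:
  assumes t: "t \<ge> 0" and h: "h \<ge> 0" and R: "AE x in \<mu>. norm x \<le> R" and hR: "4 * h * R\<^sup>2 \<le> 1"
  shows "ent \<mu> (t + h) \<le> ent \<mu> t + h / 2 * fisher \<mu> t + 16 * h\<^sup>2 * R^4"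
proof -
  interpret T: prob_space "gauss_var t :: 'a measure" by (rule prob_space_gauss_var)
  interpret W: prob_space "gauss_var h :: 'a measure" by (rule prob_space_gauss_var)
  interpret P: pair_sigma_finite "gauss_var t :: 'a measure" "gauss_var h :: 'a measure" ..
  define \<psi> where "\<psi> y = tilt_mass \<mu> (t + h) y * ln (tilt_mass \<mu> (t + h) y)" for y
  have i: "integrable (gauss_var (t + h)) \<psi>"
    unfolding \<psi>_def[abs_def] using t h by (intro integrable_ent) simp
  have [measurable]: "\<psi> \<in> borel_measurable borel" unfolding \<psi>_def[abs_def] by measurable
  have "integrable (gauss_var t \<Otimes>\<^sub>M gauss_var h) (\<lambda>(y, w). \<psi> (y + w))"
    using i unfolding gauss_var_convolution[OF t h, symmetric]
    by (subst (asm) integrable_distr_eq) (simp_all add: case_prod_beta')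
  \<comment> \<open>Fubini gives integrability of the slices only for almost every \<open>y\<close>,
    which is enough since \<open>ent_step\<close> is integrated over \<open>y\<close>.\<close>
  from P.AE_integrable_fst'[OF this]
  have ae: "AE y in gauss_var t. integrable (gauss_var h) (\<lambda>w. \<psi> (y + w))" by simp
  have "ent \<mu> (t + h) = (\<integral>y. (\<integral>w. \<psi> (y + w) \<partial>gauss_var h) \<partial>gauss_var t)"
    using integral_gauss_var_add[OF t h i] by (simp add: ent_def flip: \<psi>_def)
  also have "\<dots> \<le> (\<integral>y. tilt_mass \<mu> t y * ln (tilt_mass \<mu> t y) + h / 2 * (tilt_mass \<mu> t y * (norm (post_mean \<mu> t y))\<^sup>2)
      + 16 * h\<^sup>2 * R^4 * tilt_mass \<mu> t y \<partial>gauss_var t)"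
  proof (rule integral_mono_AE)
    show "AE y in gauss_var t. (\<integral>w. \<psi> (y + w) \<partial>gauss_var h) \<le> tilt_mass \<mu> t y * ln (tilt_mass \<mu> t y)
        + h / 2 * (tilt_mass \<mu> t y * (norm (post_mean \<mu> t y))\<^sup>2) + 16 * h\<^sup>2 * R^4 * tilt_mass \<mu> t y"
      using ae AE_admissible[OF t]
    proof eventually_elim
      case (elim y)
      show ?case using ent_step[OF h elim(2) R hR] elim(1) unfolding \<psi>_def by simp
    qed
  qed (use integrable_gauss_var_add[OF t h i] integrable_ent[OF t] integrable_fisher[OF t] integrable_tilt_mass[OF t] in simp_all)
  also have "\<dots> = ent \<mu> t + h / 2 * fisher \<mu> t + 16 * h\<^sup>2 * R^4 * measure \<mu> UNIV"
    using integrable_ent[OF t] integrable_fisher[OF t] integrable_tilt_mass[OF t] integral_tilt_mass[OF t]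
    by (simp add: ent_def fisher_def)
  also have "\<dots> \<le> ent \<mu> t + h / 2 * fisher \<mu> t + 16 * h\<^sup>2 * R^4"
    using mass_le by (simp add: mult_left_le)
  finally show ?thesis .
qed

text \<open>With \<open>n\<close> pieces of length \<open>d / n\<close> the quadratic errors add up
  to order \<open>1 / n\<close>, and by monotonicity of \<open>fisher\<close> every piece may use
  the value at the final time.\<close>

lemma ent_le_bounded:
  assumes s: "s \<ge> 0" and d: "d \<ge> 0" and R: "AE x in \<mu>. norm x \<le> R"
  shows "ent \<mu> (s + d) \<le> ent \<mu> s + d / 2 * fisher \<mu> (s + d)"
proof (rule LIMSEQ_le_const)
  let ?F = "fisher \<mu> (s + d)"
  let ?b = "\<lambda>n. ent \<mu> s + d / 2 * ?F + 16 * d\<^sup>2 * R^4 * (1 / real n)"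
  have "?b \<longlonglongrightarrow> ent \<mu> s + d / 2 * ?F + 16 * d\<^sup>2 * R^4 * 0"
    by (intro tendsto_intros lim_1_over_n)
  then show "?b \<longlonglongrightarrow> ent \<mu> s + d / 2 * ?F" by simp
  obtain N :: nat where N: "4 * d * R\<^sup>2 \<le> real N" using real_arch_simple by blast
  show "\<exists>N. \<forall>n\<ge>N. ent \<mu> (s + d) \<le> ?b n"
  proof (intro exI allI impI)
    \<comment> \<open>\<open>N\<close> makes the pieces short enough for
      \<open>ent_increment\<close>; the successor excludes \<open>n = 0\<close>.\<close>
    fix n assume n: "n \<ge> Suc N"
    define h where "h = d / real n"
    have h: "h \<ge> 0" using d by (simp add: h_def)
    have nh: "real n * h = d" using n by (simp add: h_def)
    have hR: "4 * h * R\<^sup>2 \<le> 1"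
      using n N by (simp add: h_def divide_le_eq)
    have "j \<le> n \<longrightarrow> ent \<mu> (s + real j * h) \<le> ent \<mu> s + real j * (h / 2 * ?F + 16 * h\<^sup>2 * R^4)" for j
    proof (induction j)
      case (Suc j)
      show ?case
      proof
        assume j: "Suc j \<le> n"
        have "real j * h \<le> d" using j h unfolding nh[symmetric] by (intro mult_right_mono) simp_all
        then have f: "fisher \<mu> (s + real j * h) \<le> ?F" using s h by (intro fisher_mono) simp_all
        have "ent \<mu> (s + real (Suc j) * h) = ent \<mu> ((s + real j * h) + h)" by (simp add: algebra_simps)
        also have "\<dots> \<le> ent \<mu> (s + real j * h) + h / 2 * fisher \<mu> (s + real j * h) + 16 * h\<^sup>2 * R^4"
          using s h by (intro ent_increment R hR) simp_all
        also have "h / 2 * fisher \<mu> (s + real j * h) \<le> h / 2 * ?F"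
          using f h by (intro mult_left_mono) simp_all
        finally show "ent \<mu> (s + real (Suc j) * h) \<le> ent \<mu> s + real (Suc j) * (h / 2 * ?F + 16 * h\<^sup>2 * R^4)"
          using Suc j by (simp add: algebra_simps add_divide_distrib)
      qed
    qed simp
    from this[of n] have "ent \<mu> (s + d) \<le> ent \<mu> s + (real n * h) / 2 * ?F + 16 * (real n * h)\<^sup>2 * R^4 / real n"
      unfolding nh[symmetric] using n by (simp add: field_simps power2_eq_square)
    then show "ent \<mu> (s + d) \<le> ?b n" unfolding nh by simp
  qed
qed

text \<open>At time 0 the tilt is the constant total mass \<open>c\<close>, giving
  \<open>c ln c\<close>: zero for a probability measure and of the favourable sign for a
  truncation.\<close>

lemma ent_0_le: "ent \<mu> 0 \<le> 0"
proof -
  have "ent \<mu> 0 = measure \<mu> UNIV * ln (measure \<mu> UNIV)"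
    unfolding ent_def by (subst gauss_var_0_integral) (simp_all add: tilt_mass_def)
  also have "\<dots> \<le> 0" using mass_pos mass_le by (intro mult_nonneg_nonpos) simp_all
  finally show ?thesis .
qed

lemma ent_sum_le_bounded:
  fixes n :: nat
  assumes d: "\<And>k. k \<ge> 1 \<Longrightarrow> d k \<ge> 0" and R: "AE x in \<mu>. norm x \<le> R"
  shows "ent \<mu> (\<Sum>j=1..n. d j) \<le> (\<Sum>k=1..n. d k / 2 * fisher \<mu> (\<Sum>j=1..k. d j))"
proof (induction n)
  case 0
  then show ?case using ent_0_le by simp
next
  case (Suc n)
  have "ent \<mu> ((\<Sum>j=1..n. d j) + d (Suc n)) \<le> ent \<mu> (\<Sum>j=1..n. d j) + d (Suc n) / 2 * fisher \<mu> ((\<Sum>j=1..n. d j) + d (Suc n))"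
    using d by (intro ent_le_bounded[OF _ _ R] sum_nonneg) simp_all
  then show ?case using Suc by simp
qed

text \<open>The log-Sobolev type bound for unbounded \<open>\<mu>\<close>: restrict \<open>\<mu>\<close> to balls. The bounded case holds for
  subprobability measures, so no renormalisation is needed.\<close>

lemma ent_sum_le:
  fixes n :: nat
  assumes d: "\<And>k. k \<ge> 1 \<Longrightarrow> d k \<ge> 0"
  shows "ent \<mu> (\<Sum>j=1..n. d j) \<le> (\<Sum>k=1..n. d k / 2 * fisher \<mu> (\<Sum>j=1..k. d j))"
proof -
  define B :: "nat \<Rightarrow> 'a set" where "B i = cball 0 (real i)" for i
  \<comment> \<open>A density by an indicator keeps the underlying space and the Borel sets, as the
    locale demands.\<close>
  define \<nu> where "\<nu> i = density \<mu> (\<lambda>x. ennreal (indicator (B i) x))" for i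
  have [measurable]: "B i \<in> sets borel" for i by (simp add: B_def)
  have sets_nu [measurable_cong]: "sets (\<nu> i) = sets borel" for i by (simp add: \<nu>_def)
  have nu_integral: "integral\<^sup>L (\<nu> i) F = (\<integral>x. indicator (B i) x *\<^sub>R F x \<partial>\<mu>)"
    if "F \<in> borel_measurable borel" for i and F :: "'a \<Rightarrow> 'b::{banach, second_countable_topology}"
    unfolding \<nu>_def using that by (subst integral_density) auto
  have ev: "\<exists>i0. \<forall>i\<ge>i0. x \<in> B i" for x
    using real_arch_simple[of "norm x"] by (auto simp: B_def) (meson of_nat_le_iff order_trans)
  have lim: "(\<lambda>i. integral\<^sup>L (\<nu> i) F) \<longlonglongrightarrow> integral\<^sup>L \<mu> F"
    if F: "integrable \<mu> F" for F :: "'a \<Rightarrow> 'b::{banach, second_countable_topology}"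
  proof -
    have [measurable]: "F \<in> borel_measurable borel" using borel_measurable_integrable[OF F] by simp
    have "(\<lambda>i. \<integral>x. indicator (B i) x *\<^sub>R F x \<partial>\<mu>) \<longlonglongrightarrow> integral\<^sup>L \<mu> F"
    proof (rule integral_dominated_convergence)
      show "integrable \<mu> (\<lambda>x. norm (F x))" using F by simp
      show "AE x in \<mu>. (\<lambda>i. indicator (B i) x *\<^sub>R F x) \<longlonglongrightarrow> F x"
      proof (rule AE_I2)
        fix x
        from ev[of x] obtain i0 where "\<And>i. i \<ge> i0 \<Longrightarrow> x \<in> B i" by auto
        then show "(\<lambda>i. indicator (B i) x *\<^sub>R F x) \<longlonglongrightarrow> F x"
          by (intro tendsto_eventually eventually_sequentiallyI[of i0]) simp
      qed
      show "AE x in \<mu>. norm (indicator (B i) x *\<^sub>R F x) \<le> norm (F x)" for i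
        by (intro AE_I2) (simp add: indicator_def)
    qed simp_all
    then show ?thesis by (simp add: nu_integral)
  qed
  have emeasure_nu: "emeasure (\<nu> i) UNIV = emeasure \<mu> (B i)" for i
    unfolding \<nu>_def by (subst emeasure_density) (simp_all add: nn_integral_indicator[unfolded ennreal_indicator[symmetric]] ennreal_indicator)
  have measure_nu: "measure (\<nu> i) UNIV = measure \<mu> (B i)" for i
    by (simp add: measure_def emeasure_nu)
  have "(\<lambda>i. measure \<mu> (B i)) \<longlonglongrightarrow> measure \<mu> UNIV"
    using lim[of "\<lambda>_. 1::real"] sets_eq_imp_space_eq[OF sets_nu] by (simp add: measure_nu)
  \<comment> \<open>Small balls may carry no mass. The truncations satisfy the locale only from
    \<open>i0\<close> on, hence the shifted sequences below.\<close>
  then obtain i0 where i0: "\<And>i. i \<ge> i0 \<Longrightarrow> measure \<mu> (B i) > 0"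
    using order_tendstoD(1)[of _ "measure \<mu> UNIV" sequentially 0] mass_pos by (auto simp: eventually_sequentially)
  have loc: "moment_measure (\<nu> i)" if "i \<ge> i0" for i
  proof (intro moment_measure.intro moment_measure_axioms.intro finite_measureI)
    have sp: "space (\<nu> i) = UNIV" using sets_eq_imp_space_eq[OF sets_nu] by simp
    show "emeasure (\<nu> i) (space (\<nu> i)) \<noteq> \<infinity>" by (simp add: sp emeasure_nu)
    show "0 < measure (\<nu> i) UNIV" using i0[OF that] by (simp add: measure_nu)
    show "measure (\<nu> i) UNIV \<le> 1"
      using mass_le finite_measure_mono[of "B i" UNIV] by (simp add: measure_nu)
    show "integrable (\<nu> i) (\<lambda>x. (norm x)\<^sup>2)"
      unfolding \<nu>_def using integrable_mult_indicator[OF _ second_moment, of "B i"]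
      by (subst integrable_density) simp_all
  qed (rule sets_nu)
  have AE_nu: "AE x in \<nu> i. norm x \<le> real i" for i
    unfolding \<nu>_def by (subst AE_density) (auto simp: B_def indicator_def)
  have nu_le: "integral\<^sup>L (\<nu> i) F \<le> integral\<^sup>L \<mu> F"
    if F: "integrable \<mu> F" "\<And>x. F x \<ge> 0" for i and F :: "'a \<Rightarrow> real"
  proof -
    have "F \<in> borel_measurable borel" using borel_measurable_integrable[OF F(1)] by simp
    then have "integral\<^sup>L (\<nu> i) F = (\<integral>x. indicator (B i) x *\<^sub>R F x \<partial>\<mu>)" by (rule nu_integral)
    also have "\<dots> \<le> integral\<^sup>L \<mu> F"
      using F by (intro integral_mono integrable_mult_indicator) (auto simp: indicator_def)
    finally show ?thesis .
  qed
  have lim_mass: "(\<lambda>i. tilt_mass (\<nu> i) t y) \<longlonglongrightarrow> tilt_mass \<mu> t y" if "admissible t y" for t y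
    unfolding tilt_mass_def by (rule lim[OF integrable_gker[OF that]])
  have lim_mean: "(\<lambda>i. post_mean (\<nu> i) t y) \<longlonglongrightarrow> post_mean \<mu> t y" if "admissible t y" for t y
  proof -
    have "(\<lambda>i. tilt_moment (\<nu> i) t y) \<longlonglongrightarrow> tilt_moment \<mu> t y"
      unfolding tilt_moment_def by (rule lim[OF integrable_gker_id[OF that]])
    then show ?thesis
      unfolding post_mean_def using lim_mass[OF that] tilt_mass_pos[OF that] by (intro tendsto_intros) simp_all
  qed
  have lim_ent: "(\<lambda>i. ent (\<nu> (i + i0)) t) \<longlonglongrightarrow> ent \<mu> t" if t: "t \<ge> 0" for t
    unfolding ent_def
  proof (rule integral_dominated_convergence)
    interpret W: prob_space "gauss_var t :: 'a measure" by (rule prob_space_gauss_var)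
    \<comment> \<open>The dominating function is the entropy bound of the full measure; restriction
      to a ball only lowers \<open>tilt_mass\<close>.\<close>
    show "integrable (gauss_var t) (\<lambda>y. 1 + tilt_mass \<mu> t y * (norm y)\<^sup>2 / (2 * t))"
      using integrable_tilt_mass_norm2[OF t] by simp
    show "AE y in gauss_var t. (\<lambda>i. tilt_mass (\<nu> (i + i0)) t y * ln (tilt_mass (\<nu> (i + i0)) t y)) \<longlonglongrightarrow> tilt_mass \<mu> t y * ln (tilt_mass \<mu> t y)"
      using AE_admissible[OF t]
    proof eventually_elim
      case (elim y)
      have "(\<lambda>i. tilt_mass (\<nu> (i + i0)) t y) \<longlonglongrightarrow> tilt_mass \<mu> t y"
        using lim_mass[OF elim] by (rule LIMSEQ_ignore_initial_segment)
      then show ?case using tilt_mass_pos[OF elim] by (intro tendsto_mult tendsto_ln) simp_all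
    qed
    fix i
    interpret N: moment_measure "\<nu> (i + i0)" by (rule loc) simp
    show "(\<lambda>y. tilt_mass (\<nu> (i + i0)) t y * ln (tilt_mass (\<nu> (i + i0)) t y)) \<in> borel_measurable (gauss_var t)"
      by measurable
    show "AE y in gauss_var t. norm (tilt_mass (\<nu> (i + i0)) t y * ln (tilt_mass (\<nu> (i + i0)) t y)) \<le> 1 + tilt_mass \<mu> t y * (norm y)\<^sup>2 / (2 * t)"
      using AE_admissible[OF t]
    proof eventually_elim
      case (elim y)
      have "tilt_mass (\<nu> (i + i0)) t y \<le> tilt_mass \<mu> t y"
        unfolding tilt_mass_def using integrable_gker[OF elim] by (rule nu_le) simp
      then have "tilt_mass (\<nu> (i + i0)) t y * ((norm y)\<^sup>2 / (2 * t)) \<le> tilt_mass \<mu> t y * ((norm y)\<^sup>2 / (2 * t))"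
        using t by (intro mult_right_mono) simp_all
      then show ?case using N.entropy_integrand_bound[OF elim] by simp
    qed
  qed simp
  have lim_fisher: "(\<lambda>i. fisher (\<nu> (i + i0)) t) \<longlonglongrightarrow> fisher \<mu> t" if t: "t \<ge> 0" for t
    unfolding fisher_def
  proof (rule integral_dominated_convergence)
    \<comment> \<open>Domination comes from Jensen for the truncation followed by enlarging it to
      \<open>\<mu>\<close>; the resulting bound is integrable by the semigroup started at time
      0.\<close>
    have "integrable \<mu> (\<lambda>x. gker 0 x 0 * (norm x)\<^sup>2)" using second_moment by simp
    from integrable_semigroup[OF t _ this]
    show "integrable (gauss_var t) (\<lambda>y. \<integral>x. gker t x y * (norm x)\<^sup>2 \<partial>\<mu>)" by simp
    show "AE y in gauss_var t. (\<lambda>i. tilt_mass (\<nu> (i + i0)) t y * (norm (post_mean (\<nu> (i + i0)) t y))\<^sup>2)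
        \<longlonglongrightarrow> tilt_mass \<mu> t y * (norm (post_mean \<mu> t y))\<^sup>2"
      using AE_admissible[OF t]
    proof eventually_elim
      case (elim y)
      show ?case
        using LIMSEQ_ignore_initial_segment[OF lim_mass[OF elim], of i0] LIMSEQ_ignore_initial_segment[OF lim_mean[OF elim], of i0]
        by (intro tendsto_intros)
    qed
    fix i
    interpret N: moment_measure "\<nu> (i + i0)" by (rule loc) simp
    show "(\<lambda>y. tilt_mass (\<nu> (i + i0)) t y * (norm (post_mean (\<nu> (i + i0)) t y))\<^sup>2) \<in> borel_measurable (gauss_var t)"
      by measurable
    show "AE y in gauss_var t. norm (tilt_mass (\<nu> (i + i0)) t y * (norm (post_mean (\<nu> (i + i0)) t y))\<^sup>2)
       \<le> (\<integral>x. gker t x y * (norm x)\<^sup>2 \<partial>\<mu>)"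
      using AE_admissible[OF t]
    proof eventually_elim
      case (elim y)
      have "tilt_mass (\<nu> (i + i0)) t y * (norm (post_mean (\<nu> (i + i0)) t y))\<^sup>2 \<le> (\<integral>x. gker t x y * (norm x)\<^sup>2 \<partial>\<nu> (i + i0))"
        by (rule N.tilt_mass_post_mean_le[OF elim])
      also have "\<dots> \<le> (\<integral>x. gker t x y * (norm x)\<^sup>2 \<partial>\<mu>)"
        using integrable_gker_norm2[OF elim] by (rule nu_le) simp
      finally show ?case using N.tilt_mass_nonneg by (simp add: abs_mult)
    qed
  qed simp
  have nonneg: "(\<Sum>j=1..k. d j) \<ge> 0" for k :: nat using d by (intro sum_nonneg) simp
  show ?thesis
  proof (rule LIMSEQ_le)
    show "(\<lambda>i. ent (\<nu> (i + i0)) (\<Sum>j=1..n. d j)) \<longlonglongrightarrow> ent \<mu> (\<Sum>j=1..n. d j)"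
      by (rule lim_ent[OF nonneg])
    show "(\<lambda>i. \<Sum>k=1..n. d k / 2 * fisher (\<nu> (i + i0)) (\<Sum>j=1..k. d j)) \<longlonglongrightarrow> (\<Sum>k=1..n. d k / 2 * fisher \<mu> (\<Sum>j=1..k. d j))"
      by (intro tendsto_intros lim_fisher nonneg)
    show "\<exists>N. \<forall>i\<ge>N. ent (\<nu> (i + i0)) (\<Sum>j=1..n. d j) \<le> (\<Sum>k=1..n. d k / 2 * fisher (\<nu> (i + i0)) (\<Sum>j=1..k. d j))"
      using moment_measure.ent_sum_le_bounded[OF loc, of _ d, OF _ d AE_nu] by auto
  qed
qed

end

section \<open>Gaussian walks with drift\<close>

(* Otherwise the simplifier turns the index sets {1..n} into {Suc 0..n}. *)
declare One_nat_def [simp del]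

abbreviation noise_law :: "nat \<Rightarrow> (nat \<Rightarrow> 'a::euclidean_space) measure" where
  "noise_law n \<equiv> PiM {1..n} (\<lambda>_. std_gauss)"

text \<open>\<^const>\<open>Zproc\<close> driven by the coordinate process; with a constant drift it is \<^const>\<open>Yproc\<close>.\<close>

abbreviation walk :: "(nat \<Rightarrow> real) \<Rightarrow> (nat \<Rightarrow> 'a::euclidean_space \<Rightarrow> 'a) \<Rightarrow> nat \<Rightarrow> (nat \<Rightarrow> 'a) \<Rightarrow> 'a" where
  "walk \<delta> g \<equiv> Zproc \<delta> g (\<lambda>k z. z k)"

definition walk_path :: "(nat \<Rightarrow> real) \<Rightarrow> (nat \<Rightarrow> 'a::euclidean_space \<Rightarrow> 'a) \<Rightarrow> nat \<Rightarrow> (nat \<Rightarrow> 'a) \<Rightarrow> nat \<Rightarrow> 'a" where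
  "walk_path \<delta> g n z = (\<lambda>k\<in>{1..n}. walk \<delta> g k z)"

text \<open>Paths are extensional functions on \<open>{1..n}\<close> and hence
  \<open>undefined\<close> at 0; this restores the common start value.\<close>

definition path_at :: "(nat \<Rightarrow> 'a::euclidean_space) \<Rightarrow> nat \<Rightarrow> 'a" where
  "path_at y k = (if k = 0 then 0 else y k)"

text \<open>Each summand is a Cameron-Martin exponent for one increment: drift against increment,
  minus half the variance times the squared drift.\<close>

definition drift_likelihood :: "(nat \<Rightarrow> real) \<Rightarrow> (nat \<Rightarrow> 'a::euclidean_space \<Rightarrow> 'a) \<Rightarrow> nat \<Rightarrow> (nat \<Rightarrow> 'a) \<Rightarrow> real" where
  "drift_likelihood \<delta> g n y = exp (\<Sum>k=1..n. g k (path_at y (k - 1)) \<bullet> (path_at y k - path_at y (k - 1))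
      - \<delta> k / 2 * (norm (g k (path_at y (k - 1))))\<^sup>2)"

section \<open>Measurability, recursion and change of drift for walks\<close>

lemma Zproc_measurable:
  assumes "\<And>j. 1 \<le> j \<Longrightarrow> j \<le> k \<Longrightarrow> g j \<in> borel_measurable borel"
    and "\<And>j. 1 \<le> j \<Longrightarrow> j \<le> k \<Longrightarrow> N j \<in> borel_measurable M"
  shows "(\<lambda>\<omega>. Zproc \<delta> g N k \<omega>) \<in> borel_measurable M"
  using assms
proof (induction k)
  case (Suc k)
  have [measurable]: "(\<lambda>\<omega>. Zproc \<delta> g N k \<omega>) \<in> borel_measurable M" using Suc by simp
  have [measurable]: "g (Suc k) \<in> borel_measurable borel" "N (Suc k) \<in> borel_measurable M" using Suc by simp_all
  show ?case by simp
next
  case 0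
  show ?case unfolding Zproc.simps by simp
qed

lemma Zproc_cong:
  assumes "\<And>j. 1 \<le> j \<Longrightarrow> j \<le> k \<Longrightarrow> N j \<omega> = N' j \<omega>'"
  shows "Zproc \<delta> g N k \<omega> = Zproc \<delta> g N' k \<omega>'"
  using assms by (induction k) simp_all

lemma Yproc_eq_Zproc: "Yproc \<delta> X N k \<omega> = Zproc \<delta> (\<lambda>_ _. X \<omega>) N k \<omega>"
  by (induction k) simp_all

text \<open>Separates a multiple of \<open>X\<close> from a function of the noise alone, so that
  their independence can be used.\<close>

lemma Yproc_eq_sum: "Yproc \<delta> X N k \<omega> = (\<Sum>j=1..k. \<delta> j) *\<^sub>R X \<omega> + Zproc \<delta> (\<lambda>_ _. 0) N k \<omega>"
  by (induction k) (simp_all add: scaleR_add_left)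

lemma Yproc_measurable:
  assumes [measurable]: "X \<in> borel_measurable M" "\<And>j. 1 \<le> j \<Longrightarrow> j \<le> k \<Longrightarrow> N j \<in> borel_measurable M"
  shows "(\<lambda>\<omega>. Yproc \<delta> X N k \<omega>) \<in> borel_measurable M"
proof -
  have [measurable]: "(\<lambda>\<omega>. Zproc \<delta> (\<lambda>_ _. 0) N k \<omega>) \<in> borel_measurable M"
    by (rule Zproc_measurable) (use assms in simp_all)
  show ?thesis unfolding Yproc_eq_sum by measurable
qed

lemma measurable_noise_component:
  "k \<in> {1..n} \<Longrightarrow> (\<lambda>z. z k) \<in> borel_measurable (PiM {1..n} (\<lambda>_. borel))"
  by (rule measurable_component_singleton)

lemma sets_noise_law [measurable_cong, simp]: "sets (noise_law n) = sets (PiM {1..n} (\<lambda>_. borel))"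
  by (intro sets_PiM_cong) simp_all

lemma walk_path_measurable:
  assumes "\<And>j. j \<in> {1..n} \<Longrightarrow> g j \<in> borel_measurable borel"
  shows "walk_path \<delta> g n \<in> measurable (PiM {1..n} (\<lambda>_. borel)) (PiM {1..n} (\<lambda>_. borel))"
  unfolding walk_path_def
proof (rule measurable_restrict)
  fix k assume k: "k \<in> {1..n}"
  show "(\<lambda>z. walk \<delta> g k z) \<in> borel_measurable (PiM {1..n} (\<lambda>_. borel))"
    by (rule Zproc_measurable) (use assms k in \<open>auto intro!: measurable_noise_component\<close>)
qed

lemma path_at_measurable [measurable]:
  "k \<le> n \<Longrightarrow> (\<lambda>y. path_at y k) \<in> borel_measurable (PiM {1..n} (\<lambda>_. borel))"
  by (cases "k = 0") (auto simp: path_at_def intro!: measurable_noise_component)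

lemma drift_likelihood_measurable:
  assumes "\<And>j. j \<in> {1..n} \<Longrightarrow> g j \<in> borel_measurable borel"
  shows "drift_likelihood \<delta> g n \<in> borel_measurable (PiM {1..n} (\<lambda>_. borel))"
proof -
  have "(\<lambda>y. g k (path_at y (k - 1)) \<bullet> (path_at y k - path_at y (k - 1))
      - \<delta> k / 2 * (norm (g k (path_at y (k - 1))))\<^sup>2) \<in> borel_measurable (PiM {1..n} (\<lambda>_. borel))"
    if k: "k \<in> {1..n}" for k
  proof -
    have [measurable]: "g k \<in> borel_measurable borel" using assms k by simp
    have [measurable]: "(\<lambda>y. path_at y (k - 1)) \<in> borel_measurable (PiM {1..n} (\<lambda>_. borel))"
      "(\<lambda>y. path_at y k) \<in> borel_measurable (PiM {1..n} (\<lambda>_. borel))" using k by auto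
    show ?thesis by measurable
  qed
  then show ?thesis unfolding drift_likelihood_def[abs_def]
    by (intro borel_measurable_exp borel_measurable_sum measurable_compose[OF _ borel_measurable_exp]) auto
qed

lemma walk_path_Suc:
  "walk_path \<delta> g (Suc n) (z(Suc n := w))
    = (walk_path \<delta> g n z)(Suc n := walk \<delta> g n z + \<delta> (Suc n) *\<^sub>R g (Suc n) (walk \<delta> g n z) + sqrt (\<delta> (Suc n)) *\<^sub>R w)"
proof -
  have "walk \<delta> g k (z(Suc n := w)) = walk \<delta> g k z" if "k \<le> n" for k
    by (rule Zproc_cong) (use that in auto)
  then show ?thesis by (auto simp: walk_path_def fun_eq_iff restrict_def le_Suc_eq)
qed

lemma path_at_walk_path: "k \<le> n \<Longrightarrow> path_at (walk_path \<delta> g n z) k = walk \<delta> g k z"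
  by (auto simp: path_at_def walk_path_def)

lemma drift_likelihood_Suc:
  "drift_likelihood \<delta> g (Suc n) (y(Suc n := path_at y n + sqrt (\<delta> (Suc n)) *\<^sub>R w))
    = drift_likelihood \<delta> g n y * exp (g (Suc n) (path_at y n) \<bullet> (sqrt (\<delta> (Suc n)) *\<^sub>R w) - \<delta> (Suc n) / 2 * (norm (g (Suc n) (path_at y n)))\<^sup>2)"
proof -
  have *: "path_at (y(Suc n := u)) k = (if k = Suc n then u else path_at y k)" for u k
    by (simp add: path_at_def)
  show ?thesis
    unfolding drift_likelihood_def exp_add[symmetric]
    by (simp add: * sum.cl_ivl_Suc, intro sum.cong) auto
qed

lemma product_sigma_finite_std_gauss: "product_sigma_finite (\<lambda>_. std_gauss :: 'a::euclidean_space measure)"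
  by (rule product_sigma_finite.intro)
     (rule prob_space_imp_sigma_finite[OF prob_space_std_gauss])

lemma noise_law_Suc_nn_integral:
  assumes "F \<in> borel_measurable (PiM {1..Suc n} (\<lambda>_. borel))"
  shows "(\<integral>\<^sup>+z. F z \<partial>noise_law (Suc n)) = (\<integral>\<^sup>+z. \<integral>\<^sup>+w. F (z(Suc n := w)) \<partial>std_gauss \<partial>noise_law n)"
proof -
  interpret product_sigma_finite "\<lambda>_::nat. std_gauss :: 'a measure" by (rule product_sigma_finite_std_gauss)
  have I: "{1..Suc n} = insert (Suc n) {1..n}" by auto
  have "F \<in> borel_measurable (PiM (insert (Suc n) {1..n}) (\<lambda>_. std_gauss))"
    using assms sets_noise_law[of "Suc n"] unfolding I by (simp cong: measurable_cong_sets)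
  from product_nn_integral_insert[OF _ _ this] show ?thesis unfolding I by simp
qed

text \<open>The discrete Girsanov formula; the induction step is the Cameron--Martin shift of the last increment.\<close>

lemma nn_integral_walk_path:
  fixes g :: "nat \<Rightarrow> 'a::euclidean_space \<Rightarrow> 'a"
  assumes \<delta>: "\<And>k. k \<ge> 1 \<Longrightarrow> \<delta> k > 0"
    and g: "\<And>j. j \<in> {1..n} \<Longrightarrow> g j \<in> borel_measurable borel"
    and \<psi>: "\<psi> \<in> borel_measurable (PiM {1..n} (\<lambda>_. borel))"
  shows "(\<integral>\<^sup>+z. \<psi> (walk_path \<delta> g n z) \<partial>noise_law n)
    = (\<integral>\<^sup>+z. \<psi> (walk_path \<delta> (\<lambda>_ _. 0) n z) * ennreal (drift_likelihood \<delta> g n (walk_path \<delta> (\<lambda>_ _. 0) n z)) \<partial>noise_law n)"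
  using g \<psi>
proof (induction n arbitrary: \<psi>)
  case 0
  then show ?case by (simp add: walk_path_def drift_likelihood_def)
next
  case (Suc n)
  let ?d = "\<delta> (Suc n)" and ?g = "g (Suc n)" and ?W = "walk_path \<delta> (\<lambda>_ _. 0 :: 'a) n"
  let ?E = "\<lambda>v w. ennreal (exp (?g v \<bullet> (sqrt ?d *\<^sub>R w) - ?d / 2 * (norm (?g v))\<^sup>2))"
  \<comment> \<open>The test function with the last increment integrated out under its
    Cameron-Martin density. It depends only on the first \<open>n\<close> positions, so the
    induction hypothesis applies to it.\<close>
  define \<phi> where "\<phi> y = (\<integral>\<^sup>+w. \<psi> (y(Suc n := path_at y n + sqrt ?d *\<^sub>R w)) * ?E (path_at y n) w \<partial>std_gauss)" for y
  interpret S: prob_space "std_gauss :: 'a measure" by (rule prob_space_std_gauss)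
  have d: "?d > 0" using \<delta> by simp
  note [measurable] = Suc.prems(2)
  have g_meas [measurable]: "?g \<in> borel_measurable borel" using Suc.prems(1) by simp
  have pn [measurable]: "(\<lambda>y. path_at y n) \<in> borel_measurable (PiM {1..n} (\<lambda>_. borel))" by simp
  have I: "{1..Suc n} = {1..n} \<union> {Suc n}" by auto
  have upd [measurable]: "(\<lambda>p. (fst p)(Suc n := path_at (fst p) n + sqrt ?d *\<^sub>R snd p))
      \<in> measurable (PiM {1..n} (\<lambda>_. borel) \<Otimes>\<^sub>M std_gauss) (PiM {1..Suc n} (\<lambda>_. borel))"
    by (rule measurable_fun_upd[OF I]) measurable
  have \<phi> [measurable]: "\<phi> \<in> borel_measurable (PiM {1..n} (\<lambda>_. borel))"
    unfolding \<phi>_def[abs_def]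
    by (rule S.borel_measurable_nn_integral) (unfold case_prod_beta', measurable)
  have W: "walk_path \<delta> g n \<in> measurable (PiM {1..n} (\<lambda>_. borel)) (PiM {1..n} (\<lambda>_. borel))"
    "walk_path \<delta> g (Suc n) \<in> measurable (PiM {1..Suc n} (\<lambda>_. borel)) (PiM {1..Suc n} (\<lambda>_. borel))"
    "walk_path \<delta> (\<lambda>_ _. 0) (Suc n) \<in> measurable (PiM {1..Suc n} (\<lambda>_. borel)) (PiM {1..Suc n} (\<lambda>_. borel :: 'a measure))"
    using Suc.prems(1) by (auto intro!: walk_path_measurable)
  note [measurable] = W drift_likelihood_measurable[of "Suc n" g \<delta>, OF Suc.prems(1)]
  have spc: "space (noise_law n) = space (PiM {1..n} (\<lambda>_. borel :: 'a measure))"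
    by (rule sets_eq_imp_space_eq) simp
  \<comment> \<open>Given the past, the last drift is a fixed vector, and moving the last noise by
    \<open>sqrt \<delta>\<close> times this vector produces it.\<close>
  have shift: "(\<integral>\<^sup>+w. \<psi> (y(Suc n := path_at y n + ?d *\<^sub>R ?g (path_at y n) + sqrt ?d *\<^sub>R w)) \<partial>std_gauss) = \<phi> y"
    if y: "y \<in> space (PiM {1..n} (\<lambda>_. borel))" for y
  proof -
    let ?v = "path_at y n" and ?a = "sqrt ?d *\<^sub>R ?g (path_at y n)"
    let ?F = "\<lambda>w. \<psi> (y(Suc n := ?v + sqrt ?d *\<^sub>R w))"
    have F [measurable]: "?F \<in> borel_measurable borel"
    proof -
      have "(\<lambda>w. (y, w)) \<in> measurable borel (PiM {1..n} (\<lambda>_. borel) \<Otimes>\<^sub>M (std_gauss :: 'a measure))"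
        using y by (intro measurable_Pair) (simp_all add: measurable_def)
      from measurable_compose[OF this measurable_compose[OF upd Suc.prems(2)]] show ?thesis by (simp add: fun_upd_def)
    qed
    have "(\<integral>\<^sup>+w. \<psi> (y(Suc n := ?v + ?d *\<^sub>R ?g ?v + sqrt ?d *\<^sub>R w)) \<partial>std_gauss) = (\<integral>\<^sup>+w. ?F (w + ?a) \<partial>std_gauss)"
      using d by (simp add: scaleR_add_right add_ac)
    also have "\<dots> = (\<integral>\<^sup>+w. ?F w \<partial>distr std_gauss borel (\<lambda>w. w + ?a))"
      by (simp add: nn_integral_distr)
    also have "\<dots> = (\<integral>\<^sup>+w. ennreal (exp (?a \<bullet> w - (norm ?a)\<^sup>2 / 2)) * ?F w \<partial>std_gauss)"
      unfolding std_gauss_shift[symmetric] by (simp add: nn_integral_density)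
    also have "\<dots> = \<phi> y"
      unfolding \<phi>_def using d by (intro nn_integral_cong) (simp add: power_mult_distrib mult_ac)
    finally show ?thesis .
  qed
  have mem: "walk_path \<delta> g' n z \<in> space (PiM {1..n} (\<lambda>_. borel))" for g' :: "nat \<Rightarrow> 'a \<Rightarrow> 'a" and z
    by (simp add: walk_path_def space_PiM)
  have "(\<integral>\<^sup>+z. \<psi> (walk_path \<delta> g (Suc n) z) \<partial>noise_law (Suc n))
     = (\<integral>\<^sup>+z. \<integral>\<^sup>+w. \<psi> (walk_path \<delta> g (Suc n) (z(Suc n := w))) \<partial>std_gauss \<partial>noise_law n)"
    by (rule noise_law_Suc_nn_integral) measurable
  also have "\<dots> = (\<integral>\<^sup>+z. \<phi> (walk_path \<delta> g n z) \<partial>noise_law n)"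
    unfolding walk_path_Suc using shift[OF mem] by (simp add: path_at_walk_path)
  also have "\<dots> = (\<integral>\<^sup>+z. \<phi> (?W z) * ennreal (drift_likelihood \<delta> g n (?W z)) \<partial>noise_law n)"
    using Suc.prems(1) by (intro Suc.IH \<phi>) simp
  also have "\<dots> = (\<integral>\<^sup>+z. \<integral>\<^sup>+w. \<psi> ((?W z)(Suc n := path_at (?W z) n + sqrt ?d *\<^sub>R w)) *
      ennreal (drift_likelihood \<delta> g (Suc n) ((?W z)(Suc n := path_at (?W z) n + sqrt ?d *\<^sub>R w))) \<partial>std_gauss \<partial>noise_law n)"
  proof (rule nn_integral_cong)
    fix z
    have m: "(\<lambda>w. (?W z, w)) \<in> measurable std_gauss (PiM {1..n} (\<lambda>_. borel) \<Otimes>\<^sub>M std_gauss)"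
      using mem[of "\<lambda>_ _. 0" z] by (intro measurable_Pair) (simp_all add: measurable_def)
    have [measurable]: "(\<lambda>w. \<psi> ((?W z)(Suc n := path_at (?W z) n + sqrt ?d *\<^sub>R w))) \<in> borel_measurable std_gauss"
      using measurable_compose[OF m measurable_compose[OF upd Suc.prems(2)]] by (simp add: fun_upd_def)
    show "\<phi> (?W z) * ennreal (drift_likelihood \<delta> g n (?W z)) = (\<integral>\<^sup>+w. \<psi> ((?W z)(Suc n := path_at (?W z) n + sqrt ?d *\<^sub>R w)) *
      ennreal (drift_likelihood \<delta> g (Suc n) ((?W z)(Suc n := path_at (?W z) n + sqrt ?d *\<^sub>R w))) \<partial>std_gauss)"
      unfolding drift_likelihood_Suc \<phi>_def
      by (subst nn_integral_multc[symmetric])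
         (simp_all add: ennreal_mult drift_likelihood_def mult_ac)
  qed
  also have "\<dots> = (\<integral>\<^sup>+z. \<integral>\<^sup>+w. \<psi> (walk_path \<delta> (\<lambda>_ _. 0) (Suc n) (z(Suc n := w))) *
      ennreal (drift_likelihood \<delta> g (Suc n) (walk_path \<delta> (\<lambda>_ _. 0) (Suc n) (z(Suc n := w)))) \<partial>std_gauss \<partial>noise_law n)"
    unfolding walk_path_Suc by (simp add: path_at_walk_path)
  also have "\<dots> = (\<integral>\<^sup>+z. \<psi> (walk_path \<delta> (\<lambda>_ _. 0) (Suc n) z) *
      ennreal (drift_likelihood \<delta> g (Suc n) (walk_path \<delta> (\<lambda>_ _. 0) (Suc n) z)) \<partial>noise_law (Suc n))"
    by (rule noise_law_Suc_nn_integral[symmetric]) measurable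
  finally show ?case .
qed

section \<open>Path laws as densities over the driftless walk\<close>

definition driftless_law :: "(nat \<Rightarrow> real) \<Rightarrow> nat \<Rightarrow> (nat \<Rightarrow> 'a::euclidean_space) measure" where
  "driftless_law \<delta> n = distr (noise_law n) (PiM {1..n} (\<lambda>_. borel)) (walk_path \<delta> (\<lambda>_ _. 0) n)"

lemma walk_path_driftless_measurable [measurable]:
  "walk_path \<delta> (\<lambda>_ _. 0) n \<in> measurable (PiM {1..n} (\<lambda>_. borel)) (PiM {1..n} (\<lambda>_. borel))"
  by (rule walk_path_measurable) simp

lemma sets_driftless_law [simp, measurable_cong]: "sets (driftless_law \<delta> n) = sets (PiM {1..n} (\<lambda>_. borel))"
  by (simp add: driftless_law_def)

lemma nn_integral_driftless_law:
  "F \<in> borel_measurable (PiM {1..n} (\<lambda>_. borel)) \<Longrightarrow>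
    (\<integral>\<^sup>+y. F y \<partial>driftless_law \<delta> n) = (\<integral>\<^sup>+z. F (walk_path \<delta> (\<lambda>_ _. 0) n z) \<partial>noise_law n)"
  unfolding driftless_law_def by (subst nn_integral_distr) simp_all

lemma prob_space_noise_law: "prob_space (noise_law n :: (nat \<Rightarrow> 'a::euclidean_space) measure)"
  by (intro prob_space_PiM prob_space_std_gauss)

lemma distr_walk_path:
  fixes g :: "nat \<Rightarrow> 'a::euclidean_space \<Rightarrow> 'a"
  assumes "\<And>k. k \<ge> 1 \<Longrightarrow> \<delta> k > 0" and g: "\<And>j. j \<in> {1..n} \<Longrightarrow> g j \<in> borel_measurable borel"
  shows "distr (noise_law n) (PiM {1..n} (\<lambda>_. borel)) (walk_path \<delta> g n)
    = density (driftless_law \<delta> n) (\<lambda>y. ennreal (drift_likelihood \<delta> g n y))"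
proof (rule measure_eqI)
  fix A assume "A \<in> sets (distr (noise_law n) (PiM {1..n} (\<lambda>_. borel)) (walk_path \<delta> g n))"
  then have [measurable]: "A \<in> sets (PiM {1..n} (\<lambda>_. borel))" by simp
  note [measurable] = walk_path_measurable[of n g, OF g] drift_likelihood_measurable[of n g, OF g]
  have "emeasure (distr (noise_law n) (PiM {1..n} (\<lambda>_. borel)) (walk_path \<delta> g n)) A
      = (\<integral>\<^sup>+z. indicator A (walk_path \<delta> g n z) \<partial>noise_law n)"
    by (rule emeasure_distr_nn_integral) simp_all
  also have "\<dots> = (\<integral>\<^sup>+y. indicator A y * ennreal (drift_likelihood \<delta> g n y) \<partial>driftless_law \<delta> n)"
    by (subst nn_integral_walk_path[OF assms]) (simp_all add: nn_integral_driftless_law)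
  also have "\<dots> = emeasure (density (driftless_law \<delta> n) (\<lambda>y. ennreal (drift_likelihood \<delta> g n y))) A"
    by (simp add: emeasure_density mult.commute)
  finally show "emeasure (distr (noise_law n) (PiM {1..n} (\<lambda>_. borel)) (walk_path \<delta> g n)) A
     = emeasure (density (driftless_law \<delta> n) (\<lambda>y. ennreal (drift_likelihood \<delta> g n y))) A" .
qed simp

text \<open>For a constant drift the increments telescope, so the likelihood depends on the path
  only through its endpoint.\<close>

lemma drift_likelihood_const:
  "drift_likelihood \<delta> (\<lambda>_ _. x) n y = gker (\<Sum>j=1..n. \<delta> j) x (path_at y n)"
proof -
  have "(\<Sum>k=1..n. x \<bullet> (path_at y k - path_at y (k - 1)) - \<delta> k / 2 * (norm x)\<^sup>2)
      = x \<bullet> path_at y n - (\<Sum>j=1..n. \<delta> j) / 2 * (norm x)\<^sup>2"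
    by (induction n) (simp_all add: path_at_def inner_diff algebra_simps add_divide_distrib)
  then show ?thesis by (simp add: drift_likelihood_def gker_def)
qed

lemma nn_integral_driftless_walk:
  fixes \<psi> :: "'a::euclidean_space \<Rightarrow> ennreal"
  assumes \<delta>: "\<And>k. k \<ge> 1 \<Longrightarrow> \<delta> k > 0" and \<psi>: "\<psi> \<in> borel_measurable borel"
  shows "(\<integral>\<^sup>+z. \<psi> (walk \<delta> (\<lambda>_ _. 0) n z) \<partial>noise_law n) = (\<integral>\<^sup>+y. \<psi> y \<partial>gauss_var (\<Sum>j=1..n. \<delta> j))"
  using \<psi>
proof (induction n arbitrary: \<psi>)
  case 0
  then show ?case
    by (simp add: nn_integral_gauss_var prob_space.emeasure_space_1[OF prob_space_std_gauss, simplified]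
        PiM_empty)
next
  case (Suc n)
  note [measurable] = Suc.prems
  interpret P: prob_space "gauss_var (\<delta> (Suc n)) :: 'a measure" by (rule prob_space_gauss_var)
  have [measurable]: "(\<lambda>z. walk \<delta> (\<lambda>_ _. 0) (Suc n) z) \<in> borel_measurable (PiM {1..Suc n} (\<lambda>_. borel :: 'a measure))"
    by (rule Zproc_measurable) (auto intro!: measurable_noise_component)
  have *: "walk \<delta> (\<lambda>_ _. 0) (Suc n) (z(Suc n := w)) = walk \<delta> (\<lambda>_ _. 0) n z + sqrt (\<delta> (Suc n)) *\<^sub>R w" for z and w :: 'a
  proof -
    have "walk \<delta> (\<lambda>_ _. 0) n (z(Suc n := w)) = walk \<delta> (\<lambda>_ _. 0) n z" by (rule Zproc_cong) auto
    then show ?thesis by simp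
  qed
  have "(\<integral>\<^sup>+z. \<psi> (walk \<delta> (\<lambda>_ _. 0) (Suc n) z) \<partial>noise_law (Suc n))
     = (\<integral>\<^sup>+z. \<integral>\<^sup>+w. \<psi> (walk \<delta> (\<lambda>_ _. 0) n z + sqrt (\<delta> (Suc n)) *\<^sub>R w) \<partial>std_gauss \<partial>noise_law n)"
    by (subst noise_law_Suc_nn_integral) (measurable, simp only: *)
  also have "\<dots> = (\<integral>\<^sup>+z. (\<integral>\<^sup>+w. \<psi> (walk \<delta> (\<lambda>_ _. 0) n z + w) \<partial>gauss_var (\<delta> (Suc n))) \<partial>noise_law n)"
    by (simp add: nn_integral_gauss_var)
  also have "\<dots> = (\<integral>\<^sup>+y. \<integral>\<^sup>+w. \<psi> (y + w) \<partial>gauss_var (\<delta> (Suc n)) \<partial>gauss_var (\<Sum>j=1..n. \<delta> j))"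
    by (rule Suc.IH) measurable
  also have "\<dots> = (\<integral>\<^sup>+y. \<psi> y \<partial>gauss_var ((\<Sum>j=1..n. \<delta> j) + \<delta> (Suc n)))"
    using \<delta> by (intro nn_integral_gauss_var_add sum_nonneg) (auto intro: less_imp_le)
  finally show ?case by simp
qed

section \<open>The comparison process\<close>

text \<open>With a common reference \<open>R\<close> and positive densities, the Radon-Nikodym
  derivative is \<open>p / q\<close>; the base \<open>exp 1\<close> makes the logarithm natural.
  \<open>KL_divergence\<close> takes the reference law as its first measure argument.\<close>

lemma KL_divergence_density:
  fixes p q :: "'b \<Rightarrow> real"
  assumes [measurable]: "p \<in> borel_measurable R" "q \<in> borel_measurable R"
    and pos: "\<And>y. p y > 0" "\<And>y. q y > 0"
    and Q: "sigma_finite_measure (density R q)"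
    and int: "integrable (density R p) (\<lambda>y. ln (p y / q y))"
  shows "absolutely_continuous (density R q) (density R p)"
    and "integrable (density R p) (entropy_density (exp 1) (density R q) (density R p))"
    and "KL_divergence (exp 1) (density R q) (density R p) = (\<integral>y. ln (p y / q y) \<partial>density R p)"
proof -
  let ?P = "density R p" and ?Q = "density R q"
  interpret Q: sigma_finite_measure ?Q by fact
  have P: "density ?Q (\<lambda>y. ennreal (p y / q y)) = ?P"
    using pos by (subst density_density_eq)
       (simp_all add: less_imp_le less_imp_neq[symmetric] flip: ennreal_mult)
  show ac: "absolutely_continuous ?Q ?P"
    unfolding P[symmetric] by (rule absolutely_continuousI_density) simp
  have "AE y in ?Q. ennreal (p y / q y) = RN_deriv ?Q ?P y"
    by (rule Q.RN_deriv_unique[OF _ P]) simp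
  \<comment> \<open>Radon-Nikodym derivatives are unique only almost everywhere for the reference
    law; absolute continuity carries this over to the law that is integrated against.\<close>
  then have "AE y in ?P. ennreal (p y / q y) = RN_deriv ?Q ?P y"
    by (rule absolutely_continuous_AE[OF _ ac, rotated]) simp
  then have eq: "AE y in ?P. entropy_density (exp 1) ?Q ?P y = ln (p y / q y)"
  proof eventually_elim
    case (elim y)
    then show ?case using pos[of y] by (simp add: entropy_density_def log_ln less_imp_le flip: elim)
  qed
  have [measurable]: "entropy_density (exp 1) ?Q ?P \<in> borel_measurable ?P"
    using measurable_entropy_density[of "exp 1" ?Q ?P] by (simp cong: measurable_cong_sets)
  show "integrable ?P (entropy_density (exp 1) ?Q ?P)"
    by (rule integrable_cong_AE[THEN iffD2, OF _ _ eq int]) simp_all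
  show "KL_divergence (exp 1) ?Q ?P = (\<integral>y. ln (p y / q y) \<partial>?P)"
    unfolding KL_divergence_def by (rule integral_cong_AE[OF _ _ eq]) simp_all
qed

lemma (in prob_space) distr_std_gauss:
  assumes "distributed M lborel Z (\<lambda>x. ennreal (std_gauss_density x))"
  shows "distr M borel Z = std_gauss" and "random_variable borel Z"
proof -
  have "distr M borel Z = distr M lborel Z" by (rule distr_cong) simp_all
  then show "distr M borel Z = std_gauss"
    using assms by (simp add: distributed_def std_gauss_def)
  show "random_variable borel Z" using distributed_measurable[OF assms] by simp
qed

lemma (in prob_space) distr_noise:
  fixes N :: "nat \<Rightarrow> 'a \<Rightarrow> 'e::euclidean_space"
  assumes gauss: "\<And>k. k \<in> {1..n} \<Longrightarrow> distributed M lborel (N k) (\<lambda>x. ennreal (std_gauss_density x))"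
    and indep: "indep_vars (\<lambda>_. borel) N {1..n}"
  shows "distr M (PiM {1..n} (\<lambda>_. borel)) (\<lambda>\<omega>. \<lambda>k\<in>{1..n}. N k \<omega>) = noise_law n"
\<comment> \<open>The product characterisation of independence asks for a nonempty index set. The
  empty one occurs later, because conditioning on \<open>Y 0\<close> uses no noise variable.\<close>
proof (cases "n = 0")
  case True
  interpret G: prob_space "noise_law n :: (nat \<Rightarrow> 'e) measure" by (rule prob_space_noise_law)
  show ?thesis
  proof (rule measure_eqI)
    fix A assume "A \<in> sets (distr M (PiM {1..n} (\<lambda>_. borel)) (\<lambda>\<omega>. \<lambda>k\<in>{1..n}. N k \<omega>))"
    then have "A \<in> {{}, {\<lambda>_. undefined}}" using True by (simp add: sets_PiM_empty)
    then show "emeasure (distr M (PiM {1..n} (\<lambda>_. borel)) (\<lambda>\<omega>. \<lambda>k\<in>{1..n}. N k \<omega>)) A = emeasure (noise_law n) A"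
      using True G.emeasure_space_1
      by (auto simp: emeasure_distr_nn_integral sets_PiM_empty restrict_def emeasure_space_1 space_PiM_empty)
  qed simp
next
  case False
  have "distr M (PiM {1..n} (\<lambda>_. borel)) (\<lambda>\<omega>. \<lambda>k\<in>{1..n}. N k \<omega>) = (\<Pi>\<^sub>M k\<in>{1..n}. distr M borel (N k))"
    using indep False distr_std_gauss[OF gauss] by (subst indep_vars_iff_distr_eq_PiM'[symmetric]) auto
  also have "\<dots> = noise_law n"
    using distr_std_gauss[OF gauss] by (intro PiM_cong) auto
  finally show ?thesis .
qed

lemma path_law_Zproc:
  fixes N :: "nat \<Rightarrow> 'c \<Rightarrow> 'a::euclidean_space"
  assumes M: "prob_space M"
    and \<delta>: "\<And>k. k \<ge> 1 \<Longrightarrow> \<delta> k > 0"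
    and f: "\<And>k. k \<in> {1..n} \<Longrightarrow> f k \<in> borel_measurable borel"
    and gauss: "\<And>k. k \<in> {1..n} \<Longrightarrow> distributed M lborel (N k) (\<lambda>x. ennreal (std_gauss_density x))"
    and indep: "prob_space.indep_vars M (\<lambda>_. borel) N {1..n}"
  shows "path_law M (Zproc \<delta> f N) n = density (driftless_law \<delta> n) (\<lambda>y. ennreal (drift_likelihood \<delta> f n y))"
proof -
  interpret prob_space M by fact
  have [measurable]: "(\<lambda>\<omega>. \<lambda>k\<in>{1..n}. N k \<omega>) \<in> measurable M (PiM {1..n} (\<lambda>_. borel))"
    using distr_std_gauss(2)[OF gauss] by (intro measurable_restrict) auto
  have eq: "(\<lambda>k\<in>{1..n}. Zproc \<delta> f N k \<omega>) = walk_path \<delta> f n (\<lambda>k\<in>{1..n}. N k \<omega>)" for \<omega>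
    unfolding walk_path_def by (intro restrict_ext Zproc_cong) auto
  have "path_law M (Zproc \<delta> f N) n = distr (distr M (PiM {1..n} (\<lambda>_. borel)) (\<lambda>\<omega>. \<lambda>k\<in>{1..n}. N k \<omega>)) (PiM {1..n} (\<lambda>_. borel)) (walk_path \<delta> f n)"
    unfolding path_law_def eq using walk_path_measurable[of n f \<delta>, OF f] by (subst distr_distr) (auto simp: comp_def)
  also have "\<dots> = distr (noise_law n) (PiM {1..n} (\<lambda>_. borel)) (walk_path \<delta> f n)"
    using distr_noise[OF gauss indep] by simp
  also have "\<dots> = density (driftless_law \<delta> n) (\<lambda>y. ennreal (drift_likelihood \<delta> f n y))"
    using \<delta> f by (rule distr_walk_path)
  finally show ?thesis .
qed

text \<open>One family indexed by options, with \<open>None\<close> for \<open>X\<close>, states at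
  once that the noise variables are independent of each other and of \<open>X\<close>.\<close>

locale comparison_process = prob_space M for M :: "'b measure" +
  fixes X :: "'b \<Rightarrow> 'a::euclidean_space" and N :: "nat \<Rightarrow> 'b \<Rightarrow> 'a" and \<delta> :: "nat \<Rightarrow> real"
  assumes X_rv [measurable]: "X \<in> borel_measurable M"
    and X_L2: "integrable M (\<lambda>\<omega>. (norm (X \<omega>))\<^sup>2)"
    and \<delta>_pos: "\<And>k. k \<ge> 1 \<Longrightarrow> \<delta> k > 0"
    and N_gauss: "\<And>k. k \<ge> 1 \<Longrightarrow> distributed M lborel (N k) (\<lambda>x. ennreal (std_gauss_density x))"
    and indep: "indep_vars (\<lambda>_. borel) (\<lambda>i. case i of None \<Rightarrow> X | Some k \<Rightarrow> N k) (insert None (Some ` {1..}))"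
begin

abbreviation "\<mu> \<equiv> distr M borel X"
abbreviation "T k \<equiv> (\<Sum>j=1..k. \<delta> j)"
abbreviation "Y \<equiv> Yproc \<delta> X N"
abbreviation "post k \<omega> \<equiv> post_mean \<mu> (T k) (Y k \<omega>)"

sublocale mu: moment_measure \<mu>
proof (intro moment_measure.intro moment_measure_axioms.intro)
  interpret P: prob_space \<mu> by (rule prob_space_distr) simp
  show "finite_measure \<mu>" by (rule P.finite_measure_axioms)
  show "0 < measure \<mu> UNIV" "measure \<mu> UNIV \<le> 1" using P.prob_space by simp_all
  show "integrable \<mu> (\<lambda>x. (norm x)\<^sup>2)" using X_L2 by (subst integrable_distr_eq) simp_all
qed simp

lemma T_nonneg: "T k \<ge> 0"
  using \<delta>_pos by (intro sum_nonneg) (auto intro: less_imp_le)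

lemma T_pos: "k \<ge> 1 \<Longrightarrow> T k > 0"
  using \<delta>_pos by (intro sum_pos) auto

lemma N_rv [measurable]: "k \<ge> 1 \<Longrightarrow> N k \<in> borel_measurable M"
  using distr_std_gauss(2)[OF N_gauss] .

lemma Y_rv [measurable]: "Y k \<in> borel_measurable M"
  using Yproc_measurable[of X M k N \<delta>] by simp

lemma noise_rv [measurable]: "(\<lambda>\<omega>. \<lambda>k\<in>{1..n}. N k \<omega>) \<in> measurable M (PiM {1..n} (\<lambda>_. borel))"
  by (intro measurable_restrict) auto

lemma N_indep: "indep_vars (\<lambda>_. borel) N {1..n}"
proof -
  let ?V = "\<lambda>i. case i of None \<Rightarrow> X | Some k \<Rightarrow> N k"
  have "indep_vars (\<lambda>j. PiM {Some j} (\<lambda>_. borel)) (\<lambda>j \<omega>. restrict (\<lambda>i. ?V i \<omega>) {Some j}) {1..n}"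
    by (rule indep_vars_restrict[OF indep]) (auto simp: disjoint_family_on_def)
  then have "indep_vars (\<lambda>_. borel) (\<lambda>j \<omega>. (\<lambda>\<phi>. \<phi> (Some j)) (restrict (\<lambda>i. ?V i \<omega>) {Some j})) {1..n}"
    by (rule indep_vars_compose2) (rule measurable_component_singleton, simp)
  then show ?thesis by simp
qed

text \<open>The index set is split into the blocks \<open>{None}\<close> and \<open>Some\<close> of
  \<open>{1..n}\<close>; blocks of an independent family are independent, and each is then renamed
  to its natural form.\<close>

lemma distr_X_noise:
  "distr M (borel \<Otimes>\<^sub>M PiM {1..n} (\<lambda>_. borel)) (\<lambda>\<omega>. (X \<omega>, \<lambda>k\<in>{1..n}. N k \<omega>)) = \<mu> \<Otimes>\<^sub>M noise_law n"
proof -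
  let ?V = "\<lambda>i. case i of None \<Rightarrow> X | Some k \<Rightarrow> N k"
  let ?A = "{None} :: nat option set" and ?B = "Some ` {1..n}"
  have 1: "indep_var (PiM ?A (\<lambda>_. borel)) (\<lambda>\<omega>. restrict (\<lambda>i. ?V i \<omega>) ?A) (PiM ?B (\<lambda>_. borel)) (\<lambda>\<omega>. restrict (\<lambda>i. ?V i \<omega>) ?B)"
    by (rule indep_var_restrict[OF indep]) auto
  have 2: "(\<lambda>\<phi>. \<phi> None) \<in> measurable (PiM ?A (\<lambda>_. borel)) (borel :: 'a measure)"
    by (rule measurable_component_singleton) simp
  have 3: "(\<lambda>\<phi>. \<lambda>k\<in>{1..n}. \<phi> (Some k)) \<in> measurable (PiM ?B (\<lambda>_. borel)) (PiM {1..n} (\<lambda>_. borel :: 'a measure))"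
    by (intro measurable_restrict measurable_component_singleton) simp
  let ?LA = "distr M (PiM ?A (\<lambda>_. borel)) (\<lambda>\<omega>. restrict (\<lambda>i. ?V i \<omega>) ?A)"
  let ?LB = "distr M (PiM ?B (\<lambda>_. borel)) (\<lambda>\<omega>. restrict (\<lambda>i. ?V i \<omega>) ?B)"
  note rv = 1[unfolded indep_var_distribution_eq]
  have A: "distr ?LA borel (\<lambda>\<phi>. \<phi> None) = \<mu>"
    using rv 2 by (subst distr_distr) (simp_all add: comp_def)
  have B: "distr ?LB (PiM {1..n} (\<lambda>_. borel)) (\<lambda>\<phi>. \<lambda>k\<in>{1..n}. \<phi> (Some k)) = distr M (PiM {1..n} (\<lambda>_. borel)) (\<lambda>\<omega>. \<lambda>k\<in>{1..n}. N k \<omega>)"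
    using rv 3 by (subst distr_distr) (auto simp: comp_def restrict_def intro!: distr_cong)
  interpret NL: prob_space "distr M (PiM {1..n} (\<lambda>_. borel)) (\<lambda>\<omega>. \<lambda>k\<in>{1..n}. N k \<omega>)"
    by (rule prob_space_distr) simp
  have "\<mu> \<Otimes>\<^sub>M distr M (PiM {1..n} (\<lambda>_. borel)) (\<lambda>\<omega>. \<lambda>k\<in>{1..n}. N k \<omega>)
      = distr (?LA \<Otimes>\<^sub>M ?LB) (borel \<Otimes>\<^sub>M PiM {1..n} (\<lambda>_. borel)) (\<lambda>(x, y). (x None, \<lambda>k\<in>{1..n}. y (Some k)))"
    unfolding A[symmetric] B[symmetric]
    by (rule pair_measure_distr) (use 2 3 NL.sigma_finite_measure_axioms B in simp_all)
  also have "\<dots> = distr M (borel \<Otimes>\<^sub>M PiM {1..n} (\<lambda>_. borel)) (\<lambda>\<omega>. (X \<omega>, \<lambda>k\<in>{1..n}. N k \<omega>))"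
  proof -
    have m: "(\<lambda>(x, y). (x None, \<lambda>k\<in>{1..n}. y (Some k))) \<in> measurable (PiM ?A (\<lambda>_. borel) \<Otimes>\<^sub>M PiM ?B (\<lambda>_. borel)) (borel \<Otimes>\<^sub>M PiM {1..n} (\<lambda>_. borel :: 'a measure))"
      using measurable_compose[OF measurable_fst 2] measurable_compose[OF measurable_snd 3]
      unfolding case_prod_beta' by (intro measurable_Pair) simp_all
    have rv2: "(\<lambda>\<omega>. (restrict (\<lambda>i. ?V i \<omega>) ?A, restrict (\<lambda>i. ?V i \<omega>) ?B)) \<in> measurable M (PiM ?A (\<lambda>_. borel) \<Otimes>\<^sub>M PiM ?B (\<lambda>_. borel))"
      using rv by (intro measurable_Pair) simp_all
    show ?thesis
      using rv by (simp only: distr_distr[OF m rv2]) (auto simp: comp_def restrict_def intro!: distr_cong)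
  qed
  finally have "distr M (borel \<Otimes>\<^sub>M PiM {1..n} (\<lambda>_. borel)) (\<lambda>\<omega>. (X \<omega>, \<lambda>k\<in>{1..n}. N k \<omega>))
     = \<mu> \<Otimes>\<^sub>M distr M (PiM {1..n} (\<lambda>_. borel)) (\<lambda>\<omega>. \<lambda>k\<in>{1..n}. N k \<omega>)" ..
  also have "\<dots> = \<mu> \<Otimes>\<^sub>M noise_law n"
    using N_gauss by (subst distr_noise[OF _ N_indep]) auto
  finally show ?thesis .
qed

lemma nn_integral_X_noise:
  assumes "F \<in> borel_measurable (borel \<Otimes>\<^sub>M PiM {1..n} (\<lambda>_. borel))"
  shows "(\<integral>\<^sup>+\<omega>. F (X \<omega>, \<lambda>k\<in>{1..n}. N k \<omega>) \<partial>M) = (\<integral>\<^sup>+x. \<integral>\<^sup>+z. F (x, z) \<partial>noise_law n \<partial>\<mu>)"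
proof -
  interpret G: prob_space "noise_law n :: (nat \<Rightarrow> 'a) measure" by (rule prob_space_noise_law)
  note [measurable] = assms
  have "(\<integral>\<^sup>+\<omega>. F (X \<omega>, \<lambda>k\<in>{1..n}. N k \<omega>) \<partial>M) = (\<integral>\<^sup>+p. F p \<partial>(\<mu> \<Otimes>\<^sub>M noise_law n))"
    unfolding distr_X_noise[symmetric] by (subst nn_integral_distr) simp_all
  also have "\<dots> = (\<integral>\<^sup>+x. \<integral>\<^sup>+z. F (x, z) \<partial>noise_law n \<partial>\<mu>)"
    by (rule G.nn_integral_fst[symmetric]) simp
  finally show ?thesis .
qed

text \<open>Conditioning \<open>X\<close> on a single position needs only this joint law: the noise
  part of \<open>Y k\<close> is a Gaussian of variance \<open>T k\<close> independent of
  \<open>X\<close>.\<close>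

lemma distr_X_Y:
  "distr M (borel \<Otimes>\<^sub>M borel) (\<lambda>\<omega>. (X \<omega>, Y k \<omega>))
    = distr (\<mu> \<Otimes>\<^sub>M gauss_var (T k)) (borel \<Otimes>\<^sub>M borel) (\<lambda>(x, w). (x, w + T k *\<^sub>R x))"
proof (rule measure_eqI)
  interpret W: prob_space "gauss_var (T k) :: 'a measure" by (rule prob_space_gauss_var)
  fix A assume "A \<in> sets (distr M (borel \<Otimes>\<^sub>M borel) (\<lambda>\<omega>. (X \<omega>, Y k \<omega>)))"
  then have [measurable]: "A \<in> sets (borel \<Otimes>\<^sub>M borel)" by simp
  have [measurable]: "(\<lambda>z. walk \<delta> (\<lambda>_ _. 0) k z) \<in> borel_measurable (PiM {1..k} (\<lambda>_. borel :: 'a measure))"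
    by (rule Zproc_measurable) (auto intro!: measurable_noise_component)
  have Y_eq: "Y k \<omega> = walk \<delta> (\<lambda>_ _. 0) k (\<lambda>j\<in>{1..k}. N j \<omega>) + T k *\<^sub>R X \<omega>" for \<omega>
    unfolding Yproc_eq_sum by (subst add.commute, rule arg_cong2[where f="(+)"], rule Zproc_cong) auto
  have "emeasure (distr M (borel \<Otimes>\<^sub>M borel) (\<lambda>\<omega>. (X \<omega>, Y k \<omega>))) A = (\<integral>\<^sup>+\<omega>. indicator A (X \<omega>, Y k \<omega>) \<partial>M)"
    by (rule emeasure_distr_nn_integral) simp_all
  also have "\<dots> = (\<integral>\<^sup>+\<omega>. (\<lambda>p. indicator A (fst p, walk \<delta> (\<lambda>_ _. 0) k (snd p) + T k *\<^sub>R fst p)) (X \<omega>, \<lambda>j\<in>{1..k}. N j \<omega>) \<partial>M)"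
    unfolding Y_eq by simp
  also have "\<dots> = (\<integral>\<^sup>+x. \<integral>\<^sup>+z. indicator A (x, walk \<delta> (\<lambda>_ _. 0) k z + T k *\<^sub>R x) \<partial>noise_law k \<partial>\<mu>)"
    by (subst nn_integral_X_noise) simp_all
  also have "\<dots> = (\<integral>\<^sup>+x. \<integral>\<^sup>+w. indicator A (x, w + T k *\<^sub>R x) \<partial>gauss_var (T k) \<partial>\<mu>)"
    by (intro nn_integral_cong nn_integral_driftless_walk \<delta>_pos) simp_all
  also have "\<dots> = (\<integral>\<^sup>+p. indicator A ((\<lambda>(x, w). (x, w + T k *\<^sub>R x)) p) \<partial>(\<mu> \<Otimes>\<^sub>M gauss_var (T k)))"
    by (subst W.nn_integral_fst[symmetric]) simp_all
  also have "\<dots> = emeasure (distr (\<mu> \<Otimes>\<^sub>M gauss_var (T k)) (borel \<Otimes>\<^sub>M borel) (\<lambda>(x, w). (x, w + T k *\<^sub>R x))) A"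
    by (rule emeasure_distr_nn_integral[symmetric]) simp_all
  finally show "emeasure (distr M (borel \<Otimes>\<^sub>M borel) (\<lambda>\<omega>. (X \<omega>, Y k \<omega>))) A
    = emeasure (distr (\<mu> \<Otimes>\<^sub>M gauss_var (T k)) (borel \<Otimes>\<^sub>M borel) (\<lambda>(x, w). (x, w + T k *\<^sub>R x))) A" .
qed simp

section \<open>Law of a single position and conditional expectation given it\<close>

lemma nn_integral_gker_mu:
  "admissible t y \<Longrightarrow> (\<integral>\<^sup>+x. ennreal (gker t x y) \<partial>\<mu>) = ennreal (tilt_mass \<mu> t y)"
  unfolding tilt_mass_def by (rule nn_integral_eq_integral) (simp_all add: mu.integrable_gker)

lemma distr_Y: "distr M borel (Y k) = density (gauss_var (T k)) (\<lambda>y. ennreal (tilt_mass \<mu> (T k) y))"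
proof (rule measure_eqI)
  interpret W: prob_space "gauss_var (T k) :: 'a measure" by (rule prob_space_gauss_var)
  interpret P: pair_sigma_finite \<mu> "gauss_var (T k) :: 'a measure" ..
  fix A assume "A \<in> sets (distr M borel (Y k))"
  then have [measurable]: "A \<in> sets borel" by simp
  have "emeasure (distr M borel (Y k)) A = (\<integral>\<^sup>+p. indicator A (snd p) \<partial>distr M (borel \<Otimes>\<^sub>M borel) (\<lambda>\<omega>. (X \<omega>, Y k \<omega>)))"
    by (simp add: emeasure_distr_nn_integral nn_integral_distr)
  also have "\<dots> = (\<integral>\<^sup>+x. \<integral>\<^sup>+w. indicator A (w + T k *\<^sub>R x) \<partial>gauss_var (T k) \<partial>\<mu>)"
    unfolding distr_X_Y by (subst nn_integral_distr) (simp_all add: W.nn_integral_fst[symmetric])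
  also have "\<dots> = (\<integral>\<^sup>+x. \<integral>\<^sup>+w. ennreal (gker (T k) x w) * indicator A w \<partial>gauss_var (T k) \<partial>\<mu>)"
    using T_nonneg by (simp add: nn_integral_gker_mult)
  also have "\<dots> = (\<integral>\<^sup>+w. \<integral>\<^sup>+x. ennreal (gker (T k) x w) * indicator A w \<partial>\<mu> \<partial>gauss_var (T k))"
    by (rule P.Fubini'[symmetric]) simp
  also have "\<dots> = (\<integral>\<^sup>+w. ennreal (tilt_mass \<mu> (T k) w) * indicator A w \<partial>gauss_var (T k))"
  proof (rule nn_integral_cong_AE)
    show "AE w in gauss_var (T k). (\<integral>\<^sup>+x. ennreal (gker (T k) x w) * indicator A w \<partial>\<mu>) = ennreal (tilt_mass \<mu> (T k) w) * indicator A w"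
      using AE_admissible[OF T_nonneg] by eventually_elim (simp add: nn_integral_multc nn_integral_gker_mu)
  qed
  also have "\<dots> = emeasure (density (gauss_var (T k)) (\<lambda>y. ennreal (tilt_mass \<mu> (T k) y))) A"
    by (simp add: emeasure_density)
  finally show "emeasure (distr M borel (Y k)) A = emeasure (density (gauss_var (T k)) (\<lambda>y. ennreal (tilt_mass \<mu> (T k) y))) A" .
qed simp

lemma
  fixes \<psi> :: "'a \<Rightarrow> real"
  assumes [measurable]: "\<psi> \<in> borel_measurable borel"
  shows integrable_Y_iff: "integrable M (\<lambda>\<omega>. \<psi> (Y k \<omega>)) \<longleftrightarrow> integrable (gauss_var (T k)) (\<lambda>y. tilt_mass \<mu> (T k) y * \<psi> y)"
    and expectation_Y: "expectation (\<lambda>\<omega>. \<psi> (Y k \<omega>)) = (\<integral>y. tilt_mass \<mu> (T k) y * \<psi> y \<partial>gauss_var (T k))"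
proof -
  have "integrable M (\<lambda>\<omega>. \<psi> (Y k \<omega>)) \<longleftrightarrow> integrable (distr M borel (Y k)) \<psi>"
    by (subst integrable_distr_eq) simp_all
  also have "\<dots> \<longleftrightarrow> integrable (gauss_var (T k)) (\<lambda>y. tilt_mass \<mu> (T k) y * \<psi> y)"
    unfolding distr_Y by (subst integrable_density) (simp_all add: mu.tilt_mass_nonneg)
  finally show "integrable M (\<lambda>\<omega>. \<psi> (Y k \<omega>)) \<longleftrightarrow> integrable (gauss_var (T k)) (\<lambda>y. tilt_mass \<mu> (T k) y * \<psi> y)" .
  have "expectation (\<lambda>\<omega>. \<psi> (Y k \<omega>)) = integral\<^sup>L (distr M borel (Y k)) \<psi>"
    by (subst integral_distr) simp_all
  also have "\<dots> = (\<integral>y. tilt_mass \<mu> (T k) y * \<psi> y \<partial>gauss_var (T k))"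
    unfolding distr_Y by (subst integral_density) (simp_all add: mu.tilt_mass_nonneg)
  finally show "expectation (\<lambda>\<omega>. \<psi> (Y k \<omega>)) = (\<integral>y. tilt_mass \<mu> (T k) y * \<psi> y \<partial>gauss_var (T k))" .
qed

text \<open>The defining property of a conditional expectation, tested against functions of
  \<open>Y k\<close>. It is \<open>integral_tilt\<close> started at time 0, where the kernel is 1,
  read through the joint law of \<open>X\<close> and \<open>Y k\<close>.\<close>

lemma
  fixes \<psi> :: "'a \<Rightarrow> real"
  assumes [measurable]: "\<psi> \<in> borel_measurable borel"
    and int: "integrable M (\<lambda>\<omega>. (X \<omega> \<bullet> b) * \<psi> (Y k \<omega>))"
  shows integrable_post_mult: "integrable M (\<lambda>\<omega>. (post k \<omega> \<bullet> b) * \<psi> (Y k \<omega>))"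
    and expectation_post_mult: "expectation (\<lambda>\<omega>. (post k \<omega> \<bullet> b) * \<psi> (Y k \<omega>)) = expectation (\<lambda>\<omega>. (X \<omega> \<bullet> b) * \<psi> (Y k \<omega>))"
proof -
  interpret W: prob_space "gauss_var (T k) :: 'a measure" by (rule prob_space_gauss_var)
  interpret P: pair_sigma_finite \<mu> "gauss_var (T k) :: 'a measure" ..
  let ?J = "distr M (borel \<Otimes>\<^sub>M borel) (\<lambda>\<omega>. (X \<omega>, Y k \<omega>))"
  let ?F = "\<lambda>p. (fst p \<bullet> b) * \<psi> (snd p)"
  have "integrable ?J ?F" using int by (subst integrable_distr_eq) simp_all
  then have 1: "integrable (\<mu> \<Otimes>\<^sub>M gauss_var (T k)) (\<lambda>(x, w). gker 0 x 0 * (x \<bullet> b) * \<psi> (w + T k *\<^sub>R x))"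
    unfolding distr_X_Y by (subst (asm) integrable_distr_eq) (simp_all add: case_prod_beta')
  have ae: "AE w in gauss_var (T k). (\<integral>x. gker (0 + T k) x (0 + w) * (x \<bullet> b) \<partial>\<mu>) * \<psi> w
      = tilt_mass \<mu> (T k) w * ((post_mean \<mu> (T k) w \<bullet> b) * \<psi> w)"
    using AE_admissible[OF T_nonneg]
  proof eventually_elim
    case (elim w)
    show ?case using mu.tilt_moment_inner[OF elim, of b] mu.tilt_moment_eq[OF elim] by simp
  qed
  have "integrable (gauss_var (T k)) (\<lambda>w. (\<integral>x. gker (0 + T k) x (0 + w) * (x \<bullet> b) \<partial>\<mu>) * \<psi> w)"
    by (rule mu.integrable_tilt[OF _ _ T_nonneg 1]) simp_all
  then have "integrable (gauss_var (T k)) (\<lambda>w. tilt_mass \<mu> (T k) w * ((post_mean \<mu> (T k) w \<bullet> b) * \<psi> w))"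
    by (rule integrable_cong_AE[THEN iffD1, OF _ _ ae, rotated 2]) simp_all
  then show "integrable M (\<lambda>\<omega>. (post k \<omega> \<bullet> b) * \<psi> (Y k \<omega>))"
    using integrable_Y_iff[of "\<lambda>w. (post_mean \<mu> (T k) w \<bullet> b) * \<psi> w" k] by simp
  have "expectation (\<lambda>\<omega>. (post k \<omega> \<bullet> b) * \<psi> (Y k \<omega>)) = (\<integral>w. (\<integral>x. gker (0 + T k) x (0 + w) * (x \<bullet> b) \<partial>\<mu>) * \<psi> w \<partial>gauss_var (T k))"
    using expectation_Y[of "\<lambda>w. (post_mean \<mu> (T k) w \<bullet> b) * \<psi> w" k] integral_cong_AE[OF _ _ ae] by simp
  also have "\<dots> = (\<integral>x. gker 0 x 0 * (x \<bullet> b) * (\<integral>w. \<psi> (w + T k *\<^sub>R x) \<partial>gauss_var (T k)) \<partial>\<mu>)"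
    by (rule mu.integral_tilt[OF _ _ T_nonneg 1]) simp_all
  also have "\<dots> = (\<integral>(x, w). gker 0 x 0 * (x \<bullet> b) * \<psi> (w + T k *\<^sub>R x) \<partial>(\<mu> \<Otimes>\<^sub>M gauss_var (T k)))"
    using P.integral_fst[OF 1] by simp
  also have "\<dots> = integral\<^sup>L ?J ?F"
    unfolding distr_X_Y by (subst integral_distr) (simp_all add: case_prod_beta')
  also have "\<dots> = expectation (\<lambda>\<omega>. (X \<omega> \<bullet> b) * \<psi> (Y k \<omega>))"
    by (subst integral_distr) simp_all
  finally show "expectation (\<lambda>\<omega>. (post k \<omega> \<bullet> b) * \<psi> (Y k \<omega>)) = expectation (\<lambda>\<omega>. (X \<omega> \<bullet> b) * \<psi> (Y k \<omega>))" .
qed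

lemma integrable_X: "integrable M X"
  using mu.integrable_id by (subst (asm) integrable_distr_eq) simp_all

text \<open>Sets of the generated sigma-algebra are preimages of Borel sets, so the previous lemma
  for indicators characterises each coordinate; the basis is finite, so the coordinates can be
  joined almost surely.\<close>

lemma cond_exp_vec_eq:
  "AE \<omega> in M. cond_exp_vec M (vimage_algebra (space M) (Y k) borel) X \<omega> = post k \<omega>"
proof -
  let ?F = "vimage_algebra (space M) (Y k) borel"
  have Y_F: "Y k \<in> measurable ?F borel" by (rule measurable_vimage_algebra1) simp
  have sub: "subalgebra M ?F"
    unfolding subalgebra_def using sets_image_in_sets[OF refl Y_rv[of k]] by simp
  interpret S: finite_measure_subalgebra M ?F
    by (intro finite_measure_subalgebra.intro finite_measure_subalgebra_axioms.intro sub) unfold_locales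
  have "AE \<omega> in M. real_cond_exp M ?F (\<lambda>\<eta>. X \<eta> \<bullet> b) \<omega> = post k \<omega> \<bullet> b" for b
  proof (rule S.real_cond_exp_charact)
    have Xb: "integrable M (\<lambda>\<omega>. X \<omega> \<bullet> b)" by (rule integrable_inner_left[OF integrable_X])
    then show "integrable M (\<lambda>\<omega>. X \<omega> \<bullet> b)" .
    show "integrable M (\<lambda>\<omega>. post k \<omega> \<bullet> b)"
      using integrable_post_mult[of "\<lambda>_. 1" b k] Xb by simp
    show "(\<lambda>\<omega>. post k \<omega> \<bullet> b) \<in> borel_measurable ?F"
      using Y_F by measurable
    fix A assume "A \<in> sets ?F"
    then obtain B where B [measurable]: "B \<in> sets borel" and A: "A = Y k -` B \<inter> space M"
      by (auto simp: sets_vimage_algebra2)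
    have eq: "(\<integral>\<omega>\<in>A. Z \<omega> \<partial>M) = expectation (\<lambda>\<omega>. Z \<omega> * indicator B (Y k \<omega>))" for Z :: "'b \<Rightarrow> real"
      unfolding set_lebesgue_integral_def
      by (intro Bochner_Integration.integral_cong refl) (auto simp: A indicator_def)
    have "integrable M (\<lambda>\<omega>. indicator (Y k -` B \<inter> space M) \<omega> *\<^sub>R (X \<omega> \<bullet> b))"
      by (rule integrable_mult_indicator[OF _ Xb]) simp
    moreover have "integrable M (\<lambda>\<omega>. indicator (Y k -` B \<inter> space M) \<omega> *\<^sub>R (X \<omega> \<bullet> b))
        \<longleftrightarrow> integrable M (\<lambda>\<omega>. (X \<omega> \<bullet> b) * indicator B (Y k \<omega>))"
      by (intro Bochner_Integration.integrable_cong refl) (simp add: indicator_def)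
    ultimately have "integrable M (\<lambda>\<omega>. (X \<omega> \<bullet> b) * indicator B (Y k \<omega>))" by simp
    from expectation_post_mult[OF _ this]
    show "(\<integral>\<omega>\<in>A. X \<omega> \<bullet> b \<partial>M) = (\<integral>\<omega>\<in>A. post k \<omega> \<bullet> b \<partial>M)" by (simp add: eq)
  qed
  then have "AE \<omega> in M. \<forall>b\<in>Basis. real_cond_exp M ?F (\<lambda>\<eta>. X \<eta> \<bullet> b) \<omega> = post k \<omega> \<bullet> b"
    by (simp add: AE_finite_all)
  then show ?thesis
    by eventually_elim (simp add: cond_exp_vec_def euclidean_representation)
qed

text \<open>For each value \<open>x\<close> of \<open>X\<close> the path is a walk with constant
  drift. Girsanov and Fubini then leave the average of its likelihood over \<open>x\<close>, which
  is \<open>tilt_mass\<close> at the endpoint.\<close>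

lemma path_law_Yproc:
  assumes n: "n \<ge> 1"
  shows "path_law M Y n = density (driftless_law \<delta> n) (\<lambda>y. ennreal (tilt_mass \<mu> (T n) (path_at y n)))"
proof (rule measure_eqI)
  interpret G: prob_space "noise_law n :: (nat \<Rightarrow> 'a) measure" by (rule prob_space_noise_law)
  interpret P: pair_sigma_finite \<mu> "noise_law n :: (nat \<Rightarrow> 'a) measure" ..
  let ?W = "walk_path \<delta> (\<lambda>_ _. 0 :: 'a) n"
  \<comment> \<open>Since \<open>n \<ge> 1\<close>, the total time is positive and every endpoint is
    admissible, so the density is positive everywhere and not just almost everywhere.\<close>
  have adm: "admissible (T n) y" for y :: 'a using T_pos[OF n] by (simp add: admissible_def)
  fix A assume "A \<in> sets (path_law M Y n)"
  then have [measurable]: "A \<in> sets (PiM {1..n} (\<lambda>_. borel))" by (simp add: path_law_def)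
  have [measurable]: "(\<lambda>y. path_at y n) \<in> borel_measurable (PiM {1..n} (\<lambda>_. borel :: 'a measure))" by simp
  have [measurable]: "(\<lambda>\<omega>. \<lambda>k\<in>{1..n}. Y k \<omega>) \<in> measurable M (PiM {1..n} (\<lambda>_. borel))"
    by (intro measurable_restrict) simp
  have wm [measurable]: "(\<lambda>p. walk_path \<delta> (\<lambda>_ _. fst p) n (snd p)) \<in> measurable (borel \<Otimes>\<^sub>M PiM {1..n} (\<lambda>_. borel)) (PiM {1..n} (\<lambda>_. borel :: 'a measure))"
    unfolding walk_path_def
  proof (rule measurable_restrict)
    fix k assume k: "k \<in> {1..n}"
    \<comment> \<open>Here the drift is itself a variable; joint measurability comes from viewing
      the walk as \<open>Yproc\<close> on the product space.\<close>
    have "walk \<delta> (\<lambda>_ _. fst p) k (snd p) = Yproc \<delta> fst (\<lambda>k p. snd p k) k p" for p :: "'a \<times> (nat \<Rightarrow> 'a)"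
      unfolding Yproc_eq_Zproc by (rule Zproc_cong) simp
    moreover have "(\<lambda>p. Yproc \<delta> fst (\<lambda>k p. snd p k) k p) \<in> borel_measurable (borel \<Otimes>\<^sub>M PiM {1..n} (\<lambda>_. borel :: 'a measure))"
      using k by (intro Yproc_measurable) (auto intro!: measurable_compose[OF measurable_snd measurable_noise_component])
    ultimately show "(\<lambda>p. walk \<delta> (\<lambda>_ _. fst p) k (snd p)) \<in> borel_measurable (borel \<Otimes>\<^sub>M PiM {1..n} (\<lambda>_. borel :: 'a measure))"
      by simp
  qed
  have Y_eq: "(\<lambda>k\<in>{1..n}. Y k \<omega>) = walk_path \<delta> (\<lambda>_ _. X \<omega>) n (\<lambda>k\<in>{1..n}. N k \<omega>)" for \<omega>
    unfolding walk_path_def Yproc_eq_Zproc by (intro restrict_ext Zproc_cong) auto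
  have "emeasure (path_law M Y n) A = (\<integral>\<^sup>+\<omega>. indicator A (\<lambda>k\<in>{1..n}. Y k \<omega>) \<partial>M)"
    unfolding path_law_def by (rule emeasure_distr_nn_integral) simp_all
  also have "\<dots> = (\<integral>\<^sup>+\<omega>. (\<lambda>p. indicator A (walk_path \<delta> (\<lambda>_ _. fst p) n (snd p))) (X \<omega>, \<lambda>k\<in>{1..n}. N k \<omega>) \<partial>M)"
    unfolding Y_eq by simp
  also have "\<dots> = (\<integral>\<^sup>+x. \<integral>\<^sup>+z. indicator A (walk_path \<delta> (\<lambda>_ _. x) n z) \<partial>noise_law n \<partial>\<mu>)"
    by (subst nn_integral_X_noise) simp_all
  also have "\<dots> = (\<integral>\<^sup>+x. \<integral>\<^sup>+z. indicator A (?W z) * ennreal (gker (T n) x (path_at (?W z) n)) \<partial>noise_law n \<partial>\<mu>)"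
    by (subst nn_integral_walk_path[OF \<delta>_pos]) (simp_all add: drift_likelihood_const)
  also have "\<dots> = (\<integral>\<^sup>+z. \<integral>\<^sup>+x. indicator A (?W z) * ennreal (gker (T n) x (path_at (?W z) n)) \<partial>\<mu> \<partial>noise_law n)"
    by (rule P.Fubini'[symmetric]) simp
  also have "\<dots> = (\<integral>\<^sup>+z. indicator A (?W z) * ennreal (tilt_mass \<mu> (T n) (path_at (?W z) n)) \<partial>noise_law n)"
    by (simp add: nn_integral_cmult nn_integral_gker_mu[OF adm])
  also have "\<dots> = (\<integral>\<^sup>+y. indicator A y * ennreal (tilt_mass \<mu> (T n) (path_at y n)) \<partial>driftless_law \<delta> n)"
    by (subst nn_integral_driftless_law) simp_all
  also have "\<dots> = emeasure (density (driftless_law \<delta> n) (\<lambda>y. ennreal (tilt_mass \<mu> (T n) (path_at y n)))) A"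
    by (simp add: emeasure_density mult.commute)
  finally show "emeasure (path_law M Y n) A = emeasure (density (driftless_law \<delta> n) (\<lambda>y. ennreal (tilt_mass \<mu> (T n) (path_at y n)))) A" .
qed (simp add: path_law_def)

text \<open>\<open>Y (k - 1)\<close> is built from \<open>X\<close> and the earlier noise, so it is
  independent of the centred \<open>N k\<close>. This removes the noise term from the expected
  log-likelihood.\<close>

lemma
  assumes k: "k \<ge> 1" and f [measurable]: "f \<in> borel_measurable borel"
    and f_L2: "integrable M (\<lambda>\<omega>. (norm (f (Y (k - 1) \<omega>)))\<^sup>2)"
  shows integrable_inner_noise: "integrable M (\<lambda>\<omega>. f (Y (k - 1) \<omega>) \<bullet> N k \<omega>)"
    and expectation_inner_noise: "expectation (\<lambda>\<omega>. f (Y (k - 1) \<omega>) \<bullet> N k \<omega>) = 0"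
proof -
  let ?V = "\<lambda>i. case i of None \<Rightarrow> X | Some k \<Rightarrow> N k"
  let ?A = "insert None (Some ` {1..k - 1})" and ?B = "{Some k}"
  have 1: "indep_var (PiM ?A (\<lambda>_. borel)) (\<lambda>\<omega>. restrict (\<lambda>i. ?V i \<omega>) ?A) (PiM ?B (\<lambda>_. borel)) (\<lambda>\<omega>. restrict (\<lambda>i. ?V i \<omega>) ?B)"
    by (rule indep_var_restrict[OF indep]) (use k in auto)
  \<comment> \<open>\<open>Y (k - 1)\<close> rebuilt from the restricted family, which exhibits it
    as a function of the first independent block.\<close>
  let ?y = "\<lambda>\<phi>. Yproc \<delta> (\<lambda>\<phi>. \<phi> None) (\<lambda>j \<phi>. \<phi> (Some j)) (k - 1) \<phi>"
  have [measurable]: "?y \<in> borel_measurable (PiM ?A (\<lambda>_. borel :: 'a measure))"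
    by (rule Yproc_measurable) (auto intro!: measurable_component_singleton)
  have ib: "indep_var borel (\<lambda>\<omega>. f (Y (k - 1) \<omega>) \<bullet> b) borel (\<lambda>\<omega>. N k \<omega> \<bullet> b)" for b
  proof -
    have 2: "(\<lambda>\<phi>. f (?y \<phi>) \<bullet> b) \<in> borel_measurable (PiM ?A (\<lambda>_. borel))" by simp
    have 3: "(\<lambda>\<phi>. \<phi> (Some k) \<bullet> b) \<in> borel_measurable (PiM ?B (\<lambda>_. borel :: 'a measure))"
      by (intro borel_measurable_inner measurable_component_singleton) simp_all
    have y: "?y (restrict (\<lambda>i. ?V i \<omega>) ?A) = Y (k - 1) \<omega>" for \<omega>
      unfolding Yproc_eq_Zproc by simp (rule Zproc_cong, auto)
    show ?thesis using indep_var_compose[OF 1 2 3] by (simp add: comp_def y)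
  qed
  have fb: "integrable M (\<lambda>\<omega>. f (Y (k - 1) \<omega>) \<bullet> b)" for b
  proof (rule integrable_inner_left, rule Bochner_Integration.integrable_bound)
    show "integrable M (\<lambda>\<omega>. 1 + (norm (f (Y (k - 1) \<omega>)))\<^sup>2)" using f_L2 by simp
    show "AE \<omega> in M. norm (f (Y (k - 1) \<omega>)) \<le> norm (1 + (norm (f (Y (k - 1) \<omega>)))\<^sup>2)" by (simp add: le_one_plus_square)
  qed simp
  have Nk: "distr M borel (N k) = gauss_var 1"
    using distr_std_gauss(1)[OF N_gauss[OF k]] by (simp add: gauss_var_def distr_id2)
  have [measurable]: "N k \<in> borel_measurable M" using k by simp
  have Nb: "integrable M (\<lambda>\<omega>. N k \<omega> \<bullet> b)" "expectation (\<lambda>\<omega>. N k \<omega> \<bullet> b) = 0" for b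
    using integrable_inner_left[OF integrable_gauss_var_id[of 1], of b] integral_gauss_var_inner[where b=b and t=1]
    unfolding Nk[symmetric] by (simp_all add: integrable_distr_eq integral_distr)
  have int: "integrable M (\<lambda>\<omega>. (f (Y (k - 1) \<omega>) \<bullet> b) * (N k \<omega> \<bullet> b))" for b
    by (rule indep_var_integrable[OF ib fb Nb(1)])
  have sum: "f (Y (k - 1) \<omega>) \<bullet> N k \<omega> = (\<Sum>b\<in>Basis. (f (Y (k - 1) \<omega>) \<bullet> b) * (N k \<omega> \<bullet> b))" for \<omega>
    by (rule euclidean_inner)
  show "integrable M (\<lambda>\<omega>. f (Y (k - 1) \<omega>) \<bullet> N k \<omega>)"
    using int by (subst sum) simp
  show "expectation (\<lambda>\<omega>. f (Y (k - 1) \<omega>) \<bullet> N k \<omega>) = 0"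
    using int by (subst sum) (simp add: indep_var_lebesgue_integral[OF ib fb Nb(1)] Nb(2))
qed

end

section \<open>Second-moment identities and the expected log-likelihood\<close>

context comparison_process
begin

lemma
  shows integrable_post_norm2: "integrable M (\<lambda>\<omega>. (norm (post k \<omega>))\<^sup>2)"
    and expectation_post_norm2: "expectation (\<lambda>\<omega>. (norm (post k \<omega>))\<^sup>2) = fisher \<mu> (T k)"
  using integrable_Y_iff[of "\<lambda>y. (norm (post_mean \<mu> (T k) y))\<^sup>2" k] expectation_Y[of "\<lambda>y. (norm (post_mean \<mu> (T k) y))\<^sup>2" k]
    mu.integrable_fisher[OF T_nonneg]
  by (simp_all add: fisher_def)

lemma integrable_inner_L2:
  fixes U V :: "'b \<Rightarrow> 'a"
  assumes [measurable]: "U \<in> borel_measurable M" "V \<in> borel_measurable M"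
    and "integrable M (\<lambda>\<omega>. (norm (U \<omega>))\<^sup>2)" "integrable M (\<lambda>\<omega>. (norm (V \<omega>))\<^sup>2)"
  shows "integrable M (\<lambda>\<omega>. norm (U \<omega>) * norm (V \<omega>))" and "integrable M (\<lambda>\<omega>. U \<omega> \<bullet> V \<omega>)"
proof -
  show *: "integrable M (\<lambda>\<omega>. norm (U \<omega>) * norm (V \<omega>))"
  proof (rule Bochner_Integration.integrable_bound)
    show "integrable M (\<lambda>\<omega>. (norm (U \<omega>))\<^sup>2 + (norm (V \<omega>))\<^sup>2)" using assms by simp
    have "a * b \<le> a\<^sup>2 + b\<^sup>2" if "a \<ge> 0" "b \<ge> 0" for a b :: real
      using sum_squares_bound[of a b] mult_nonneg_nonneg[OF that] by linarith
    then show "AE \<omega> in M. norm (norm (U \<omega>) * norm (V \<omega>)) \<le> norm ((norm (U \<omega>))\<^sup>2 + (norm (V \<omega>))\<^sup>2)" by simp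
  qed simp
  show "integrable M (\<lambda>\<omega>. U \<omega> \<bullet> V \<omega>)"
    by (rule Bochner_Integration.integrable_bound[OF *]) (simp_all add: Cauchy_Schwarz_ineq2)
qed

text \<open>The projection property applied coordinatewise; square integrability of both factors
  makes each product integrable.\<close>

lemma expectation_inner_post:
  assumes [measurable]: "g \<in> borel_measurable borel"
    and L2: "integrable M (\<lambda>\<omega>. (norm (g (Y k \<omega>)))\<^sup>2)"
  shows "expectation (\<lambda>\<omega>. g (Y k \<omega>) \<bullet> post k \<omega>) = expectation (\<lambda>\<omega>. g (Y k \<omega>) \<bullet> X \<omega>)"
proof -
  have int: "integrable M (\<lambda>\<omega>. (X \<omega> \<bullet> b) * (g (Y k \<omega>) \<bullet> b))" if "b \<in> Basis" for b
  proof (rule Bochner_Integration.integrable_bound)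
    show "integrable M (\<lambda>\<omega>. norm (X \<omega>) * norm (g (Y k \<omega>)))"
      by (intro integrable_inner_L2 X_L2 L2) simp_all
    show "AE \<omega> in M. norm ((X \<omega> \<bullet> b) * (g (Y k \<omega>) \<bullet> b)) \<le> norm (norm (X \<omega>) * norm (g (Y k \<omega>)))"
      using that by (intro AE_I2) (simp add: abs_mult mult_mono Basis_le_norm)
  qed simp
  have gm: "(\<lambda>y. g y \<bullet> b) \<in> borel_measurable borel" for b by simp
  note i2 = integrable_post_mult[OF gm int] and e2 = expectation_post_mult[OF gm int]
  have "expectation (\<lambda>\<omega>. g (Y k \<omega>) \<bullet> post k \<omega>) = expectation (\<lambda>\<omega>. \<Sum>b\<in>Basis. (post k \<omega> \<bullet> b) * (g (Y k \<omega>) \<bullet> b))"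
    by (subst euclidean_inner) (simp add: mult.commute)
  also have "\<dots> = (\<Sum>b\<in>Basis. expectation (\<lambda>\<omega>. (post k \<omega> \<bullet> b) * (g (Y k \<omega>) \<bullet> b)))"
    by (rule Bochner_Integration.integral_sum) (rule i2)
  also have "\<dots> = (\<Sum>b\<in>Basis. expectation (\<lambda>\<omega>. (X \<omega> \<bullet> b) * (g (Y k \<omega>) \<bullet> b)))"
    by (intro sum.cong refl e2)
  also have "\<dots> = expectation (\<lambda>\<omega>. \<Sum>b\<in>Basis. (X \<omega> \<bullet> b) * (g (Y k \<omega>) \<bullet> b))"
    by (rule Bochner_Integration.integral_sum[symmetric]) (rule int)
  also have "\<dots> = expectation (\<lambda>\<omega>. g (Y k \<omega>) \<bullet> X \<omega>)"
    by (subst (2) euclidean_inner) (simp add: mult.commute)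
  finally show ?thesis .
qed

text \<open>Expanding the square and projecting the cross term back to \<open>X\<close> produces the
  terms that also occur in the expected log-likelihood, plus one \<open>fisher\<close>
  value.\<close>

lemma expectation_norm2_diff_post:
  assumes [measurable]: "g \<in> borel_measurable borel"
    and L2: "integrable M (\<lambda>\<omega>. (norm (g (Y k \<omega>)))\<^sup>2)"
  shows "expectation (\<lambda>\<omega>. (norm (g (Y k \<omega>) - cond_exp_vec M (vimage_algebra (space M) (Y k) borel) X \<omega>))\<^sup>2)
    = expectation (\<lambda>\<omega>. (norm (g (Y k \<omega>)))\<^sup>2) - 2 * expectation (\<lambda>\<omega>. g (Y k \<omega>) \<bullet> X \<omega>) + fisher \<mu> (T k)"
proof -
  have i: "integrable M (\<lambda>\<omega>. g (Y k \<omega>) \<bullet> post k \<omega>)"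
    by (intro integrable_inner_L2 L2 integrable_post_norm2) simp_all
  have sub: "subalgebra M (vimage_algebra (space M) (Y k) borel)"
    unfolding subalgebra_def using sets_image_in_sets[OF refl Y_rv[of k]] by simp
  have [measurable]: "cond_exp_vec M (vimage_algebra (space M) (Y k) borel) X \<in> borel_measurable M"
    unfolding cond_exp_vec_def[abs_def]
    by (intro borel_measurable_sum borel_measurable_scaleR measurable_from_subalg[OF sub borel_measurable_cond_exp]) simp
  have "expectation (\<lambda>\<omega>. (norm (g (Y k \<omega>) - cond_exp_vec M (vimage_algebra (space M) (Y k) borel) X \<omega>))\<^sup>2)
    = expectation (\<lambda>\<omega>. (norm (g (Y k \<omega>)))\<^sup>2 - 2 * (g (Y k \<omega>) \<bullet> post k \<omega>) + (norm (post k \<omega>))\<^sup>2)"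
  proof (rule integral_cong_AE)
    show "AE \<omega> in M. (norm (g (Y k \<omega>) - cond_exp_vec M (vimage_algebra (space M) (Y k) borel) X \<omega>))\<^sup>2
       = (norm (g (Y k \<omega>)))\<^sup>2 - 2 * (g (Y k \<omega>) \<bullet> post k \<omega>) + (norm (post k \<omega>))\<^sup>2"
      using cond_exp_vec_eq[of k]
      by eventually_elim (simp add: power2_norm_eq_inner inner_diff inner_commute)
  qed simp_all
  also have "\<dots> = expectation (\<lambda>\<omega>. (norm (g (Y k \<omega>)))\<^sup>2) - 2 * expectation (\<lambda>\<omega>. g (Y k \<omega>) \<bullet> X \<omega>) + fisher \<mu> (T k)"
    using i L2 integrable_post_norm2[of k] by (simp add: expectation_inner_post[OF assms] expectation_post_norm2)
  finally show ?thesis .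
qed

text \<open>\<open>Y 0 = 0\<close> carries no information, so the posterior mean at time 0 is E X
  and \<open>fisher \<mu> 0 = |E X|^2\<close>.\<close>

lemma trace_cov_eq: "trace_cov M X = expectation (\<lambda>\<omega>. (norm (X \<omega>))\<^sup>2) - fisher \<mu> 0"
proof -
  have sq: "integrable M (\<lambda>\<omega>. (X \<omega> \<bullet> b)\<^sup>2)" if "b \<in> Basis" for b
  proof (rule Bochner_Integration.integrable_bound[OF X_L2])
    show "AE \<omega> in M. norm ((X \<omega> \<bullet> b)\<^sup>2) \<le> norm ((norm (X \<omega>))\<^sup>2)"
      using Basis_le_norm[OF that] by (intro AE_I2) (simp add: abs_le_square_iff[symmetric])
  qed simp
  have norm_sum: "(norm v)\<^sup>2 = (\<Sum>b\<in>Basis. (v \<bullet> b)\<^sup>2)" for v :: 'a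
    unfolding power2_norm_eq_inner by (subst euclidean_inner) (simp add: power2_eq_square)
  have one: "tilt_mass \<mu> 0 0 = 1"
    using prob_space.prob_space[OF prob_space_distr[OF X_rv]] by (simp add: tilt_mass_def)
  have mean: "post_mean \<mu> 0 0 = expectation X"
    by (simp add: post_mean_def one tilt_moment_def integral_distr)
  have "fisher \<mu> 0 = (norm (expectation X))\<^sup>2"
    unfolding fisher_def by (subst gauss_var_0_integral) (simp_all add: one mean)
  also have "\<dots> = (\<Sum>b\<in>Basis. (expectation (\<lambda>\<omega>. X \<omega> \<bullet> b))\<^sup>2)"
    unfolding norm_sum using integral_inner_left[of _ M X] integrable_X by simp
  finally have f: "fisher \<mu> 0 = (\<Sum>b\<in>Basis. (expectation (\<lambda>\<omega>. X \<omega> \<bullet> b))\<^sup>2)" .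
  have "trace_cov M X = (\<Sum>b\<in>Basis. expectation (\<lambda>\<omega>. (X \<omega> \<bullet> b)\<^sup>2) - (expectation (\<lambda>\<omega>. X \<omega> \<bullet> b))\<^sup>2)"
    unfolding trace_cov_def
    by (intro sum.cong refl variance_eq integrable_inner_left[OF integrable_X] sq)
  also have "\<dots> = expectation (\<lambda>\<omega>. (norm (X \<omega>))\<^sup>2) - fisher \<mu> 0"
    unfolding sum_subtractf f norm_sum by (subst Bochner_Integration.integral_sum) (simp_all add: sq)
  finally show ?thesis .
qed

lemma sum_fisher_increments_le:
  assumes n: "n \<ge> 1"
  shows "(\<Sum>k=1..n. \<delta> k / 2 * (fisher \<mu> (T k) - fisher \<mu> (T (k - 1)))) \<le> Max (\<delta> ` {1..n}) / 2 * trace_cov M X"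
proof -
  let ?J = "\<lambda>k. fisher \<mu> (T k)" and ?m = "Max (\<delta> ` {1..n})"
  have m: "\<delta> k \<le> ?m" if "k \<in> {1..n}" for k using that by (intro Max_ge) simp_all
  have m0: "?m \<ge> 0" by (rule order_trans[OF less_imp_le[OF \<delta>_pos] m[of 1]]) (use n in simp_all)
  have "(\<Sum>k=1..n. \<delta> k / 2 * (?J k - ?J (k - 1))) \<le> (\<Sum>k=1..n. ?m / 2 * (?J k - ?J (k - 1)))"
  proof (intro sum_mono mult_right_mono)
    fix k assume k: "k \<in> {1..n}"
    show "\<delta> k / 2 \<le> ?m / 2" using m[OF k] by simp
    have "T (k - 1) \<le> T k"
      using \<delta>_pos by (intro sum_mono2) (auto intro: less_imp_le)
    then show "0 \<le> ?J k - ?J (k - 1)" using mu.fisher_mono[OF T_nonneg] by simp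
  qed
  also have "\<dots> = ?m / 2 * (\<Sum>k=1..n. ?J k - ?J (k - 1))" by (simp add: sum_distrib_left)
  also have "(\<Sum>k=1..n. ?J k - ?J (k - 1)) = ?J n - ?J 0"
    by (induction n) simp_all
  also have "?m / 2 * (?J n - ?J 0) \<le> ?m / 2 * trace_cov M X"
  proof (rule mult_left_mono)
    have "?J n \<le> expectation (\<lambda>\<omega>. (norm (X \<omega>))\<^sup>2)"
      using mu.fisher_le_second_moment[OF T_nonneg, of n] by (simp add: integral_distr)
    then show "?J n - ?J 0 \<le> trace_cov M X" by (simp add: trace_cov_eq)
  qed (use m0 in simp)
  finally show ?thesis .
qed

lemma
  assumes n: "n \<ge> 1"
    and f: "\<And>k. k \<in> {1..n} \<Longrightarrow> f k \<in> borel_measurable borel"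
    and f_L2: "\<And>k. k \<in> {1..n} \<Longrightarrow> integrable M (\<lambda>\<omega>. (norm (f k (Y (k - 1) \<omega>)))\<^sup>2)"
  shows integrable_log_likelihood: "integrable (path_law M Y n)
      (\<lambda>y. ln (tilt_mass \<mu> (T n) (path_at y n) / drift_likelihood \<delta> f n y))"
    and integral_log_likelihood: "(\<integral>y. ln (tilt_mass \<mu> (T n) (path_at y n) / drift_likelihood \<delta> f n y) \<partial>path_law M Y n)
      = ent \<mu> (T n) + (\<Sum>k=1..n. \<delta> k / 2 * (expectation (\<lambda>\<omega>. (norm (f k (Y (k - 1) \<omega>)))\<^sup>2)
          - 2 * expectation (\<lambda>\<omega>. f k (Y (k - 1) \<omega>) \<bullet> X \<omega>)))"
proof -
  let ?F = "\<lambda>k \<omega>. f k (Y (k - 1) \<omega>)"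
  \<comment> \<open>The \<open>k\<close>-th Girsanov exponent along the comparison process, with its
    increment written as \<open>\<delta> k\<close> times \<open>X\<close> plus scaled noise.\<close>
  let ?s = "\<lambda>k \<omega>. \<delta> k * (?F k \<omega> \<bullet> X \<omega>) + sqrt (\<delta> k) * (?F k \<omega> \<bullet> N k \<omega>) - \<delta> k / 2 * (norm (?F k \<omega>))\<^sup>2"
  let ?L = "\<lambda>\<omega>. ln (tilt_mass \<mu> (T n) (Y n \<omega>)) - (\<Sum>k=1..n. ?s k \<omega>)"
  have adm: "admissible (T n) y" for y :: 'a using T_pos[OF n] by (simp add: admissible_def)
  have [measurable]: "drift_likelihood \<delta> f n \<in> borel_measurable (PiM {1..n} (\<lambda>_. borel))"
    by (rule drift_likelihood_measurable) (rule f)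
  have [measurable]: "(\<lambda>y. path_at y n) \<in> borel_measurable (PiM {1..n} (\<lambda>_. borel :: 'a measure))" by simp
  have Ym [measurable]: "(\<lambda>\<omega>. \<lambda>k\<in>{1..n}. Y k \<omega>) \<in> measurable M (PiM {1..n} (\<lambda>_. borel))"
    by (intro measurable_restrict) simp
  have at: "path_at (\<lambda>k\<in>{1..n}. Y k \<omega>) k = Y k \<omega>" if "k \<le> n" for k \<omega>
    using that by (auto simp: path_at_def)
  have step: "?F k \<omega> \<bullet> (Y k \<omega> - Y (k - 1) \<omega>) - \<delta> k / 2 * (norm (?F k \<omega>))\<^sup>2 = ?s k \<omega>" if "k \<in> {1..n}" for k \<omega>
    using that by (cases k) (simp_all add: inner_add)
  have eq: "ln (tilt_mass \<mu> (T n) (path_at y n) / drift_likelihood \<delta> f n y) = ?L \<omega>"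
    if "y = (\<lambda>k\<in>{1..n}. Y k \<omega>)" for y \<omega>
  proof -
    have "drift_likelihood \<delta> f n y = exp (\<Sum>k=1..n. ?s k \<omega>)"
      unfolding drift_likelihood_def that
    proof (intro arg_cong[where f=exp] sum.cong refl)
      fix k assume k: "k \<in> {1..n}"
      then have "k \<le> n" "k - 1 \<le> n" by auto
      then show "f k (path_at (\<lambda>k\<in>{1..n}. Y k \<omega>) (k - 1)) \<bullet> (path_at (\<lambda>k\<in>{1..n}. Y k \<omega>) k - path_at (\<lambda>k\<in>{1..n}. Y k \<omega>) (k - 1))
          - \<delta> k / 2 * (norm (f k (path_at (\<lambda>k\<in>{1..n}. Y k \<omega>) (k - 1))))\<^sup>2 = ?s k \<omega>"
        using step[OF k] by (simp only: at)
    qed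
    then show ?thesis
      using mu.tilt_mass_pos[OF adm, of "Y n \<omega>"] by (simp add: ln_div that at)
  qed
  have iX: "integrable M (\<lambda>\<omega>. ?F k \<omega> \<bullet> X \<omega>)" if "k \<in> {1..n}" for k
    using f[OF that] by (intro integrable_inner_L2 f_L2[OF that] X_L2) simp_all
  have iN: "integrable M (\<lambda>\<omega>. ?F k \<omega> \<bullet> N k \<omega>)" and eN: "expectation (\<lambda>\<omega>. ?F k \<omega> \<bullet> N k \<omega>) = 0"
    if "k \<in> {1..n}" for k
    using integrable_inner_noise[of k "f k"] expectation_inner_noise[of k "f k"] that f f_L2 by simp_all
  have i_s: "integrable M (?s k)" if "k \<in> {1..n}" for k
    using iX[OF that] iN[OF that] f_L2[OF that] by simp
  have es: "expectation (?s k) = \<delta> k * expectation (\<lambda>\<omega>. ?F k \<omega> \<bullet> X \<omega>) - \<delta> k / 2 * expectation (\<lambda>\<omega>. (norm (?F k \<omega>))\<^sup>2)"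
    if "k \<in> {1..n}" for k
    using iX[OF that] iN[OF that] f_L2[OF that] by (simp add: eN[OF that])
  have iln: "integrable M (\<lambda>\<omega>. ln (tilt_mass \<mu> (T n) (Y n \<omega>)))"
    and eln: "expectation (\<lambda>\<omega>. ln (tilt_mass \<mu> (T n) (Y n \<omega>))) = ent \<mu> (T n)"
    using integrable_Y_iff[of "\<lambda>y. ln (tilt_mass \<mu> (T n) y)" n] expectation_Y[of "\<lambda>y. ln (tilt_mass \<mu> (T n) y)" n]
      mu.integrable_ent[OF T_nonneg] by (simp_all add: ent_def)
  have isum: "integrable M (\<lambda>\<omega>. \<Sum>k=1..n. ?s k \<omega>)"
    by (rule Bochner_Integration.integrable_sum) (rule i_s)
  show "integrable (path_law M Y n) (\<lambda>y. ln (tilt_mass \<mu> (T n) (path_at y n) / drift_likelihood \<delta> f n y))"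
    unfolding path_law_def
    by (subst integrable_distr_eq[OF Ym], simp, subst eq[OF refl], rule Bochner_Integration.integrable_diff[OF iln isum])
  have "(\<integral>y. ln (tilt_mass \<mu> (T n) (path_at y n) / drift_likelihood \<delta> f n y) \<partial>path_law M Y n) = expectation ?L"
    unfolding path_law_def by (subst integral_distr[OF Ym], simp, subst eq[OF refl], rule refl)
  also have "\<dots> = ent \<mu> (T n) - (\<Sum>k=1..n. expectation (?s k))"
    using Bochner_Integration.integral_diff[OF iln isum] Bochner_Integration.integral_sum[of "{1..n}" M ?s, OF i_s] by (simp only: eln)
  also have "\<dots> = ent \<mu> (T n) + (\<Sum>k=1..n. - expectation (?s k))" by (simp add: sum_negf)
  also have "(\<Sum>k=1..n. - expectation (?s k)) = (\<Sum>k=1..n. \<delta> k / 2 * (expectation (\<lambda>\<omega>. (norm (?F k \<omega>))\<^sup>2) - 2 * expectation (\<lambda>\<omega>. ?F k \<omega> \<bullet> X \<omega>)))"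
    by (intro sum.cong refl, subst es) (simp_all add: algebra_simps)
  finally show "(\<integral>y. ln (tilt_mass \<mu> (T n) (path_at y n) / drift_likelihood \<delta> f n y) \<partial>path_law M Y n)
      = ent \<mu> (T n) + (\<Sum>k=1..n. \<delta> k / 2 * (expectation (\<lambda>\<omega>. (norm (f k (Y (k - 1) \<omega>)))\<^sup>2)
          - 2 * expectation (\<lambda>\<omega>. f k (Y (k - 1) \<omega>) \<bullet> X \<omega>)))" .
qed

end

text \<open>\<open>KL_divergence\<close> is a Bochner integral of a chosen derivative and has a
  value in every case. Absolute continuity and integrability of the log density are therefore part
  of the conclusion: they make the bounded number the genuine divergence. The first measure argument
  is the law of \<open>Z\<close>, the reference.\<close>

theorem theorem1:
  fixes M :: "'b measure" and M' :: "'c measure"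
    and X :: "'b \<Rightarrow> 'a::euclidean_space"
    and N :: "nat \<Rightarrow> 'b \<Rightarrow> 'a"
    and N' :: "nat \<Rightarrow> 'c \<Rightarrow> 'a"
    and \<delta> :: "nat \<Rightarrow> real"
    and f :: "nat \<Rightarrow> 'a \<Rightarrow> 'a"
    and n :: nat
  assumes M: "prob_space M" and M': "prob_space M'"
    and X_rv: "X \<in> borel_measurable M"
    and X_L2: "integrable M (\<lambda>\<omega>. (norm (X \<omega>))\<^sup>2)"
    and \<delta>_pos: "\<And>k. k \<ge> 1 \<Longrightarrow> \<delta> k > 0"
    and N_gauss: "\<And>k. k \<ge> 1 \<Longrightarrow> distributed M lborel (N k) (\<lambda>x. ennreal (std_gauss_density x))"
    and indep: "prob_space.indep_vars M (\<lambda>_. borel)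
                  (\<lambda>i. case i of None \<Rightarrow> X | Some k \<Rightarrow> N k) (insert None (Some ` {1..}))"
    and f_meas: "\<And>k. k \<ge> 1 \<Longrightarrow> f k \<in> borel_measurable borel"
    and N'_gauss: "\<And>k. k \<ge> 1 \<Longrightarrow> distributed M' lborel (N' k) (\<lambda>x. ennreal (std_gauss_density x))"
    and N'_indep: "prob_space.indep_vars M' (\<lambda>_. borel) N' {1..}"
    and n_pos: "n \<ge> 1"
    and f_L2: "\<And>k. k \<in> {1..n} \<Longrightarrow> integrable M (\<lambda>\<omega>. (norm (f k (Yproc \<delta> X N (k - 1) \<omega>)))\<^sup>2)"
  shows "absolutely_continuous (path_law M' (Zproc \<delta> f N') n) (path_law M (Yproc \<delta> X N) n)
    \<and> integrable (path_law M (Yproc \<delta> X N) n)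
        (entropy_density (exp 1) (path_law M' (Zproc \<delta> f N') n) (path_law M (Yproc \<delta> X N) n))
    \<and> KL_divergence (exp 1) (path_law M' (Zproc \<delta> f N') n) (path_law M (Yproc \<delta> X N) n)
      \<le> Max (\<delta> ` {1..n}) / 2 * trace_cov M X
        + (\<Sum>k=1..n. \<delta> k / 2 *
            prob_space.expectation M (\<lambda>\<omega>. (norm (f k (Yproc \<delta> X N (k - 1) \<omega>)
               - cond_exp_vec M (vimage_algebra (space M) (Yproc \<delta> X N (k - 1)) borel) X \<omega>))\<^sup>2))"
proof -
  interpret prob_space M by fact
  interpret comparison_process M X N \<delta>
    by unfold_locales (fact X_rv X_L2 \<delta>_pos N_gauss indep)+
  interpret M': prob_space M' by fact
  let ?R = "driftless_law \<delta> n :: (nat \<Rightarrow> 'a) measure"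
  let ?p = "\<lambda>y. tilt_mass \<mu> (T n) (path_at y n)" and ?q = "drift_likelihood \<delta> f n"
  let ?J = "\<lambda>k. fisher \<mu> (T k)"
  let ?e = "\<lambda>k. expectation (\<lambda>\<omega>. (norm (f k (Yproc \<delta> X N (k - 1) \<omega>)
    - cond_exp_vec M (vimage_algebra (space M) (Yproc \<delta> X N (k - 1)) borel) X \<omega>))\<^sup>2)"
  have f: "f k \<in> borel_measurable borel" if "k \<in> {1..n}" for k using f_meas that by simp
  have Z: "path_law M' (Zproc \<delta> f N') n = density ?R ?q"
    by (rule path_law_Zproc[OF M' \<delta>_pos f])
       (use N'_gauss M'.indep_vars_subset[OF N'_indep] in auto)
  have Y: "path_law M Y n = density ?R ?p"
    by (rule path_law_Yproc[OF n_pos])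
  have Zproc_m: "(\<lambda>\<omega>. \<lambda>k\<in>{1..n}. Zproc \<delta> f N' k \<omega>) \<in> measurable M' (PiM {1..n} (\<lambda>_. borel))"
    using f_meas M'.distr_std_gauss(2)[OF N'_gauss] by (intro measurable_restrict Zproc_measurable) auto
  have sf: "sigma_finite_measure (density ?R ?q)"
    unfolding Z[symmetric] path_law_def
    by (intro prob_space_imp_sigma_finite M'.prob_space_distr Zproc_m)
  have pm: "?p \<in> borel_measurable ?R"
    using measurable_compose[OF path_at_measurable[of n n] mu.tilt_mass_measurable] by (simp cong: measurable_cong_sets)
  have qm: "?q \<in> borel_measurable ?R"
    using drift_likelihood_measurable[of n f \<delta>, OF f] by (simp cong: measurable_cong_sets)
  have pp: "?p y > 0" for y
    using T_pos[OF n_pos] by (intro mu.tilt_mass_pos) (simp add: admissible_def)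
  have qp: "?q y > 0" for y by (simp add: drift_likelihood_def)
  note KL = KL_divergence_density[OF pm qm pp qp sf, folded Y Z, OF integrable_log_likelihood[OF n_pos f f_L2]]
  \<comment> \<open>Solved for the two terms in \<open>f\<close>, this turns each summand of the
    expected log-likelihood into regression error minus \<open>?J (k - 1)\<close>.\<close>
  have e: "?e k = expectation (\<lambda>\<omega>. (norm (f k (Y (k - 1) \<omega>)))\<^sup>2) - 2 * expectation (\<lambda>\<omega>. f k (Y (k - 1) \<omega>) \<bullet> X \<omega>) + ?J (k - 1)"
    if "k \<in> {1..n}" for k
    by (rule expectation_norm2_diff_post[OF f[OF that] f_L2[OF that]])
  have "KL_divergence (exp 1) (path_law M' (Zproc \<delta> f N') n) (path_law M Y n)
      = ent \<mu> (T n) + (\<Sum>k=1..n. \<delta> k / 2 * (?e k - ?J (k - 1)))"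
    using KL(3) integral_log_likelihood[OF n_pos f f_L2] e by simp
  \<comment> \<open>The entropy is bounded with \<open>?J k\<close> at the right end of each step,
    against \<open>?J (k - 1)\<close> from the regression error; the differences are what
    \<open>sum_fisher_increments_le\<close> bounds.\<close>
  also have "\<dots> \<le> (\<Sum>k=1..n. \<delta> k / 2 * ?J k) + (\<Sum>k=1..n. \<delta> k / 2 * (?e k - ?J (k - 1)))"
    using mu.ent_sum_le[of \<delta> n] \<delta>_pos by (simp add: less_imp_le)
  also have "\<dots> = (\<Sum>k=1..n. \<delta> k / 2 * (?J k - ?J (k - 1))) + (\<Sum>k=1..n. \<delta> k / 2 * ?e k)"
    by (simp add: right_diff_distrib sum_subtractf)
  also have "\<dots> \<le> Max (\<delta> ` {1..n}) / 2 * trace_cov M X + (\<Sum>k=1..n. \<delta> k / 2 * ?e k)"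
    using sum_fisher_increments_le[OF n_pos] by simp
  finally show ?thesis using KL(1,2) by blast
qed

end
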